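(* Let $M,M'\subseteq\mathbb{C}^{n+1}$ be real analytic hypersurfaces through $0$, given near $0$ in normal coordinates by $w=Q(z,\bar z,\bar w)$ and $w'=Q'(z',\bar z',\bar w')$ respectively, with complexifications $\mathcal{M}$ and $\mathcal{M}'$. Assume that $M'$ is finitely nondegenerate at $0$, and let $\mathcal{H}=(f,g,\tilde f,\tilde g)$ be a holomorphic Segre preserving map (HSPM), totally Segre nondegenerate at $0$, sending $(\mathcal{M},0)$ into $(\mathcal{M}',0)$. Write $\det\big(f_z(z,0)\big)=\sum_j p_j(z)$ and $\det\big(\tilde f_\chi(\chi,0)\big)=\sum_k q_k(\chi)$, where $p_l$ and $q_l$ are homogeneous polynomials of degree $l$. Choose $j_0$ so that $p_{j_0}\not\equiv 0$ but $p_j\equiv 0$ for $j<j_0$, and choose $k_0$ so that $q_{k_0}\not\equiv 0$ but $q_k\equiv 0$ for $k<k_0$. Then $j_0=k_0$, and $p_{j_0}(z)=c\,\overline{q}_{k_0}(z)$ for some nonzero constant $c$.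
   Context: Here $n\ge 1$, and everything is local near $0$. Coordinates on $\mathbb{C}^{n+1}\times\mathbb{C}^{n+1}$ are $(Z,\zeta)$ with $Z=(z,w)\in\mathbb{C}^n\times\mathbb{C}$, $\zeta=(\chi,\tau)\in\mathbb{C}^n\times\mathbb{C}$ (primed for the target). For a holomorphic function $\varphi$, $\overline{\varphi}(x):=\overline{\varphi(\bar x)}$; thus $\overline{q}_{k_0}$ is the polynomial obtained from $q_{k_0}$ by conjugating its coefficients. Normal coordinates: the real analytic hypersurface $M\subseteq\mathbb{C}^{n+1}$ is given near $0\in M$ by $w=Q(z,\bar z,\bar w)$, where $Q(z,\chi,\tau)$ is holomorphic near $0$ in $\mathbb{C}^n\times\mathbb{C}^n\times\mathbb{C}$ and $Q(0,\chi,\tau)\equiv Q(z,0,\tau)\equiv\tau$. Since $M$ is a real hypersurface, $Q(z,\chi,\overline{Q}(\chi,z,w))\equiv w$. Similarly for $M'$ and $Q'$. Complexification: $\mathcal{M}$ is the holomorphic hypersurface $\{(z,w,\chi,\tau): w=Q(z,\chi,\tau)\}$ in $\mathbb{C}^{2n+2}$ near $0$; similarly $\mathcal{M}'$ with $Q'$. HSPM: a holomorphic Segre preserving map sending $(\mathcal{M},0)$ into $(\mathcal{M}',0)$ is a holomorphic map, defined near $0$ in $\mathbb{C}^{2n+2}$, of the form $\mathcal{H}(z,w,\chi,\tau)=\big(H(z,w),\widetilde H(\chi,\tau)\big)=\big(f(z,w),g(z,w),\tilde f(\chi,\tau),\tilde g(\chi,\tau)\big)$ with $\mathcal{H}(0)=0$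 and $\mathcal{H}$ mapping $\mathcal{M}$ (near $0$) into $\mathcal{M}'$; here $f,\tilde f$ are $\mathbb{C}^n$-valued and $g,\tilde g$ are $\mathbb{C}$-valued holomorphic functions. ($\widetilde H$ need not be related to $\overline H$.) Totally Segre nondegenerate at $0$: $\det\big(f_z(z,0)\big)\not\equiv 0$ and $\det\big(\tilde f_\chi(\chi,0)\big)\not\equiv 0$. $M'$ finitely nondegenerate at $0$: there is an integer $K$ such that the matrix with rows $\big(Q'_{\chi'_j z'^\alpha}(0,0,0)\big)_{|\alpha|\le K}$, $1\le j\le n$, has rank $n$. *)

theory Defs
  imports "HOL-Analysis.Analysis"
begin

(* Complex vector spaces with a real structure: the complex scalar multiplication and the
   coordinatewise conjugation of C^m, available uniformly on complex, on complex ^ 'n and on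
   products such as C^n x C and (C^n x C) x (C^n x C). *)

class complex_space = real_normed_vector +
  fixes cscale :: "complex \<Rightarrow> 'a \<Rightarrow> 'a"
    and conj :: "'a \<Rightarrow> 'a"
  assumes cscale_add_right: "cscale a (x + y) = cscale a x + cscale a y"
    and cscale_add_left: "cscale (a + b) x = cscale a x + cscale b x"
    and cscale_cscale: "cscale a (cscale b x) = cscale (a * b) x"
    and cscale_of_real: "cscale (complex_of_real r) x = r *\<^sub>R x"
    and conj_add: "conj (x + y) = conj x + conj y"
    and conj_cscale: "conj (cscale a x) = cscale (cnj a) (conj x)"
    and conj_conj: "conj (conj x) = x"

instantiation complex :: complex_space
begin

definition cscale_complex :: "complex \<Rightarrow> complex \<Rightarrow> complex" where
  "cscale_complex a x = a * x"

definition conj_complex :: "complex \<Rightarrow> complex" where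
  "conj_complex x = cnj x"

instance
  by standard
    (simp_all add: cscale_complex_def conj_complex_def algebra_simps scaleR_conv_of_real)

end

instantiation vec :: (complex_space, finite) complex_space
begin

definition cscale_vec :: "complex \<Rightarrow> 'a ^ 'b \<Rightarrow> 'a ^ 'b" where
  "cscale_vec a x = (\<chi> i. cscale a (x $ i))"

definition conj_vec :: "'a ^ 'b \<Rightarrow> 'a ^ 'b" where
  "conj_vec x = (\<chi> i. conj (x $ i))"

instance
  by standard
    (simp_all add: cscale_vec_def conj_vec_def vec_eq_iff cscale_add_right cscale_add_left
      cscale_cscale cscale_of_real conj_add conj_cscale conj_conj)

end

instantiation prod :: (complex_space, complex_space) complex_space
begin

definition cscale_prod :: "complex \<Rightarrow> 'a \<times> 'b \<Rightarrow> 'a \<times> 'b" where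
  "cscale_prod a x = (cscale a (fst x), cscale a (snd x))"

definition conj_prod :: "'a \<times> 'b \<Rightarrow> 'a \<times> 'b" where
  "conj_prod x = (conj (fst x), conj (snd x))"

instance
  by standard
    (simp_all add: cscale_prod_def conj_prod_def prod_eq_iff cscale_add_right cscale_add_left
      cscale_cscale cscale_of_real conj_add conj_cscale conj_conj)

end

(* Germs at 0 are represented by total functions of which only the behaviour on some
   neighbourhood of 0 matters. *)

definition holomorphic_near :: "('a::complex_space \<Rightarrow> 'b::complex_space) \<Rightarrow> 'a \<Rightarrow> bool" where
  "holomorphic_near F x \<longleftrightarrow>
     (\<forall>\<^sub>F y in nhds x. \<exists>D. (F has_derivative D) (at y) \<and> (\<forall>c v. D (cscale c v) = cscale c (D v)))"

definition bar :: "('a::complex_space \<Rightarrow> 'b::complex_space) \<Rightarrow> 'a \<Rightarrow> 'b" where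
  "bar \<phi> x = conj (\<phi> (conj x))"

definition cpartial :: "'n::finite \<Rightarrow> (complex ^ 'n \<Rightarrow> complex) \<Rightarrow> complex ^ 'n \<Rightarrow> complex" where
  "cpartial i F x = deriv (\<lambda>t. F (x + axis i t)) 0"

(* Multi-indices are functions on the coordinate set.  The partial derivatives are taken in the
   order of an arbitrary enumeration of the coordinates, which is immaterial for functions
   holomorphic near the point of evaluation. *)

definition mabs :: "('n::finite \<Rightarrow> nat) \<Rightarrow> nat" where
  "mabs \<alpha> = (\<Sum>i\<in>UNIV. \<alpha> i)"

definition mpartial ::
    "('n::finite \<Rightarrow> nat) \<Rightarrow> (complex ^ 'n \<Rightarrow> complex) \<Rightarrow> complex ^ 'n \<Rightarrow> complex" where
  "mpartial \<alpha> F =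
     foldr (\<lambda>i G. (cpartial i ^^ \<alpha> i) G) (SOME xs. distinct xs \<and> set xs = (UNIV :: 'n set)) F"

definition homogeneous_polynomial :: "nat \<Rightarrow> (complex ^ 'n::finite \<Rightarrow> complex) \<Rightarrow> bool" where
  "homogeneous_polynomial l P \<longleftrightarrow>
     (\<exists>a :: ('n \<Rightarrow> nat) \<Rightarrow> complex.
        \<forall>z. P z = (\<Sum>\<alpha> | mabs \<alpha> = l. a \<alpha> * (\<Prod>i\<in>UNIV. (z $ i) ^ \<alpha> i)))"

(* Multi-indices are the extensional functions on Basis, so that each occurs exactly once. *)

definition real_analytic_at :: "('a::euclidean_space \<Rightarrow> real) \<Rightarrow> 'a \<Rightarrow> bool" where
  "real_analytic_at \<rho> p \<longleftrightarrow>
     (\<exists>a :: ('a \<Rightarrow> nat) \<Rightarrow> real. \<forall>\<^sub>F x in nhds p.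
        ((\<lambda>\<alpha>. a \<alpha> * (\<Prod>b\<in>Basis. ((x - p) \<bullet> b) ^ \<alpha> b)) has_sum \<rho> x)
          (Basis \<rightarrow>\<^sub>E (UNIV :: nat set)))"

definition real_analytic_hypersurface :: "'a::euclidean_space set \<Rightarrow> bool" where
  "real_analytic_hypersurface M \<longleftrightarrow>
     (\<forall>p\<in>M. \<exists>U \<rho>. open U \<and> p \<in> U \<and> (\<forall>x\<in>U. real_analytic_at \<rho> x) \<and>
        M \<inter> U = {x \<in> U. \<rho> x = 0} \<and>
        (\<exists>D. (\<rho> has_derivative D) (at p) \<and> D \<noteq> (\<lambda>_. 0)))"

(* The arguments of Q are (z, xi, tau), with xi in the place of the customary letter chi (which is
   the vector binder here).  The last conjunct is the reality condition
   Q(z, xi, bar Q(xi, z, w)) = w, which expresses that w = Q(z, conj z, conj w) defines a real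
   hypersurface. *)

definition normal_coordinates ::
    "((complex ^ 'n::finite) \<times> complex) set \<Rightarrow>
     ((complex ^ 'n) \<times> (complex ^ 'n) \<times> complex \<Rightarrow> complex) \<Rightarrow> bool" where
  "normal_coordinates M Q \<longleftrightarrow>
     holomorphic_near Q 0 \<and>
     (\<forall>\<^sub>F (z, w) in nhds 0. (z, w) \<in> M \<longleftrightarrow> w = Q (z, conj z, conj w)) \<and>
     (\<forall>\<^sub>F (\<xi>, \<tau>) in nhds 0. Q (0, \<xi>, \<tau>) = \<tau>) \<and>
     (\<forall>\<^sub>F (z, \<tau>) in nhds 0. Q (z, 0, \<tau>) = \<tau>) \<and>
     (\<forall>\<^sub>F (z, \<xi>, w) in nhds 0. Q (z, \<xi>, bar Q (\<xi>, z, w)) = w)"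

definition complexification ::
    "((complex ^ 'n::finite) \<times> (complex ^ 'n) \<times> complex \<Rightarrow> complex) \<Rightarrow>
     (((complex ^ 'n) \<times> complex) \<times> ((complex ^ 'n) \<times> complex)) set" where
  "complexification Q = {((z, w), (\<xi>, \<tau>)) | z w \<xi> \<tau>. w = Q (z, \<xi>, \<tau>)}"

definition segre_map ::
    "('a \<Rightarrow> 'b) \<Rightarrow> ('a \<Rightarrow> 'c) \<Rightarrow> ('a \<Rightarrow> 'b) \<Rightarrow> ('a \<Rightarrow> 'c) \<Rightarrow>
     'a \<times> 'a \<Rightarrow> ('b \<times> 'c) \<times> ('b \<times> 'c)" where
  "segre_map f g ft gt = (\<lambda>(Z, \<zeta>). ((f Z, g Z), (ft \<zeta>, gt \<zeta>)))"

definition HSPM ::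
    "((complex ^ 'n::finite) \<times> (complex ^ 'n) \<times> complex \<Rightarrow> complex) \<Rightarrow>
     ((complex ^ 'n) \<times> (complex ^ 'n) \<times> complex \<Rightarrow> complex) \<Rightarrow>
     ((complex ^ 'n) \<times> complex \<Rightarrow> complex ^ 'n) \<Rightarrow> ((complex ^ 'n) \<times> complex \<Rightarrow> complex) \<Rightarrow>
     ((complex ^ 'n) \<times> complex \<Rightarrow> complex ^ 'n) \<Rightarrow> ((complex ^ 'n) \<times> complex \<Rightarrow> complex) \<Rightarrow>
     bool" where
  "HSPM Q Q' f g ft gt \<longleftrightarrow>
     holomorphic_near (segre_map f g ft gt) 0 \<and>
     segre_map f g ft gt 0 = 0 \<and>
     (\<forall>\<^sub>F x in nhds 0. x \<in> complexification Q \<longrightarrow> segre_map f g ft gt x \<in> complexification Q')"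

(* jac_det f z is the determinant of the Jacobian f_z(z, 0). *)

definition jac_det :: "((complex ^ 'n::finite) \<times> complex \<Rightarrow> complex ^ 'n) \<Rightarrow> complex ^ 'n \<Rightarrow> complex" where
  "jac_det f z = det ((\<chi> i j. cpartial j (\<lambda>x. f (x, 0) $ i) z) :: complex ^ 'n ^ 'n)"

definition totally_segre_nondegenerate ::
    "((complex ^ 'n::finite) \<times> complex \<Rightarrow> complex ^ 'n) \<Rightarrow>
     ((complex ^ 'n) \<times> complex \<Rightarrow> complex ^ 'n) \<Rightarrow> bool" where
  "totally_segre_nondegenerate f ft \<longleftrightarrow>
     \<not> (\<forall>\<^sub>F z in nhds 0. jac_det f z = 0) \<and> \<not> (\<forall>\<^sub>F \<xi> in nhds 0. jac_det ft \<xi> = 0)"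

(* The rank of the matrix with rows j and columns alpha, |alpha| \<le> K, is the complex dimension of
   the span of its columns; vec.dim is the dimension over the field of scalars. *)

definition finitely_nondegenerate ::
    "((complex ^ 'n::finite) \<times> (complex ^ 'n) \<times> complex \<Rightarrow> complex) \<Rightarrow> bool" where
  "finitely_nondegenerate Q \<longleftrightarrow>
     (\<exists>K. vec.dim {(\<chi> j. mpartial \<alpha> (\<lambda>z. cpartial j (\<lambda>\<xi>. Q (z, \<xi>, 0)) 0) 0) :: complex ^ 'n
                   | \<alpha>. mabs \<alpha> \<le> K} = CARD('n))"

end

theory Submission
  imports Defs "HOL-Complex_Analysis.Complex_Singularities"
begin

text \<open>The whole argument takes place on the slice \<open>w = 0\<close> of the complexified source hypersurface. By the
reality condition this slice is parametrised by \<open>(z, \<xi>)\<close> with \<open>\<tau> = bar Q (\<xi>, z, 0)\<close>.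
Differentiating the equation \<open>g = Q' (f, ft, gt)\<close> of the image in the directions \<open>z\<close> tangent to the
hypersurface gives the identity of row vectors
\<open>A (z, \<xi>) \<cdot> J z = b (z, \<xi>) R (z, \<xi>)\<close> (lemma \<open>covector_identity\<close>). Here \<open>J z = f_z (z, 0)\<close>,
\<open>A\<close> is the covector \<open>Q'_{z'}\<close> at the image point, \<open>R\<close> is \<open>Q_z\<close>, and
\<open>b = g_w (z, 0) - A \<cdot> f_w (z, 0)\<close> is the factor by which the map rescales the contact form.

Two facts make this identity useful. The covector \<open>R\<close> depends on the source only, not on the map. And
since both hypersurfaces are real, \<open>(bar ft, bar gt, bar f, bar g)\<close> is again a Segre preserving
map between them (lemma \<open>segre_preserving_dual\<close>), so the same \<open>R\<close> also occurs in the identity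
\<open>A' \<cdot> J' = b' R\<close> with \<open>J' z = (bar ft)_z (z, 0)\<close>. Now choose \<open>n\<close> points \<open>\<xi>_i\<close> near \<open>0\<close> for
which the rows \<open>A (0, \<xi>_i)\<close> are linearly independent, write the two identities as matrix identities,
and eliminate the determinant of the rows \<open>R (z, \<xi>_i)\<close>. The result is
\<open>det (J z) = u z * det (J' z)\<close> with \<open>u\<close> continuous at \<open>0\<close>, as soon as \<open>b\<close> and \<open>b'\<close> do not
vanish at the origin (lemma \<open>det_ratio_continuous\<close>). Exchanging the roles of the two maps gives the reverse
divisibility, and comparing the lowest homogeneous terms of \<open>det (J z)\<close> and
\<open>det (J' z) = cnj (jac_det ft (conj z))\<close> proves the theorem, with \<open>c = u 0\<close>.

The points \<open>\<xi>_i\<close> exist because the components of \<open>A (0, \<xi>)\<close> are linearly independent functions of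
\<open>\<xi>\<close> (lemma \<open>covector_independent\<close>): a linear relation between them propagates from the image
of \<open>\<xi> \<mapsto> ft (\<xi>, 0)\<close>, which contains an open set, to a neighbourhood of \<open>0\<close>, and turns by the
reality condition into a relation between the functions \<open>Q'_{\<chi>_j} (z', 0, 0)\<close>, which finite nondegeneracy
forbids.

That \<open>b (0, 0) = g_w (0)\<close> is nonzero (transversality) is the delicate point. Suppose it vanishes. The function
\<open>g_w (z, 0)\<close> cannot vanish identically, since the identity would then force \<open>A = 0\<close>
(lemma \<open>gw_not_zero\<close>). Where \<open>det (J z)\<close> and \<open>g_w (z, 0)\<close> are both nonzero, \<open>b\<close> has no zero,
because \<open>b = 0\<close> there implies \<open>A = 0\<close> and hence \<open>b = g_w\<close>. Along a suitable complex line in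
\<open>z\<close> the only possible zero of \<open>b (z, \<xi>)\<close> is therefore \<open>z = 0\<close>, and the minimum modulus principle shows
that the zero at \<open>\<xi> = 0\<close> can only be explained by \<open>b (0, \<xi>) = 0\<close> for all small \<open>\<xi>\<close>
(lemma \<open>degenerate_imp_b_zero\<close>). But \<open>b (0, \<xi>) = gt_\<tau> (\<xi>, 0)\<close>, so the normal derivative of the dual map
vanishes identically, which has just been excluded.\<close>

section \<open>Complex differentiability and directional derivatives\<close>

lemma cscale_zero_left [simp]: "cscale 0 v = 0"
  using cscale_of_real[of 0 v] by simp

lemma cscale_one [simp]: "cscale 1 v = v"
  using cscale_of_real[of 1 v] by simp

lemma cscale_zero_right [simp]: "cscale c 0 = 0"
  using cscale_add_right[of c 0 0] by simp

lemma conj_zero [simp]: "conj 0 = 0"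
  using conj_add[of 0 0] by simp

lemma cscale_Pair [simp]: "cscale c (x, y) = (cscale c x, cscale c y)"
  by (simp add: cscale_prod_def)

lemma conj_Pair [simp]: "conj (x, y) = (conj x, conj y)"
  by (simp add: conj_prod_def)

lemma cscale_complex [simp]: "cscale c x = c * x"
  by (simp add: cscale_complex_def)

lemma conj_complex [simp]: "conj x = cnj x"
  by (simp add: conj_complex_def)

lemma cscale_nth [simp]: "cscale c x $ i = cscale c (x $ i)"
  by (simp add: cscale_vec_def)

lemma conj_nth [simp]: "conj x $ i = conj (x $ i)"
  by (simp add: conj_vec_def)

lemma cscale_axis: "cscale c (axis i a) = axis i (cscale c a)"
  by (simp add: vec_eq_iff axis_def)

lemma conj_axis: "conj (axis i a) = axis i (conj a)"
  by (simp add: vec_eq_iff axis_def)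

text \<open>The scalars form a two-dimensional real space, so boundedness in the scalar follows from its decomposition into real and
imaginary part.\<close>

lemma bounded_linear_cscale_left: "bounded_linear (\<lambda>t. cscale t v)"
proof -
  have "(\<lambda>t. cscale t v) = (\<lambda>t. Re t *\<^sub>R v + Im t *\<^sub>R cscale \<i> v)"
  proof (rule ext)
    fix t :: complex
    have "cscale t v = cscale (of_real (Re t)) v + cscale (of_real (Im t) * \<i>) v"
      by (simp add: cscale_add_left[symmetric] complex_eq[symmetric] mult.commute)
    then show "cscale t v = Re t *\<^sub>R v + Im t *\<^sub>R cscale \<i> v"
      by (simp only: cscale_cscale[symmetric] cscale_of_real)
  qed
  moreover have "bounded_linear (\<lambda>t. Re t *\<^sub>R v + Im t *\<^sub>R cscale \<i> v)"
    by (intro bounded_linear_add bounded_linear_scaleR_const bounded_linear_Re bounded_linear_Im)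
  ultimately show ?thesis by (rule ssubst[where P = bounded_linear])
qed

lemma bounded_linear_conj: "bounded_linear (conj :: 'a::{complex_space,euclidean_space} \<Rightarrow> 'a)"
proof -
  have "linear (conj :: 'a \<Rightarrow> 'a)"
  proof (rule linearI)
    show "conj (r *\<^sub>R x) = r *\<^sub>R conj x" for r and x :: 'a
      using conj_cscale[of "of_real r" x] by (simp only: cscale_of_real complex_cnj_complex_of_real)
  qed (rule conj_add)
  then show ?thesis by (rule linear_conv_bounded_linear[THEN iffD1])
qed

text \<open>This is \<^const>\<open>holomorphic_near\<close> at a single point, which is the form in which the chain rule composes.\<close>

definition cdiff :: "('a::complex_space \<Rightarrow> 'b::complex_space) \<Rightarrow> 'a \<Rightarrow> bool" where
  "cdiff F x \<longleftrightarrow> (\<exists>D. (F has_derivative D) (at x) \<and> (\<forall>c v. D (cscale c v) = cscale c (D v)))"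

lemma holomorphic_near_iff: "holomorphic_near F x \<longleftrightarrow> (\<forall>\<^sub>F y in nhds x. cdiff F y)"
  by (simp add: holomorphic_near_def cdiff_def)

lemma cdiff_isCont: "cdiff F x \<Longrightarrow> isCont F x"
  unfolding cdiff_def by (elim exE conjE, rule has_derivative_continuous)

lemma cdiff_compose:
  assumes "cdiff G x" "cdiff F (G x)"
  shows "cdiff (\<lambda>y. F (G y)) x"
proof -
  obtain D E where D: "(G has_derivative D) (at x)" "\<forall>c v. D (cscale c v) = cscale c (D v)"
    and E: "(F has_derivative E) (at (G x))" "\<forall>c v. E (cscale c v) = cscale c (E v)"
    using assms unfolding cdiff_def by blast
  have "((\<lambda>y. F (G y)) has_derivative (\<lambda>v. E (D v))) (at x)"
    by (rule has_derivative_compose[OF D(1) E(1)])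
  then show ?thesis unfolding cdiff_def using D(2) E(2) by (intro exI[of _ "\<lambda>v. E (D v)"]) simp
qed

lemma cdiff_Pair:
  assumes "cdiff F x" "cdiff G x"
  shows "cdiff (\<lambda>y. (F y, G y)) x"
proof -
  obtain D E where D: "(F has_derivative D) (at x)" "\<forall>c v. D (cscale c v) = cscale c (D v)"
    and E: "(G has_derivative E) (at x)" "\<forall>c v. E (cscale c v) = cscale c (E v)"
    using assms unfolding cdiff_def by blast
  have "((\<lambda>y. (F y, G y)) has_derivative (\<lambda>v. (D v, E v))) (at x)"
    by (rule has_derivative_Pair[OF D(1) E(1)])
  then show ?thesis unfolding cdiff_def using D(2) E(2) by (intro exI[of _ "\<lambda>v. (D v, E v)"]) simp
qed

lemma cdiff_bounded_linear:
  assumes "bounded_linear L" "\<And>c v. L (cscale c v) = cscale c (L v)"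
  shows "cdiff L x"
  unfolding cdiff_def
  by (intro exI[of _ L] conjI allI bounded_linear_imp_has_derivative assms)

lemma cdiff_const: "cdiff (\<lambda>_. k) x"
  unfolding cdiff_def by (intro exI[of _ "\<lambda>_. 0"]) simp

lemma cdiff_ident: "cdiff (\<lambda>y. y) x"
  by (rule cdiff_bounded_linear) (auto intro: bounded_linear_ident)

lemma cdiff_fst: "cdiff fst x"
  by (rule cdiff_bounded_linear) (auto intro: bounded_linear_fst simp: cscale_prod_def)

lemma cdiff_snd: "cdiff snd x"
  by (rule cdiff_bounded_linear) (auto intro: bounded_linear_snd simp: cscale_prod_def)

lemma cdiff_nth: "cdiff (\<lambda>y. y $ i) x"
  by (rule cdiff_bounded_linear) (auto intro: bounded_linear_vec_nth)

lemma cdiff_add: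
  assumes "cdiff F x" "cdiff G x"
  shows "cdiff (\<lambda>y. F y + G y) x"
proof -
  obtain D E where D: "(F has_derivative D) (at x)" "\<forall>c v. D (cscale c v) = cscale c (D v)"
    and E: "(G has_derivative E) (at x)" "\<forall>c v. E (cscale c v) = cscale c (E v)"
    using assms unfolding cdiff_def by blast
  have "((\<lambda>y. F y + G y) has_derivative (\<lambda>v. D v + E v)) (at x)"
    by (rule has_derivative_add[OF D(1) E(1)])
  then show ?thesis unfolding cdiff_def using D(2) E(2)
    by (intro exI[of _ "\<lambda>v. D v + E v"]) (simp add: cscale_add_right)
qed

lemma cdiff_line: "cdiff (\<lambda>t. x + cscale t v) t0"
proof -
  have "cdiff (\<lambda>t. cscale t v) t0"
    by (rule cdiff_bounded_linear[OF bounded_linear_cscale_left]) (simp only: cscale_cscale cscale_complex)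
  from cdiff_add[OF cdiff_const[of x] this] show ?thesis .
qed

lemma has_derivative_bar:
  fixes F :: "'a::{complex_space,euclidean_space} \<Rightarrow> 'b::{complex_space,euclidean_space}"
  assumes "(F has_derivative D) (at (conj x))"
  shows "(bar F has_derivative bar D) (at x)"
proof -
  have c: "(conj has_derivative conj) (at y)" for y :: 'a
    by (rule bounded_linear_imp_has_derivative[OF bounded_linear_conj])
  have c': "(conj has_derivative conj) (at y)" for y :: 'b
    by (rule bounded_linear_imp_has_derivative[OF bounded_linear_conj])
  have "((\<lambda>y. F (conj y)) has_derivative (\<lambda>v. D (conj v))) (at x)"
    by (rule has_derivative_compose[OF c assms])
  then have "((\<lambda>y. conj (F (conj y))) has_derivative (\<lambda>v. conj (D (conj v)))) (at x)"
    by (rule has_derivative_compose[OF _ c'])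
  moreover have "bar G = (\<lambda>y. conj (G (conj y)))" for G :: "'a \<Rightarrow> 'b"
    by (rule ext) (rule bar_def)
  ultimately show ?thesis by (simp only:)
qed

lemma bar_cscale:
  assumes "\<forall>c v. D (cscale c v) = cscale c (D v)"
  shows "\<forall>c v. bar D (cscale c v) = cscale c (bar D v)"
  using assms by (simp add: bar_def conj_cscale)

lemma cdiff_bar:
  fixes F :: "'a::{complex_space,euclidean_space} \<Rightarrow> 'b::{complex_space,euclidean_space}"
  assumes "cdiff F (conj x)"
  shows "cdiff (bar F) x"
  using assms has_derivative_bar bar_cscale unfolding cdiff_def by blast

lemma cdiff_imp_field_differentiable:
  fixes F :: "complex \<Rightarrow> complex"
  assumes "cdiff F x"
  shows "F field_differentiable (at x)"
proof -
  obtain D where D: "(F has_derivative D) (at x)" "\<forall>c v. D (cscale c v) = cscale c (D v)"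
    using assms unfolding cdiff_def by blast
  have "D v = D 1 * v" for v using D(2)[rule_format, of v 1] by (simp add: mult.commute)
  then have "D = (*) (D 1)" by (rule ext)
  then have "(F has_field_derivative D 1) (at x)" using D(1) unfolding has_field_derivative_def by metis
  then show ?thesis unfolding field_differentiable_def by blast
qed

lemma cdiff_imp_holomorphic:
  fixes F :: "complex \<Rightarrow> complex"
  assumes "\<And>x. x \<in> S \<Longrightarrow> cdiff F x"
  shows "F holomorphic_on S"
  unfolding holomorphic_on_def
  using assms cdiff_imp_field_differentiable field_differentiable_at_within by blast

text \<open>Directional derivatives are taken one complex line at a time, so that they make sense for functions that are only
known to be holomorphic along lines, and coincide with \<^const>\<open>cpartial\<close> for coordinate directions.\<close>

definition dird :: "'a::complex_space \<Rightarrow> ('a \<Rightarrow> complex) \<Rightarrow> 'a \<Rightarrow> complex" where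
  "dird v F x = deriv (\<lambda>t. F (x + cscale t v)) 0"

lemma dird_eq:
  assumes "(F has_derivative D) (at x)" "\<forall>c v. D (cscale c v) = cscale c (D v)"
  shows "dird v F x = D v"
proof -
  have a: "((\<lambda>t. x + cscale t v) has_derivative (\<lambda>t. 0 + cscale t v)) (at 0)"
    by (rule has_derivative_add[OF has_derivative_const
        bounded_linear_imp_has_derivative[OF bounded_linear_cscale_left]])
  have b: "(F has_derivative D) (at (x + cscale 0 v))"
    by (simp only: cscale_zero_left add_0_right assms(1))
  have "((\<lambda>t. F (x + cscale t v)) has_derivative (\<lambda>t. D (0 + cscale t v))) (at 0)"
    by (rule has_derivative_compose[OF a b])
  moreover have "(\<lambda>t. D (0 + cscale t v)) = (*) (D v)"
    by (rule ext) (simp only: add_0_left assms(2) cscale_complex mult.commute)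
  ultimately have "((\<lambda>t. F (x + cscale t v)) has_field_derivative (D v)) (at 0)"
    by (simp only: has_field_derivative_def)
  from DERIV_imp_deriv[OF this] show ?thesis by (simp only: dird_def)
qed

lemma dird_bar:
  fixes F :: "'a::{complex_space,euclidean_space} \<Rightarrow> complex"
  assumes "cdiff F (conj x)"
  shows "dird v (bar F) x = cnj (dird (conj v) F (conj x))"
proof -
  obtain D where D: "(F has_derivative D) (at (conj x))" "\<forall>c v. D (cscale c v) = cscale c (D v)"
    using assms unfolding cdiff_def by blast
  show ?thesis
    unfolding dird_eq[OF has_derivative_bar[OF D(1)] bar_cscale[OF D(2)]] dird_eq[OF D]
    by (simp add: bar_def)
qed

lemma cpartial_eq_dird: "cpartial i F = dird (axis i 1) F"
  by (rule ext) (simp only: cpartial_def dird_def cscale_axis cscale_complex mult_1_right)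

section \<open>Derivatives of holomorphic functions depending on a parameter\<close>

lemma deriv_eq_circlepath_integral:
  assumes "f holomorphic_on S" "open S" "cball 0 r \<subseteq> S" "r > 0"
  shows "deriv f 0 = 1 / (2 * of_real pi * \<i>) * contour_integral (circlepath 0 r) (\<lambda>u. f u / u\<^sup>2)"
proof -
  have "continuous_on (cball 0 r) f" "f holomorphic_on ball 0 r"
    using assms holomorphic_on_imp_continuous_on holomorphic_on_subset
    by (blast, meson ball_subset_cball holomorphic_on_subset subset_trans)
  then have "(f has_field_derivative (1 / (2 * of_real pi * \<i>) *
      contour_integral (circlepath 0 r) (\<lambda>u. f u / (u - 0)\<^sup>2))) (at 0)"
    by (rule Cauchy_derivative_integral_circlepath(2)) (use assms in auto)
  then show ?thesis by (simp add: DERIV_imp_deriv)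
qed

text \<open>Cauchy's formula turns the derivative at the centre into an integral over a small circle, which depends
continuously on the parameter.\<close>

lemma continuous_on_deriv_param:
  fixes K :: "'a::metric_space \<Rightarrow> complex \<Rightarrow> complex"
  assumes W: "open W" and cont: "continuous_on W (\<lambda>(x, t). K x t)"
    and hol: "\<And>x. K x holomorphic_on {t. (x, t) \<in> W}"
  shows "continuous_on {x. (x, 0) \<in> W} (\<lambda>x. deriv (K x) 0)"
proof (rule continuous_at_imp_continuous_on, clarify)
  fix x0 assume "(x0, 0) \<in> W"
  with W obtain A B where AB: "open A" "open B" "x0 \<in> A" "0 \<in> B" "A \<times> B \<subseteq> W"
    by (auto elim!: open_prod_elim)
  then obtain r where r: "r > 0" "cball 0 r \<subseteq> B" by (meson open_contains_cball)
  define c where "c = circlepath (0::complex) r"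
  have c_in: "c s \<in> B" "c s \<noteq> 0" for s
    using r by (auto simp: c_def circlepath norm_mult subset_iff)
  have c_cont: "continuous_on X c" for X
    unfolding c_def circlepath by (intro continuous_intros)
  have eq: "deriv (K x) 0 = 1 / (2 * of_real pi * \<i>) *
      integral (cbox 0 1) (\<lambda>s. K x (c s) / (c s)\<^sup>2 * (2 * of_real pi * \<i> * r * exp (2 * of_real pi * \<i> * s)))"
    if "x \<in> A" for x
  proof -
    have "K x holomorphic_on B" using hol AB(5) that by (auto intro: holomorphic_on_subset)
    then have "deriv (K x) 0 = 1 / (2 * of_real pi * \<i>) * contour_integral c (\<lambda>u. K x u / u\<^sup>2)"
      unfolding c_def by (rule deriv_eq_circlepath_integral[OF _ AB(2) r(2,1)])
    then show ?thesis
      by (simp add: contour_integral_integral c_def vector_derivative_circlepath cbox_interval)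
  qed
  have "continuous_on (A \<times> cbox (0::real) 1)
      (\<lambda>(x, s). K x (c s) / (c s)\<^sup>2 * (2 * of_real pi * \<i> * r * exp (2 * of_real pi * \<i> * s)))"
  proof -
    have "continuous_on (A \<times> cbox (0::real) 1) (\<lambda>p. case (fst p, c (snd p)) of (x, t) \<Rightarrow> K x t)"
      by (rule continuous_on_compose2[OF cont])
        (use AB(5) c_in in \<open>auto intro!: continuous_intros continuous_on_compose2[OF c_cont[of UNIV]]\<close>)
    then have 1: "continuous_on (A \<times> cbox (0::real) 1) (\<lambda>p. K (fst p) (c (snd p)))" by simp
    show ?thesis unfolding case_prod_beta
      by (intro continuous_intros 1 continuous_on_compose2[OF c_cont[of UNIV]]) (auto simp: c_in)
  qed
  from integral_continuous_on_param[OF this]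
  have "continuous_on A (\<lambda>x. deriv (K x) 0)"
    by (subst continuous_on_cong[OF refl eq]) (auto intro!: continuous_intros)
  then show "isCont (\<lambda>x. deriv (K x) 0) x0"
    using AB by (simp add: continuous_on_eq_continuous_at)
qed

text \<open>By Cauchy's formula and Morera's theorem: the integral of the derivative over a triangle in the parameter plane can be
interchanged with the integral over the circle, and the inner integral then vanishes because the integrand is
holomorphic in the parameter.\<close>

lemma holomorphic_on_deriv_param:
  fixes K :: "complex \<Rightarrow> complex \<Rightarrow> complex"
  assumes W: "open W" and cont: "continuous_on W (\<lambda>(s, t). K s t)"
    and hol: "\<And>s. K s holomorphic_on {t. (s, t) \<in> W}"
    and hol': "\<And>t. (\<lambda>s. K s t) holomorphic_on {s. (s, t) \<in> W}"
  shows "(\<lambda>s. deriv (K s) 0) holomorphic_on {s. (s, 0) \<in> W}"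
proof (rule analytic_imp_holomorphic, subst analytic_on_def, intro ballI)
  fix s0 assume "s0 \<in> {s. (s, 0) \<in> W}"
  then have "(s0, 0) \<in> W" by simp
  with W obtain A B where AB: "open A" "open B" "s0 \<in> A" "0 \<in> B" "A \<times> B \<subseteq> W"
    by (auto elim!: open_prod_elim)
  then obtain r where r: "r > 0" "cball 0 r \<subseteq> B" by (meson open_contains_cball)
  obtain e where e: "e > 0" "ball s0 e \<subseteq> A" using AB by (meson open_contains_ball)
  define c where "c = circlepath (0::complex) r"
  have im: "path_image c \<subseteq> B" "0 \<notin> path_image c" using r by (auto simp: c_def)
  have eq: "deriv (K s) 0 = 1 / (2 * of_real pi * \<i>) * contour_integral c (\<lambda>u. K s u / u\<^sup>2)"
    if "s \<in> A" for s
  proof -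
    have "K s holomorphic_on B" using hol AB(5) that by (auto intro: holomorphic_on_subset)
    then show ?thesis
      unfolding c_def by (rule deriv_eq_circlepath_integral[OF _ AB(2) r(2,1)])
  qed
  have dcont: "continuous_on {s. (s, 0) \<in> W} (\<lambda>s. deriv (K s) 0)"
    by (rule continuous_on_deriv_param[OF W cont hol])
  have "(\<lambda>s. deriv (K s) 0) analytic_on ball s0 e"
  proof (rule Morera_triangle)
    show "continuous_on (ball s0 e) (\<lambda>s. deriv (K s) 0)"
      by (rule continuous_on_subset[OF dcont]) (use e AB in auto)
    show "open (ball s0 e)" by simp
    (* The factor that Cauchy's formula puts under the integral is harmless, as the circle avoids 0. *)
    have Kcont: "continuous_on (A \<times> path_image c) (\<lambda>(s, u). K s u / u\<^sup>2)"
    proof -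
      have "continuous_on (A \<times> path_image c) (\<lambda>(s, u). K s u)"
        by (rule continuous_on_subset[OF cont]) (use AB(5) im in auto)
      then show ?thesis
        using im by (auto simp: case_prod_beta intro!: continuous_intros)
    qed
    have seg: "contour_integral (linepath p q) (\<lambda>s. deriv (K s) 0) =
          1 / (2 * of_real pi * \<i>) *
          contour_integral c (\<lambda>u. contour_integral (linepath p q) (\<lambda>s. K s u / u\<^sup>2)) \<and>
        (\<lambda>u. contour_integral (linepath p q) (\<lambda>s. K s u / u\<^sup>2)) contour_integrable_on c"
      if pq: "closed_segment p q \<subseteq> ball s0 e" for p q
    proof
      have pqA: "closed_segment p q \<subseteq> A" using pq e by blast
      have int: "(\<lambda>s. deriv (K s) 0) contour_integrable_on linepath p q"
        by (rule contour_integrable_continuous_linepath, rule continuous_on_subset[OF dcont])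
          (use pqA AB in auto)
      have "contour_integral c (\<lambda>u. contour_integral (linepath p q) (\<lambda>s. K s u / u\<^sup>2)) =
          contour_integral (linepath p q) (\<lambda>s. contour_integral c (\<lambda>u. K s u / u\<^sup>2))"
      proof (rule contour_integral_swap[symmetric])
        show "continuous_on (path_image (linepath p q) \<times> path_image c) (\<lambda>(s, u). K s u / u\<^sup>2)"
          by (rule continuous_on_subset[OF Kcont]) (use pqA in auto)
        show "continuous_on {0..1} (\<lambda>t. vector_derivative c (at t))"
          by (auto simp: c_def vector_derivative_circlepath intro!: continuous_intros)
      qed (auto simp: c_def)
      also have "\<dots> = contour_integral (linepath p q) (\<lambda>s. (2 * of_real pi * \<i>) * deriv (K s) 0)"
        by (rule contour_integral_eq) (use pqA eq in auto)
      also have "\<dots> = (2 * of_real pi * \<i>) * contour_integral (linepath p q) (\<lambda>s. deriv (K s) 0)"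
        by (rule contour_integral_lmul[OF int])
      finally show "contour_integral (linepath p q) (\<lambda>s. deriv (K s) 0) =
          1 / (2 * of_real pi * \<i>) *
          contour_integral c (\<lambda>u. contour_integral (linepath p q) (\<lambda>s. K s u / u\<^sup>2))"
        by simp
      have "continuous_on (path_image c)
          (\<lambda>u. integral (cbox 0 1) (\<lambda>x. K (linepath p q x) u / u\<^sup>2 * (q - p)))"
      proof (rule integral_continuous_on_param)
        have "linepath p q x \<in> A" if "x \<in> {0..1}" for x
          using pqA that linepath_in_path by blast
        then have "continuous_on (path_image c \<times> cbox 0 1)
            (\<lambda>y. case (linepath p q (snd y), fst y) of (s, u) \<Rightarrow> K s u / u\<^sup>2)"
          by (intro continuous_on_compose2[OF Kcont])
            (auto simp: linepath_def cbox_interval intro!: continuous_intros)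
        then have "continuous_on (path_image c \<times> cbox 0 1)
            (\<lambda>y. K (linepath p q (snd y)) (fst y) / (fst y)\<^sup>2)"
          by simp
        then show "continuous_on (path_image c \<times> cbox 0 1)
            (\<lambda>(u, x). K (linepath p q x) u / u\<^sup>2 * (q - p))"
          unfolding case_prod_beta by (rule continuous_on_mult_right)
      qed
      then have "continuous_on (path_image c) (\<lambda>u. contour_integral (linepath p q) (\<lambda>s. K s u / u\<^sup>2))"
        by (simp add: contour_integral_integral cbox_interval)
      then show "(\<lambda>u. contour_integral (linepath p q) (\<lambda>s. K s u / u\<^sup>2)) contour_integrable_on c"
        unfolding c_def by (rule contour_integrable_continuous_circlepath)
    qed
    fix a b d
    show "convex hull {a, b, d} \<subseteq> ball s0 e \<longrightarrow>
       contour_integral (linepath a b) (\<lambda>s. deriv (K s) 0) +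
       contour_integral (linepath b d) (\<lambda>s. deriv (K s) 0) +
       contour_integral (linepath d a) (\<lambda>s. deriv (K s) 0) = 0"
    proof
      assume sub: "convex hull {a, b, d} \<subseteq> ball s0 e"
      have "closed_segment p q \<subseteq> ball s0 e" if "{p, q} \<subseteq> {a, b, d}" for p q
        using hull_mono[OF that, of convex] sub by (metis segment_convex_hull subset_trans)
      then have segs: "closed_segment a b \<subseteq> ball s0 e" "closed_segment b d \<subseteq> ball s0 e"
          "closed_segment d a \<subseteq> ball s0 e"
        by simp_all
      have hullA: "convex hull {a, b, d} \<subseteq> A" using sub e(2) by (rule subset_trans)
      let ?I = "\<lambda>p q u. contour_integral (linepath p q) (\<lambda>s. K s u / u\<^sup>2)"
      have zero: "?I a b u + ?I b d u + ?I d a u = 0" if "u \<in> path_image c" for u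
      proof -
        have "(\<lambda>s. K s u / u\<^sup>2) holomorphic_on convex hull {a, b, d}"
          using that im AB(5) hullA
          by (intro holomorphic_intros holomorphic_on_subset[OF hol']) auto
        then have "((\<lambda>s. K s u / u\<^sup>2) has_contour_integral 0)
            (linepath a b +++ linepath b d +++ linepath d a)"
          by (rule Cauchy_theorem_triangle)
        then show ?thesis
          by (rule has_chain_integral_chain_integral3)
      qed
      have "contour_integral c (\<lambda>u. ?I a b u + ?I b d u + ?I d a u) = contour_integral c (\<lambda>u. 0)"
        by (rule contour_integral_eq) (rule zero)
      then have "contour_integral c (?I a b) + contour_integral c (?I b d) + contour_integral c (?I d a) = 0"
        using segs seg by (simp add: contour_integral_add contour_integrable_add)
      moreover have "contour_integral (linepath a b) (\<lambda>s. deriv (K s) 0) +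
          contour_integral (linepath b d) (\<lambda>s. deriv (K s) 0) +
          contour_integral (linepath d a) (\<lambda>s. deriv (K s) 0) =
          1 / (2 * of_real pi * \<i>) *
          (contour_integral c (?I a b) + contour_integral c (?I b d) + contour_integral c (?I d a))"
        using segs seg by (simp add: distrib_left)
      ultimately show "contour_integral (linepath a b) (\<lambda>s. deriv (K s) 0) +
          contour_integral (linepath b d) (\<lambda>s. deriv (K s) 0) +
          contour_integral (linepath d a) (\<lambda>s. deriv (K s) 0) = 0" by simp
    qed
  qed
  then show "\<exists>\<epsilon>>0. (\<lambda>s. deriv (K s) 0) holomorphic_on ball s0 \<epsilon>"
    using e analytic_imp_holomorphic by blast
qed

section \<open>Functions holomorphic along complex lines\<close>

text \<open>Continuity together with holomorphy along all complex lines is weaker on its face than complex differentiability, but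
it is closed under directional derivatives by one-variable arguments, and it suffices for the
identity theorem and the maximum principle, which only look at lines.\<close>

definition lhol :: "('a::complex_space \<Rightarrow> complex) \<Rightarrow> 'a set \<Rightarrow> bool" where
  "lhol G U \<longleftrightarrow> open U \<and> continuous_on U G \<and>
     (\<forall>x v. (\<lambda>t. G (x + cscale t v)) holomorphic_on {t. x + cscale t v \<in> U})"

lemma continuous_on_line: "continuous_on S (\<lambda>t. x + cscale t v)"
  by (intro continuous_intros bounded_linear.continuous_on[OF bounded_linear_cscale_left])

lemma open_line:
  assumes "open U"
  shows "open {t. x + cscale t v \<in> U}"
proof -
  have "open ((\<lambda>t. x + cscale t v) -` U)"
    by (rule open_vimage[OF assms continuous_on_line])
  then show ?thesis by (simp add: vimage_def)
qed

lemma convex_line: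
  assumes "convex U"
  shows "convex {t. x + cscale t v \<in> U}"
proof (rule convexI)
  fix s t :: complex and a b :: real
  assume st: "s \<in> {t. x + cscale t v \<in> U}" "t \<in> {t. x + cscale t v \<in> U}"
    and ab: "0 \<le> a" "0 \<le> b" "a + b = 1"
  interpret bounded_linear "\<lambda>t. cscale t v" by (rule bounded_linear_cscale_left)
  have "x + cscale (a *\<^sub>R s + b *\<^sub>R t) v = (a + b) *\<^sub>R x + cscale (a *\<^sub>R s + b *\<^sub>R t) v"
    using ab(3) by simp
  also have "\<dots> = a *\<^sub>R (x + cscale s v) + b *\<^sub>R (x + cscale t v)"
    by (simp only: add scaleR scaleR_add_left scaleR_add_right add_ac)
  also have "\<dots> \<in> U" using st ab by (intro convexD[OF assms]) auto
  finally show "a *\<^sub>R s + b *\<^sub>R t \<in> {t. x + cscale t v \<in> U}" by simp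
qed

lemma lhol_open: "lhol G U \<Longrightarrow> open U"
  and lhol_continuous: "lhol G U \<Longrightarrow> continuous_on U G"
  and lhol_line: "lhol G U \<Longrightarrow> (\<lambda>t. G (x + cscale t v)) holomorphic_on {t. x + cscale t v \<in> U}"
  by (auto simp: lhol_def)

lemma lhol_isCont: "lhol G U \<Longrightarrow> x \<in> U \<Longrightarrow> isCont G x"
  unfolding lhol_def using continuous_on_eq_continuous_at by blast

lemma lhol_cdiff:
  assumes "open U" "\<And>x. x \<in> U \<Longrightarrow> cdiff G x"
  shows "lhol G U"
  unfolding lhol_def
proof (intro conjI allI)
  show "continuous_on U G"
    using assms(2) by (auto intro!: continuous_at_imp_continuous_on cdiff_isCont)
  fix x v show "(\<lambda>t. G (x + cscale t v)) holomorphic_on {t. x + cscale t v \<in> U}"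
    by (rule cdiff_imp_holomorphic, rule cdiff_compose[OF cdiff_line]) (use assms in auto)
qed (rule assms)

lemma lhol_const: "open U \<Longrightarrow> lhol (\<lambda>_. k) U"
  by (simp add: lhol_def)

lemma lhol_add: "lhol G U \<Longrightarrow> lhol H U \<Longrightarrow> lhol (\<lambda>x. G x + H x) U"
  unfolding lhol_def by (auto intro!: continuous_intros holomorphic_intros)

lemma lhol_diff: "lhol G U \<Longrightarrow> lhol H U \<Longrightarrow> lhol (\<lambda>x. G x - H x) U"
  unfolding lhol_def by (auto intro!: continuous_intros holomorphic_intros)

lemma lhol_mult: "lhol G U \<Longrightarrow> lhol H U \<Longrightarrow> lhol (\<lambda>x. G x * H x) U"
  unfolding lhol_def by (auto intro!: continuous_intros holomorphic_intros)

lemma lhol_sum: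
  assumes "open U" "\<And>i. i \<in> I \<Longrightarrow> lhol (G i) U"
  shows "lhol (\<lambda>x. \<Sum>i\<in>I. G i x) U"
  using assms unfolding lhol_def by (auto intro!: continuous_intros holomorphic_intros)

lemma lhol_prod:
  assumes "open U" "\<And>i. i \<in> I \<Longrightarrow> lhol (G i) U"
  shows "lhol (\<lambda>x. \<Prod>i\<in>I. G i x) U"
  using assms unfolding lhol_def by (auto intro!: continuous_intros holomorphic_intros)

lemma lhol_det:
  fixes N :: "'a::complex_space \<Rightarrow> complex ^ 'n ^ 'n"
  assumes "open U" "\<And>i j. lhol (\<lambda>x. N x $ i $ j) U"
  shows "lhol (\<lambda>x. det (N x)) U"
  unfolding det_def by (intro lhol_sum lhol_mult lhol_prod lhol_const assms)

text \<open>Any point of a convex open set lies on a complex line through \<open>y\<close>, and the one-variable identity theorem applies to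
the convex slice.\<close>

lemma lhol_identity:
  assumes G: "lhol G U" and U: "convex U" "y \<in> U"
    and zero: "\<forall>\<^sub>F x in nhds y. G x = 0" and x: "x \<in> U"
  shows "G x = 0"
proof -
  obtain N where N: "open N" "y \<in> N" "\<And>x. x \<in> N \<Longrightarrow> G x = 0"
    using zero by (auto simp: eventually_nhds)
  let ?S = "{t. y + cscale t (x - y) \<in> U}"
  have "G (y + cscale 1 (x - y)) = 0"
  proof (rule analytic_continuation_open[where f = "\<lambda>t. G (y + cscale t (x - y))" and g = "\<lambda>_. 0"
        and s = "{t. y + cscale t (x - y) \<in> N \<inter> U}" and s' = ?S])
    show "open ?S" "open {t. y + cscale t (x - y) \<in> N \<inter> U}"
      by (intro open_line open_Int lhol_open[OF G] N(1))+
    show "connected ?S" by (rule convex_connected[OF convex_line[OF U(1)]])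
    have "0 \<in> {t. y + cscale t (x - y) \<in> N \<inter> U}" using N U by simp
    then show "{t. y + cscale t (x - y) \<in> N \<inter> U} \<noteq> {}" by blast
    show "(\<lambda>t. G (y + cscale t (x - y))) holomorphic_on ?S" by (rule lhol_line[OF G])
  qed (use N x in auto)
  then show ?thesis by simp
qed

lemma lhol_nonzero_mult:
  assumes G: "lhol G U" and H: "lhol H U" and U: "convex U"
    and nz: "x \<in> U" "G x \<noteq> 0" "y \<in> U" "H y \<noteq> 0"
  shows "\<exists>z\<in>U. G z \<noteq> 0 \<and> H z \<noteq> 0"
proof (rule ccontr)
  assume "\<not> (\<exists>z\<in>U. G z \<noteq> 0 \<and> H z \<noteq> 0)"
  then have *: "H z = 0" if "z \<in> U" "G z \<noteq> 0" for z using that by blast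
  have "\<forall>\<^sub>F z in nhds x. G z \<noteq> 0"
  proof -
    have "(G \<longlongrightarrow> G x) (at x)"
      using lhol_continuous[OF G] lhol_open[OF G] nz(1) continuous_on_eq_continuous_at isContD by blast
    then show ?thesis using tendsto_imp_eventually_ne nz(2) eventually_nhds_conv_at by blast
  qed
  moreover have "\<forall>\<^sub>F z in nhds x. z \<in> U"
    using lhol_open[OF G] nz(1) by (rule eventually_nhds_in_open)
  ultimately have "\<forall>\<^sub>F z in nhds x. H z = 0" by eventually_elim (rule *)
  then have "H y = 0" by (rule lhol_identity[OF H U nz(1) _ nz(3)])
  with nz show False by simp
qed

lemma lhol_isolated_zero:
  assumes G: "lhol G U" and U: "convex U" "0 \<in> U" and v: "v \<in> U" "G v \<noteq> 0"
  shows "\<forall>\<^sub>F s in at 0. G (cscale s v) \<noteq> 0 \<and> cscale s v \<in> U"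
proof -
  let ?S = "{t. 0 + cscale t v \<in> U}"
  have "\<forall>\<^sub>F s in at 0. G (0 + cscale s v) \<noteq> 0 \<and> s \<in> ?S"
  proof (rule non_zero_neighbour_alt)
    show "(\<lambda>t. G (0 + cscale t v)) holomorphic_on ?S" by (rule lhol_line[OF G])
    show "open ?S" by (rule open_line[OF lhol_open[OF G]])
    show "connected ?S" by (rule convex_connected[OF convex_line[OF U(1)]])
    show "0 \<in> ?S" "1 \<in> ?S" "G (0 + cscale 1 v) \<noteq> 0" using U v by auto
  qed
  then show ?thesis by simp
qed

lemma lhol_slice_right:
  assumes "lhol G (U \<times> V)" "open V" "a \<in> U"
  shows "lhol (\<lambda>y. G (a, y)) V"
  unfolding lhol_def
proof (intro conjI allI)
  show "continuous_on V (\<lambda>y. G (a, y))"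
    by (rule continuous_on_compose2[OF lhol_continuous[OF assms(1)]])
      (use assms in \<open>auto intro!: continuous_intros\<close>)
  fix x v
  show "(\<lambda>t. G (a, x + cscale t v)) holomorphic_on {t. x + cscale t v \<in> V}"
    using lhol_line[OF assms(1), of "(a, x)" "(0, v)"] assms by simp
qed (rule assms)

lemma lhol_slice_left:
  assumes "lhol G (U \<times> V)" "open U" "b \<in> V"
  shows "lhol (\<lambda>x. G (x, b)) U"
  unfolding lhol_def
proof (intro conjI allI)
  show "continuous_on U (\<lambda>y. G (y, b))"
    by (rule continuous_on_compose2[OF lhol_continuous[OF assms(1)]])
      (use assms in \<open>auto intro!: continuous_intros\<close>)
  fix x v
  show "(\<lambda>t. G (x + cscale t v, b)) holomorphic_on {t. x + cscale t v \<in> U}"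
    using lhol_line[OF assms(1), of "(x, b)" "(v, 0)"] assms by simp
qed (rule assms)

lemma lhol_compose_fst:
  assumes "lhol G U" "open V"
  shows "lhol (\<lambda>p. G (fst p)) (U \<times> V)"
  unfolding lhol_def
proof (intro conjI allI)
  show "open (U \<times> V)" using assms lhol_open by (blast intro: open_Times)
  show "continuous_on (U \<times> V) (\<lambda>p. G (fst p))"
    by (rule continuous_on_compose2[OF lhol_continuous[OF assms(1)]]) (auto intro!: continuous_intros)
  fix x v :: "'a \<times> 'b"
  show "(\<lambda>t. G (fst (x + cscale t v))) holomorphic_on {t. x + cscale t v \<in> U \<times> V}"
    using lhol_line[OF assms(1), of "fst x" "fst v"]
    by (auto simp: cscale_prod_def mem_Times_iff intro: holomorphic_on_subset)
qed

text \<open>The common source of \<open>lhol_dird\<close> and \<open>lhol_dird_compose\<close>: the direction of differentiation is the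
second variable, and every line in the first variable reduces to a function of two complex variables.\<close>

lemma lhol_deriv_param:
  fixes K :: "'a::complex_space \<Rightarrow> complex \<Rightarrow> complex"
  assumes W: "open W" and cont: "continuous_on W (\<lambda>(x, t). K x t)"
    and hol: "\<And>x. K x holomorphic_on {t. (x, t) \<in> W}"
    and hol': "\<And>x v t. (\<lambda>s. K (x + cscale s v) t) holomorphic_on {s. (x + cscale s v, t) \<in> W}"
  shows "lhol (\<lambda>x. deriv (K x) 0) {x. (x, 0) \<in> W}"
  unfolding lhol_def
proof (intro conjI allI)
  have "open ((\<lambda>x. (x, 0::complex)) -` W)"
    by (rule open_vimage[OF W]) (intro continuous_intros)
  then show "open {x. (x, 0) \<in> W}" by (simp add: vimage_def)
  show "continuous_on {x. (x, 0) \<in> W} (\<lambda>x. deriv (K x) 0)"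
    by (rule continuous_on_deriv_param[OF W cont hol])
  fix x v
  define W' where "W' = (\<lambda>(s, t). (x + cscale s v, t)) -` W"
  have c: "continuous_on S (\<lambda>(s::complex, t::complex). (x + cscale s v, t))" for S
    unfolding case_prod_beta
    by (intro continuous_intros bounded_linear.continuous_on[OF bounded_linear_cscale_left])
  have "(\<lambda>s. deriv ((\<lambda>s. K (x + cscale s v)) s) 0) holomorphic_on {s. (s, 0) \<in> W'}"
  proof (rule holomorphic_on_deriv_param)
    show "open W'" unfolding W'_def by (rule open_vimage[OF W c])
    have "continuous_on W' (\<lambda>p. case (case p of (s, t) \<Rightarrow> (x + cscale s v, t)) of (x, t) \<Rightarrow> K x t)"
      by (rule continuous_on_compose2[OF cont c]) (auto simp: W'_def)
    then show "continuous_on W' (\<lambda>(s, t). K (x + cscale s v) t)" by (simp add: case_prod_beta)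
    show "K (x + cscale s v) holomorphic_on {t. (s, t) \<in> W'}" for s
      using hol by (simp add: W'_def)
    show "(\<lambda>s. K (x + cscale s v) t) holomorphic_on {s. (s, t) \<in> W'}" for t
      using hol' by (simp add: W'_def)
  qed
  then show "(\<lambda>t. deriv (K (x + cscale t v)) 0) holomorphic_on {t. x + cscale t v \<in> {x. (x, 0) \<in> W}}"
    by (simp add: W'_def)
qed

lemma lhol_dird:
  assumes G: "lhol G U"
  shows "lhol (dird e G) U"
proof -
  define W where "W = {(x, t). x + cscale t e \<in> U}"
  have c: "continuous_on S (\<lambda>(x, t). x + cscale t e)" for S
    unfolding case_prod_beta
    by (intro continuous_intros bounded_linear.continuous_on[OF bounded_linear_cscale_left])
  have "lhol (\<lambda>x. deriv ((\<lambda>x t. G (x + cscale t e)) x) 0) {x. (x, 0) \<in> W}"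
  proof (rule lhol_deriv_param)
    have "open ((\<lambda>(x, t). x + cscale t e) -` U)" by (rule open_vimage[OF lhol_open[OF G] c])
    also have "(\<lambda>(x, t). x + cscale t e) -` U = W" by (auto simp: W_def)
    finally show "open W" .
    have "continuous_on W (\<lambda>p. G (case p of (x, t) \<Rightarrow> x + cscale t e))"
      by (rule continuous_on_compose2[OF lhol_continuous[OF G] c]) (auto simp: W_def)
    then show "continuous_on W (\<lambda>(x, t). G (x + cscale t e))" by (simp add: case_prod_beta)
    show "(\<lambda>t. G (x + cscale t e)) holomorphic_on {t. (x, t) \<in> W}" for x
      using lhol_line[OF G, of x e] by (simp add: W_def)
    show "(\<lambda>s. G (x + cscale s v + cscale t e)) holomorphic_on {s. (x + cscale s v, t) \<in> W}" for x v t
      using lhol_line[OF G, of "x + cscale t e" v] by (simp add: W_def add_ac)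
  qed
  then show ?thesis by (simp add: W_def dird_def[abs_def])
qed

text \<open>The composite of a directional derivative with a complex differentiable map is covered directly, by differentiating
\<open>F (y x + cscale t e)\<close> in \<open>t\<close>. This avoids having to know that a directional derivative is itself
complex differentiable.\<close>

lemma lhol_dird_compose:
  assumes U: "open U" "\<And>x. x \<in> U \<Longrightarrow> cdiff F x"
    and V: "open V" "\<And>x. x \<in> V \<Longrightarrow> cdiff y x" "\<And>x. x \<in> V \<Longrightarrow> y x \<in> U"
  shows "lhol (\<lambda>x. dird e F (y x)) V"
proof -
  define W where "W = {(x, t). x \<in> V \<and> y x + cscale t e \<in> U}"
  have ycont: "continuous_on V y"
    using V(2) by (auto intro!: continuous_at_imp_continuous_on cdiff_isCont)
  have c: "continuous_on (V \<times> UNIV) (\<lambda>(x, t). y x + cscale t e)"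
    unfolding case_prod_beta
    by (intro continuous_intros bounded_linear.continuous_on[OF bounded_linear_cscale_left]
        continuous_on_compose2[OF ycont]) auto
  have cF: "continuous_on U F"
    using U(2) by (auto intro!: continuous_at_imp_continuous_on cdiff_isCont)
  have "lhol (\<lambda>x. deriv ((\<lambda>x t. F (y x + cscale t e)) x) 0) {x. (x, 0) \<in> W}"
  proof (rule lhol_deriv_param)
    have "open ((\<lambda>(x, t). y x + cscale t e) -` U \<inter> (V \<times> UNIV))"
      using c U V continuous_on_open_vimage[of "V \<times> UNIV" "\<lambda>(x, t). y x + cscale t e"]
      by (auto simp: open_Times)
    also have "(\<lambda>(x, t). y x + cscale t e) -` U \<inter> (V \<times> UNIV) = W" by (auto simp: W_def)
    finally show "open W" .
    have "continuous_on W (\<lambda>p. F (case p of (x, t) \<Rightarrow> y x + cscale t e))"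
      by (rule continuous_on_compose2[OF cF continuous_on_subset[OF c]]) (auto simp: W_def)
    then show "continuous_on W (\<lambda>(x, t). F (y x + cscale t e))" by (simp add: case_prod_beta)
    show "(\<lambda>t. F (y x + cscale t e)) holomorphic_on {t. (x, t) \<in> W}" for x
      by (rule cdiff_imp_holomorphic, rule cdiff_compose[OF cdiff_line]) (auto simp: W_def U)
    show "(\<lambda>s. F (y (x + cscale s v) + cscale t e)) holomorphic_on {s. (x + cscale s v, t) \<in> W}" for x v t
    proof (rule cdiff_imp_holomorphic, rule cdiff_compose[OF cdiff_add[OF cdiff_compose[OF cdiff_line] cdiff_const]])
      fix s assume "s \<in> {s. (x + cscale s v, t) \<in> W}"
      then show "cdiff y (x + cscale s v)" "cdiff F (y (x + cscale s v) + cscale t e)"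
        using U V by (auto simp: W_def)
    qed
  qed
  then show ?thesis using V(3) by (simp add: W_def dird_def[abs_def] cong: conj_cong)
qed

section \<open>Segre preserving maps and their duals\<close>

lemma eventually_nhds_compose:
  assumes "eventually P (nhds (h a))" "isCont h a"
  shows "\<forall>\<^sub>F x in nhds a. P (h x)"
proof -
  have "(h \<longlongrightarrow> h a) (nhds a)"
    using assms(2) by (simp add: isCont_def tendsto_at_iff_tendsto_nhds)
  then show ?thesis using assms(1) by (simp add: filterlim_iff)
qed

lemma eventually_nhds_0_ball:
  fixes P :: "'a::real_normed_vector \<Rightarrow> bool"
  assumes "\<forall>\<^sub>F x in nhds 0. P x"
  shows "\<exists>r>0. \<forall>x\<in>ball 0 r. P x"
proof -
  obtain S where "open S" "0 \<in> S" "\<forall>x\<in>S. P x" using assms by (auto simp: eventually_nhds)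
  then show ?thesis by (meson open_contains_ball subsetD)
qed

lemma eventually_nhds_0_ball_Times:
  fixes P :: "'a::real_normed_vector \<times> 'b::real_normed_vector \<Rightarrow> bool"
  assumes "\<forall>\<^sub>F p in nhds 0. P p"
  shows "\<exists>r>0. \<forall>p\<in>ball 0 r \<times> ball 0 r. P p"
proof -
  obtain S where S: "open S" "(0, 0) \<in> S" "\<forall>x\<in>S. P x"
    using assms by (auto simp: eventually_nhds zero_prod_def)
  then obtain U V where UV: "open U" "open V" "0 \<in> U" "0 \<in> V" "U \<times> V \<subseteq> S"
    by (auto elim!: open_prod_elim)
  then obtain r s where rs: "r > 0" "ball 0 r \<subseteq> U" "s > 0" "ball 0 s \<subseteq> V" by (meson open_contains_ball)
  show ?thesis
    by (rule exI[of _ "min r s"]) (use rs UV S in \<open>auto simp: subset_iff\<close>)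
qed

lemma continuous_conj [continuous_intros]:
  fixes h :: "'a::t2_space \<Rightarrow> 'b::{complex_space,euclidean_space}"
  shows "continuous F h \<Longrightarrow> continuous F (\<lambda>x. conj (h x))"
  by (rule bounded_linear.continuous[OF bounded_linear_conj])

lemma vec_expansion:
  fixes v :: "complex ^ 'n"
  shows "v = (\<Sum>k\<in>UNIV. cscale (v $ k) (axis k 1))"
  by (simp add: vec_eq_iff axis_def if_distrib cong: if_cong)

lemma dird_nth:
  assumes "(F has_derivative D) (at x)" "\<forall>c v. D (cscale c v) = cscale c (D v)"
  shows "dird v (\<lambda>y. F y $ k) x = D v $ k"
proof (rule dird_eq)
  show "((\<lambda>y. F y $ k) has_derivative (\<lambda>v. D v $ k)) (at x)"
    by (rule bounded_linear.has_derivative[OF bounded_linear_vec_nth assms(1)])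
qed (use assms(2) in simp)

lemma clinear_fst_expansion:
  fixes D :: "(complex ^ 'n) \<times> 'b::complex_space \<Rightarrow> complex"
  assumes "linear D" "\<forall>c v. D (cscale c v) = cscale c (D v)"
  shows "D (v, 0) = (\<Sum>k\<in>UNIV. v $ k * D (axis k 1, 0))"
proof -
  have "(v, 0 :: 'b) = (\<Sum>k\<in>UNIV. cscale (v $ k) (axis k 1, 0))"
    using vec_expansion[of v] by (simp add: prod_eq_iff fst_sum snd_sum)
  then have "D (v, 0) = (\<Sum>k\<in>UNIV. D (cscale (v $ k) (axis k 1, 0)))"
    by (simp only: linear_sum[OF assms(1)])
  then show ?thesis by (simp only: assms(2) cscale_complex)
qed

text \<open>The content of \<^const>\<open>HSPM\<close> with the complexification of the source parametrised by
\<open>(z, \<xi>, \<tau>)\<close>, as an equation of germs of functions.\<close>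

definition segre_preserving ::
    "((complex ^ 'n::finite) \<times> (complex ^ 'n) \<times> complex \<Rightarrow> complex) \<Rightarrow>
     ((complex ^ 'n) \<times> (complex ^ 'n) \<times> complex \<Rightarrow> complex) \<Rightarrow>
     ((complex ^ 'n) \<times> complex \<Rightarrow> complex ^ 'n) \<Rightarrow> ((complex ^ 'n) \<times> complex \<Rightarrow> complex) \<Rightarrow>
     ((complex ^ 'n) \<times> complex \<Rightarrow> complex ^ 'n) \<Rightarrow> ((complex ^ 'n) \<times> complex \<Rightarrow> complex) \<Rightarrow>
     bool" where
  "segre_preserving Q Q' f g ft gt \<longleftrightarrow>
     holomorphic_near f 0 \<and> holomorphic_near g 0 \<and> holomorphic_near ft 0 \<and> holomorphic_near gt 0 \<and>
     f 0 = 0 \<and> g 0 = 0 \<and> ft 0 = 0 \<and> gt 0 = 0 \<and>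
     (\<forall>\<^sub>F (z, \<xi>, \<tau>) in nhds 0.
        g (z, Q (z, \<xi>, \<tau>)) = Q' (f (z, Q (z, \<xi>, \<tau>)), ft (\<xi>, \<tau>), gt (\<xi>, \<tau>)))"

lemma normal_coordinatesD:
  assumes "normal_coordinates M Q"
  shows "\<forall>\<^sub>F p in nhds 0. cdiff Q p"
    and "\<forall>\<^sub>F p in nhds 0. Q (0, fst p, snd p) = snd p"
    and "\<forall>\<^sub>F p in nhds 0. Q (fst p, 0, snd p) = snd p"
    and "\<forall>\<^sub>F p in nhds 0. Q (fst p, fst (snd p), bar Q (fst (snd p), fst p, snd (snd p))) = snd (snd p)"
    and "Q 0 = 0"
proof -
  show "\<forall>\<^sub>F p in nhds 0. Q (0, fst p, snd p) = snd p"
    and "\<forall>\<^sub>F p in nhds 0. Q (fst p, 0, snd p) = snd p"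
    and "\<forall>\<^sub>F p in nhds 0. Q (fst p, fst (snd p), bar Q (fst (snd p), fst p, snd (snd p))) = snd (snd p)"
    and "\<forall>\<^sub>F p in nhds 0. cdiff Q p"
    using assms unfolding normal_coordinates_def case_prod_beta holomorphic_near_iff by blast+
  from eventually_nhds_x_imp_x[OF this(1)] show "Q 0 = 0" by (simp add: zero_prod_def)
qed

lemma HSPM_imp_segre_preserving:
  fixes f :: "(complex ^ 'n::finite) \<times> complex \<Rightarrow> complex ^ 'n"
  assumes H: "HSPM Q Q' f g ft gt" and Q: "normal_coordinates M Q"
  shows "segre_preserving Q Q' f g ft gt"
proof -
  let ?H = "segre_map f g ft gt"
  have hol: "\<forall>\<^sub>F x in nhds 0. cdiff ?H x" and zero: "?H 0 = 0"
    and map: "\<forall>\<^sub>F x in nhds 0. x \<in> complexification Q \<longrightarrow> ?H x \<in> complexification Q'"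
    using H by (auto simp: HSPM_def holomorphic_near_iff)
  have left: "\<forall>\<^sub>F Z in nhds 0. cdiff ?H (Z, 0)"
    by (rule eventually_nhds_compose[where h = "\<lambda>Z. (Z, 0)"])
      (use hol in \<open>auto simp: zero_prod_def intro!: continuous_intros\<close>)
  have right: "\<forall>\<^sub>F \<zeta> in nhds 0. cdiff ?H (0, \<zeta>)"
    by (rule eventually_nhds_compose[where h = "\<lambda>\<zeta>. (0, \<zeta>)"])
      (use hol in \<open>auto simp: zero_prod_def intro!: continuous_intros\<close>)
  have "\<forall>\<^sub>F Z in nhds 0. cdiff f Z \<and> cdiff g Z"
  using left proof eventually_elim
    case (elim Z)
    have 1: "cdiff (\<lambda>Z. ?H (Z, 0)) Z"
      by (rule cdiff_compose[OF cdiff_Pair[OF cdiff_ident cdiff_const] elim])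
    have 2: "cdiff (\<lambda>Z. fst (fst (?H (Z, 0)))) Z" "cdiff (\<lambda>Z. snd (fst (?H (Z, 0)))) Z"
      by (rule cdiff_compose[OF cdiff_compose[OF 1 cdiff_fst] cdiff_fst],
          rule cdiff_compose[OF cdiff_compose[OF 1 cdiff_fst] cdiff_snd])
    then show ?case by (simp add: segre_map_def)
  qed
  moreover have "\<forall>\<^sub>F Z in nhds 0. cdiff ft Z \<and> cdiff gt Z"
  using right proof eventually_elim
    case (elim Z)
    have 1: "cdiff (\<lambda>Z. ?H (0, Z)) Z"
      by (rule cdiff_compose[OF cdiff_Pair[OF cdiff_const cdiff_ident] elim])
    have 2: "cdiff (\<lambda>Z. fst (snd (?H (0, Z)))) Z" "cdiff (\<lambda>Z. snd (snd (?H (0, Z)))) Z"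
      by (rule cdiff_compose[OF cdiff_compose[OF 1 cdiff_snd] cdiff_fst],
          rule cdiff_compose[OF cdiff_compose[OF 1 cdiff_snd] cdiff_snd])
    then show ?case by (simp add: segre_map_def)
  qed
  moreover have "f 0 = 0 \<and> g 0 = 0 \<and> ft 0 = 0 \<and> gt 0 = 0"
    using zero by (simp add: segre_map_def zero_prod_def)
  moreover have "\<forall>\<^sub>F p in nhds 0. case p of (z, \<xi>, \<tau>) \<Rightarrow>
      g (z, Q (z, \<xi>, \<tau>)) = Q' (f (z, Q (z, \<xi>, \<tau>)), ft (\<xi>, \<tau>), gt (\<xi>, \<tau>))"
  proof -
    have "isCont Q 0"
      using eventually_nhds_x_imp_x[OF normal_coordinatesD(1)[OF Q]] cdiff_isCont by blast
    then have c: "isCont (\<lambda>p. ((fst p, Q p), snd p)) 0"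
      by (intro continuous_intros)
    have h0: "((fst 0, Q 0), snd 0) = 0"
      using normal_coordinatesD(5)[OF Q] by (simp add: zero_prod_def)
    have "\<forall>\<^sub>F x in nhds ((fst 0, Q 0), snd 0).
        x \<in> complexification Q \<longrightarrow> ?H x \<in> complexification Q'"
      unfolding h0 by (rule map)
    then have "\<forall>\<^sub>F p in nhds 0. ((fst p, Q p), snd p) \<in> complexification Q \<longrightarrow>
        ?H ((fst p, Q p), snd p) \<in> complexification Q'"
      by (rule eventually_nhds_compose[where h = "\<lambda>p. ((fst p, Q p), snd p)"]) (rule c)
    then show ?thesis
      by eventually_elim (auto simp: complexification_def segre_map_def)
  qed
  ultimately show ?thesis
    unfolding segre_preserving_def holomorphic_near_iff eventually_conj_iff by blast
qed

lemma holomorphic_near_bar: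
  fixes F :: "'a::{complex_space,euclidean_space} \<Rightarrow> 'b::{complex_space,euclidean_space}"
  assumes "holomorphic_near F 0"
  shows "holomorphic_near (bar F) 0"
proof -
  have "\<forall>\<^sub>F y in nhds 0. cdiff F (conj y)"
    by (rule eventually_nhds_compose[where h = conj])
      (use assms in \<open>auto simp: holomorphic_near_iff bounded_linear.isCont[OF bounded_linear_conj]\<close>)
  then show ?thesis unfolding holomorphic_near_iff by eventually_elim (rule cdiff_bar)
qed

lemma holomorphic_near_isCont: "holomorphic_near F x \<Longrightarrow> isCont F x"
  unfolding holomorphic_near_iff by (rule cdiff_isCont) (rule eventually_nhds_x_imp_x)

lemma isCont_bar:
  fixes F :: "'a::{complex_space,euclidean_space} \<Rightarrow> 'b::{complex_space,euclidean_space}"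
  assumes "holomorphic_near F 0"
  shows "isCont (bar F) 0"
  by (rule holomorphic_near_isCont[OF holomorphic_near_bar[OF assms]])

lemma bar_zero: "F 0 = 0 \<Longrightarrow> bar F 0 = 0"
  by (simp add: bar_def)

text \<open>The reality condition for the source says that \<open>((z, w), (\<xi>, \<tau>))\<close> lies on its complexification exactly when
\<open>((conj \<xi>, cnj \<tau>), (conj z, cnj w))\<close> does, and likewise for the target. Conjugating the map by these two
involutions exchanges the roles of \<open>(f, g)\<close> and \<open>(ft, gt)\<close>.\<close>

lemma segre_preserving_dual:
  fixes f ft :: "(complex ^ 'n::finite) \<times> complex \<Rightarrow> complex ^ 'n"
  assumes S: "segre_preserving Q Q' f g ft gt"
    and Q: "normal_coordinates M Q" and Q': "normal_coordinates M' Q'"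
  shows "segre_preserving Q Q' (bar ft) (bar gt) (bar f) (bar g)"
proof -
  have hol: "holomorphic_near f 0" "holomorphic_near g 0" "holomorphic_near ft 0" "holomorphic_near gt 0"
    and zero: "f 0 = 0" "g 0 = 0" "ft 0 = 0" "gt 0 = 0"
    and E: "\<forall>\<^sub>F p in nhds 0. case p of (z, \<xi>, \<tau>) \<Rightarrow>
        g (z, Q (z, \<xi>, \<tau>)) = Q' (f (z, Q (z, \<xi>, \<tau>)), ft (\<xi>, \<tau>), gt (\<xi>, \<tau>))"
    using S unfolding segre_preserving_def by blast+
  have Q0: "Q 0 = 0" by (rule normal_coordinatesD(5)[OF Q])
  have cQ: "isCont Q 0"
    using eventually_nhds_x_imp_x[OF normal_coordinatesD(1)[OF Q]] cdiff_isCont by blast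
  have cZ: "isCont (\<lambda>p. (fst p, Q p)) 0"
    by (intro continuous_intros cQ)
  have cft: "isCont (\<lambda>p. bar ft (fst p, Q p)) 0" and cgt: "isCont (\<lambda>p. bar gt (fst p, Q p)) 0"
    using isCont_bar[OF hol(3)] isCont_bar[OF hol(4)] Q0
    by (auto intro!: isCont_o2[OF cZ] simp: zero_prod_def[symmetric])
  have cf: "isCont (\<lambda>p. bar f (fst (snd p), snd (snd p))) 0"
    by (rule isCont_o2[where f = "\<lambda>p. (fst (snd p), snd (snd p))"])
      (use isCont_bar[OF hol(1)] in \<open>auto simp: zero_prod_def[symmetric] intro!: continuous_intros\<close>)
  have ev1: "\<forall>\<^sub>F p in nhds 0. case (conj (fst (snd p)), conj (fst p), cnj (Q p)) of (z, \<xi>, \<tau>) \<Rightarrow>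
        g (z, Q (z, \<xi>, \<tau>)) = Q' (f (z, Q (z, \<xi>, \<tau>)), ft (\<xi>, \<tau>), gt (\<xi>, \<tau>))"
    by (rule eventually_nhds_compose[where h = "\<lambda>p. (conj (fst (snd p)), conj (fst p), cnj (Q p))"])
      (use E Q0 cQ in \<open>auto simp: zero_prod_def[symmetric] intro!: continuous_intros\<close>)
  have ev2: "\<forall>\<^sub>F p in nhds 0. let p = (conj (fst (snd p)), conj (fst p), cnj (snd (snd p))) in
      Q (fst p, fst (snd p), bar Q (fst (snd p), fst p, snd (snd p))) = snd (snd p)"
    unfolding Let_def
    by (rule eventually_nhds_compose[where h = "\<lambda>p. (conj (fst (snd p)), conj (fst p), cnj (snd (snd p)))"])
      (use normal_coordinatesD(4)[OF Q] in \<open>auto simp: zero_prod_def[symmetric] intro!: continuous_intros\<close>)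
  (* The reality condition of the target, at the image point of the dual map. *)
  have ev3: "\<forall>\<^sub>F p in nhds 0. let p = (bar ft (fst p, Q p), bar f (fst (snd p), snd (snd p)), bar gt (fst p, Q p)) in
      Q' (fst p, fst (snd p), bar Q' (fst (snd p), fst p, snd (snd p))) = snd (snd p)"
    unfolding Let_def
  proof (rule eventually_nhds_compose[where
        h = "\<lambda>p. (bar ft (fst p, Q p), bar f (fst (snd p), snd (snd p)), bar gt (fst p, Q p))"])
    have h0: "(bar ft (fst 0, Q 0), bar f (fst (snd 0), snd (snd 0)), bar gt (fst 0, Q 0)) = 0"
      using zero Q0 by (simp add: bar_zero zero_prod_def[symmetric])
    show "\<forall>\<^sub>F p in nhds (bar ft (fst 0, Q 0), bar f (fst (snd 0), snd (snd 0)), bar gt (fst 0, Q 0)).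
        Q' (fst p, fst (snd p), bar Q' (fst (snd p), fst p, snd (snd p))) = snd (snd p)"
      unfolding h0 by (rule normal_coordinatesD(4)[OF Q'])
  qed (intro continuous_Pair cft cf cgt)
  have "\<forall>\<^sub>F p in nhds 0. case p of (z, \<xi>, \<tau>) \<Rightarrow>
      bar gt (z, Q (z, \<xi>, \<tau>)) = Q' (bar ft (z, Q (z, \<xi>, \<tau>)), bar f (\<xi>, \<tau>), bar g (\<xi>, \<tau>))"
    using ev1 ev2 ev3
  proof eventually_elim
    case (elim p)
    obtain z \<xi> \<tau> where p: "p = (z, \<xi>, \<tau>)" by (cases p)
    let ?w = "Q (z, \<xi>, \<tau>)"
    have 2: "Q (conj \<xi>, conj z, cnj ?w) = cnj \<tau>"
      using elim(2) by (simp add: p bar_def conj_conj)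
    have 1: "g (conj \<xi>, cnj \<tau>) = Q' (f (conj \<xi>, cnj \<tau>), ft (conj z, cnj ?w), gt (conj z, cnj ?w))"
      using elim(1) by (simp add: p 2)
    have "Q' (bar ft (z, ?w), bar f (\<xi>, \<tau>), cnj (g (conj \<xi>, cnj \<tau>))) = bar gt (z, ?w)"
      using elim(3) 1 by (simp add: p bar_def conj_conj)
    then show ?case by (simp add: p bar_def)
  qed
  with hol[THEN holomorphic_near_bar] zero bar_zero[of f] bar_zero[of g] bar_zero[of ft] bar_zero[of gt] show ?thesis
    unfolding segre_preserving_def by (intro conjI)
qed

section \<open>Derivatives of the mapping equation\<close>

text \<open>The chain rule for \<open>x \<mapsto> g (x, Q (x, \<xi>, \<tau>))\<close> at a point with \<open>w = 0\<close>. The \<open>z\<close>-derivative of \<open>g\<close>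
itself drops out because \<open>g\<close> vanishes on \<open>w = 0\<close>, which is why the right-hand side is a multiple of the
covector of the source.\<close>

lemma covector_identity:
  fixes f :: "(complex ^ 'n::finite) \<times> complex \<Rightarrow> complex ^ 'n"
    and Q' :: "(complex ^ 'n) \<times> (complex ^ 'n) \<times> complex \<Rightarrow> complex"
  assumes Q: "cdiff Q (z, \<xi>, \<tau>)" "Q (z, \<xi>, \<tau>) = 0" and f: "cdiff f (z, 0)" and g: "cdiff g (z, 0)"
    and Q': "cdiff Q' (f (z, 0), a, c)"
    and g0: "\<forall>\<^sub>F x in nhds z. g (x, 0) = 0"
    and E: "\<forall>\<^sub>F x in nhds z. g (x, Q (x, \<xi>, \<tau>)) = Q' (f (x, Q (x, \<xi>, \<tau>)), a, c)"
  shows "(\<Sum>k\<in>UNIV. dird (axis k 1, 0) Q' (f (z, 0), a, c) * cpartial j (\<lambda>x. f (x, 0) $ k) z) =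
    (dird (0, 1) g (z, 0) -
      (\<Sum>k\<in>UNIV. dird (axis k 1, 0) Q' (f (z, 0), a, c) * dird (0, 1) (\<lambda>x. f x $ k) (z, 0))) *
    dird (axis j 1, 0) Q (z, \<xi>, \<tau>)"
proof -
  obtain DQ where DQ: "(Q has_derivative DQ) (at (z, \<xi>, \<tau>))" "\<forall>c v. DQ (cscale c v) = cscale c (DQ v)"
    using Q(1) unfolding cdiff_def by blast
  obtain Df where Df: "(f has_derivative Df) (at (z, 0))" "\<forall>c v. Df (cscale c v) = cscale c (Df v)"
    using f unfolding cdiff_def by blast
  obtain Dg where Dg: "(g has_derivative Dg) (at (z, 0))" "\<forall>c v. Dg (cscale c v) = cscale c (Dg v)"
    using g unfolding cdiff_def by blast
  obtain DQ' where DQ': "(Q' has_derivative DQ') (at (f (z, 0), a, c))"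
      "\<forall>c v. DQ' (cscale c v) = cscale c (DQ' v)"
    using Q' unfolding cdiff_def by blast
  have lin: "linear DQ'" "linear Df" "linear Dg"
    using DQ'(1) Df(1) Dg(1) by (auto intro: has_derivative_linear)
  define e :: "complex ^ 'n" where "e = axis j 1"
  define r where "r = DQ (e, 0, 0)"
  have dq: "((\<lambda>x. Q (x, \<xi>, \<tau>)) has_derivative (\<lambda>v. DQ (v, 0, 0))) (at z)"
    by (rule has_derivative_compose[where g = Q and f = "\<lambda>x. (x, \<xi>, \<tau>)", OF _ DQ(1)])
      (intro has_derivative_Pair has_derivative_ident has_derivative_const)
  have dp: "((\<lambda>x. (x, Q (x, \<xi>, \<tau>))) has_derivative (\<lambda>v. (v, DQ (v, 0, 0)))) (at z)"
    by (rule has_derivative_Pair[OF has_derivative_ident dq])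
  have dl: "((\<lambda>x. g (x, Q (x, \<xi>, \<tau>))) has_derivative (\<lambda>v. Dg (v, DQ (v, 0, 0)))) (at z)"
    by (rule has_derivative_compose[OF dp]) (simp only: Q(2) Dg(1))
  have df: "((\<lambda>x. f (x, Q (x, \<xi>, \<tau>))) has_derivative (\<lambda>v. Df (v, DQ (v, 0, 0)))) (at z)"
    by (rule has_derivative_compose[OF dp]) (simp only: Q(2) Df(1))
  have dr: "((\<lambda>x. Q' (f (x, Q (x, \<xi>, \<tau>)), a, c)) has_derivative (\<lambda>v. DQ' (Df (v, DQ (v, 0, 0)), 0, 0))) (at z)"
    by (rule has_derivative_compose[where g = Q',
          OF has_derivative_Pair[OF df has_derivative_Pair[OF has_derivative_const has_derivative_const]]])
      (simp only: Q(2) DQ'(1))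
  have "((\<lambda>x. Q' (f (x, Q (x, \<xi>, \<tau>)), a, c)) has_derivative (\<lambda>v. Dg (v, DQ (v, 0, 0)))) (at z)"
    by (rule has_derivative_transform_eventually[OF dl])
      (use E eventually_nhds_x_imp_x[OF E] in \<open>auto simp: eventually_nhds_conv_at\<close>)
  then have "(\<lambda>v. Dg (v, DQ (v, 0, 0))) = (\<lambda>v. DQ' (Df (v, DQ (v, 0, 0)), 0, 0))"
    using dr by (rule has_derivative_unique)
  then have main: "Dg (e, r) = DQ' (Df (e, r), 0)" 
    unfolding r_def zero_prod_def by (rule fun_cong[where x = e])
  have "((\<lambda>x. g (x, 0)) has_derivative (\<lambda>v. Dg (v, 0))) (at z)"
    by (rule has_derivative_compose[OF has_derivative_Pair[OF has_derivative_ident has_derivative_const] Dg(1)])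
  then have "((\<lambda>x. 0) has_derivative (\<lambda>v. Dg (v, 0))) (at z)"
    by (rule has_derivative_transform_eventually)
      (use g0 eventually_nhds_x_imp_x[OF g0] in \<open>auto simp: eventually_nhds_conv_at\<close>)
  then have "(\<lambda>v. Dg (v, 0)) = (\<lambda>v. 0)"
    by (rule has_derivative_unique) (rule has_derivative_const)
  then have g1: "Dg (e, 0) = 0" by (rule fun_cong[where x = e])
  have er: "(e, r) = (e, 0) + cscale r (0, 1)" by simp
  have gr: "Dg (e, r) = r * Dg (0, 1)"
    unfolding er linear_add[OF lin(3)] by (simp only: g1 Dg(2) add_0_left cscale_complex)
  have fr: "Df (e, r) = Df (e, 0) + cscale r (Df (0, 1))"
    unfolding er linear_add[OF lin(2)] by (simp only: Df(2))
  have "r * Dg (0, 1) = (\<Sum>k\<in>UNIV. Df (e, r) $ k * DQ' (axis k 1, 0))"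
    unfolding gr[symmetric] main by (rule clinear_fst_expansion[OF lin(1) DQ'(2)])
  also have "\<dots> = (\<Sum>k\<in>UNIV. (Df (e, 0) $ k + r * Df (0, 1) $ k) * DQ' (axis k 1, 0))"
    by (simp only: fr vector_add_component cscale_nth cscale_complex)
  also have "\<dots> = (\<Sum>k\<in>UNIV. DQ' (axis k 1, 0) * Df (e, 0) $ k) +
      (\<Sum>k\<in>UNIV. DQ' (axis k 1, 0) * Df (0, 1) $ k) * r"
    by (simp add: algebra_simps sum.distrib sum_distrib_left)
  finally have "(\<Sum>k\<in>UNIV. DQ' (axis k 1, 0) * Df (e, 0) $ k) =
      (Dg (0, 1) - (\<Sum>k\<in>UNIV. DQ' (axis k 1, 0) * Df (0, 1) $ k)) * DQ (axis j 1, 0)"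
    by (simp add: algebra_simps r_def e_def zero_prod_def)
  moreover have "cpartial j (\<lambda>x. f (x, 0) $ k) z = Df (e, 0) $ k" for k
    using dird_nth[OF Df, of "(e, 0)" k] unfolding dird_def cpartial_def e_def
    by (simp add: cscale_axis)
  ultimately show ?thesis
    unfolding dird_eq[OF DQ] dird_eq[OF Dg] dird_eq[OF DQ'] dird_nth[OF Df] by (simp only:)
qed

text \<open>The \<open>\<tau>\<close>-derivative of the mapping equation over \<open>z = 0\<close>, where both hypersurfaces are in normal
form. It identifies the factor of \<open>covector_identity\<close> at \<open>z = 0\<close> with a normal derivative of the
other half of the map.\<close>

lemma normal_derivative_identity:
  fixes f ft :: "(complex ^ 'n::finite) \<times> complex \<Rightarrow> complex ^ 'n"
    and Q' :: "(complex ^ 'n) \<times> (complex ^ 'n) \<times> complex \<Rightarrow> complex"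
  assumes f: "cdiff f (0, 0)" "f (0, 0) = 0" and g: "cdiff g (0, 0)"
    and ft: "cdiff ft (\<xi>, 0)" and gt: "cdiff gt (\<xi>, 0)" "gt (\<xi>, 0) = 0"
    and Q': "cdiff Q' (0, ft (\<xi>, 0), 0)"
    and E: "\<forall>\<^sub>F t in nhds 0. g (0, t) = Q' (f (0, t), ft (\<xi>, t), gt (\<xi>, t))"
    and N: "\<forall>\<^sub>F p in nhds (ft (\<xi>, 0), 0). Q' (0, fst p, snd p) = snd p"
  shows "dird (0, 1) g (0, 0) -
      (\<Sum>k\<in>UNIV. dird (axis k 1, 0) Q' (0, ft (\<xi>, 0), 0) * dird (0, 1) (\<lambda>x. f x $ k) (0, 0)) =
    dird (0, 1) gt (\<xi>, 0)"
proof -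
  obtain Df where Df: "(f has_derivative Df) (at (0, 0))" "\<forall>c v. Df (cscale c v) = cscale c (Df v)"
    using f unfolding cdiff_def by blast
  obtain Dg where Dg: "(g has_derivative Dg) (at (0, 0))" "\<forall>c v. Dg (cscale c v) = cscale c (Dg v)"
    using g unfolding cdiff_def by blast
  obtain Dft where Dft: "(ft has_derivative Dft) (at (\<xi>, 0))"
    using ft unfolding cdiff_def by blast
  obtain Dgt where Dgt: "(gt has_derivative Dgt) (at (\<xi>, 0))" "\<forall>c v. Dgt (cscale c v) = cscale c (Dgt v)"
    using gt unfolding cdiff_def by blast
  obtain DQ' where DQ': "(Q' has_derivative DQ') (at (0, ft (\<xi>, 0), 0))"
      "\<forall>c v. DQ' (cscale c v) = cscale c (DQ' v)"
    using Q' unfolding cdiff_def by blast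
  have lin: "linear DQ'" using DQ'(1) by (rule has_derivative_linear)
  have dg: "((\<lambda>t. g (0, t)) has_derivative (\<lambda>v. Dg (0, v))) (at 0)"
    by (rule has_derivative_compose[where g = g, OF has_derivative_Pair[OF has_derivative_const has_derivative_ident] Dg(1)])
  have df: "((\<lambda>t. f (0, t)) has_derivative (\<lambda>v. Df (0, v))) (at 0)"
    by (rule has_derivative_compose[where g = f, OF has_derivative_Pair[OF has_derivative_const has_derivative_ident] Df(1)])
  have dft: "((\<lambda>t. ft (\<xi>, t)) has_derivative (\<lambda>v. Dft (0, v))) (at 0)"
    by (rule has_derivative_compose[where g = ft, OF has_derivative_Pair[OF has_derivative_const has_derivative_ident] Dft])
  have dgt: "((\<lambda>t. gt (\<xi>, t)) has_derivative (\<lambda>v. Dgt (0, v))) (at 0)"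
    by (rule has_derivative_compose[where g = gt, OF has_derivative_Pair[OF has_derivative_const has_derivative_ident] Dgt(1)])
  have dr: "((\<lambda>t. Q' (f (0, t), ft (\<xi>, t), gt (\<xi>, t))) has_derivative
      (\<lambda>v. DQ' (Df (0, v), Dft (0, v), Dgt (0, v)))) (at 0)"
    by (rule has_derivative_compose[where g = Q', OF has_derivative_Pair[OF df has_derivative_Pair[OF dft dgt]]])
      (simp only: f(2) gt(2) DQ'(1))
  have "((\<lambda>t. Q' (f (0, t), ft (\<xi>, t), gt (\<xi>, t))) has_derivative (\<lambda>v. Dg (0, v))) (at 0)"
    by (rule has_derivative_transform_eventually[OF dg])
      (use E eventually_nhds_x_imp_x[OF E] in \<open>auto simp: eventually_nhds_conv_at\<close>)
  then have "(\<lambda>v. Dg (0, v)) = (\<lambda>v. DQ' (Df (0, v), Dft (0, v), Dgt (0, v)))"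
    using dr by (rule has_derivative_unique)
  then have main: "Dg (0, 1) = DQ' (Df (0, 1), Dft (0, 1), Dgt (0, 1))" by (rule fun_cong)
  have dn: "((\<lambda>p. Q' (0, p)) has_derivative (\<lambda>v. DQ' (0, v))) (at (ft (\<xi>, 0), 0))"
    by (rule has_derivative_compose[where g = Q', OF has_derivative_Pair[OF has_derivative_const has_derivative_ident] DQ'(1)])
  have N': "\<forall>\<^sub>F p in nhds (ft (\<xi>, 0), 0). Q' (0, p) = snd p" using N by simp
  have "(snd has_derivative (\<lambda>v. DQ' (0, v))) (at (ft (\<xi>, 0), 0))"
    by (rule has_derivative_transform_eventually[OF dn])
      (use N' eventually_nhds_x_imp_x[OF N'] in \<open>auto simp: eventually_nhds_conv_at\<close>)
  then have "(\<lambda>v. DQ' (0, v)) = snd"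
    by (rule has_derivative_unique) (rule bounded_linear_imp_has_derivative[OF bounded_linear_snd])
  then have nd: "DQ' (0, v) = snd v" for v by (rule fun_cong)
  have "Dg (0, 1) = DQ' ((Df (0, 1), 0) + (0, Dft (0, 1), Dgt (0, 1)))"
    unfolding main by simp
  also have "\<dots> = (\<Sum>k\<in>UNIV. Df (0, 1) $ k * DQ' (axis k 1, 0)) + Dgt (0, 1)"
    by (simp only: linear_add[OF lin] nd snd_conv clinear_fst_expansion[OF lin DQ'(2), of "Df (0, 1)"])
  finally have "Dg (0, 1) - (\<Sum>k\<in>UNIV. DQ' (axis k 1, 0) * Df (0, 1) $ k) = Dgt (0, 1)"
    by (simp add: mult.commute)
  then show ?thesis
    unfolding dird_eq[OF Dgt] dird_eq[OF Dg] dird_eq[OF DQ'] dird_nth[OF Df] by (simp only:)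
qed

lemma dird_eventually_zero:
  assumes "\<forall>\<^sub>F y in nhds x. F (y, b) = 0"
  shows "dird (v, 0) F (x, b) = 0"
proof -
  have "\<forall>\<^sub>F t in nhds 0. F (x + cscale t v, b) = 0"
    by (rule eventually_nhds_compose[where h = "\<lambda>t. x + cscale t v"])
      (use assms in \<open>auto intro!: continuous_intros bounded_linear.isCont[OF bounded_linear_cscale_left]\<close>)
  then have "deriv (\<lambda>t. F (x + cscale t v, b)) 0 = deriv (\<lambda>_. 0) 0"
    by (intro deriv_cong_ev) auto
  then show ?thesis by (simp add: dird_def)
qed

section \<open>Linear independence of the covectors of the target\<close>

lemma lhol_relation_cpartial:
  assumes G: "\<And>k. lhol (G k) U" and rel: "\<And>x. x \<in> U \<Longrightarrow> (\<Sum>k\<in>UNIV. c k * G k x) = 0" and x: "x \<in> U"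
  shows "(\<Sum>k\<in>(UNIV :: 'k::finite set). c k * cpartial i (G k) x) = 0"
proof -
  let ?e = "axis i 1"
  let ?S = "{t. x + cscale t ?e \<in> U}"
  have S: "open ?S" "0 \<in> ?S" using open_line[OF lhol_open[OF G]] x by auto
  have "((\<lambda>t. G k (x + cscale t ?e)) has_field_derivative cpartial i (G k) x) (at 0)" for k
    unfolding cpartial_eq_dird dird_def
    by (rule holomorphic_derivI[OF lhol_line[OF G] S])
  then have "((\<lambda>t. \<Sum>k\<in>UNIV. c k * G k (x + cscale t ?e)) has_field_derivative
      (\<Sum>k\<in>UNIV. c k * cpartial i (G k) x)) (at 0)"
    by (intro DERIV_sum DERIV_cmult)
  moreover have "\<forall>\<^sub>F t in nhds 0. (\<Sum>k\<in>UNIV. c k * G k (x + cscale t ?e)) = 0"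
    using eventually_nhds_in_open[OF S] by eventually_elim (simp add: rel)
  ultimately have "((\<lambda>t. 0) has_field_derivative (\<Sum>k\<in>UNIV. c k * cpartial i (G k) x)) (at 0)"
    using DERIV_cong_ev by fastforce
  then show ?thesis by (rule DERIV_unique) (rule DERIV_const)
qed

text \<open>A linear relation between functions is inherited by their partial derivatives of all orders. The class of functions
is closed under \<^const>\<open>cpartial\<close>, so the relation passes through the nested definition of
\<^const>\<open>mpartial\<close> one derivative at a time.\<close>

lemma lhol_relation_mpartial:
  fixes c :: "'k::finite \<Rightarrow> complex" and U :: "(complex ^ 'n::finite) set"
  assumes G: "\<And>k. lhol (G k) U" and rel: "\<And>x. x \<in> U \<Longrightarrow> (\<Sum>k\<in>UNIV. c k * G k x) = 0" and x: "x \<in> U"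
  shows "(\<Sum>k\<in>UNIV. c k * mpartial \<alpha> (G k) x) = 0"
proof -
  define P where "P H \<longleftrightarrow> (\<forall>k. lhol (H k) U) \<and> (\<forall>x\<in>U. (\<Sum>k\<in>UNIV. c k * H k x) = 0)"
    for H :: "'k \<Rightarrow> complex ^ 'n \<Rightarrow> complex"
  have step: "P (\<lambda>k. cpartial i (H k))" if "P H" for H i
    using that lhol_relation_cpartial[of H U c] unfolding P_def
    by (auto simp: cpartial_eq_dird intro: lhol_dird)
  have pow: "P (\<lambda>k. (cpartial i ^^ m) (H k))" if "P H" for H i m
    by (induction m) (use that step in auto)
  have "P (\<lambda>k. foldr (\<lambda>i H. (cpartial i ^^ \<alpha> i) H) xs (G k))" for xs
  proof (induction xs)
    case Nil
    show ?case using G rel by (simp add: P_def)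
  next
    case (Cons i xs)
    from pow[OF this, where i = i and m = "\<alpha> i"] show ?case by simp
  qed
  then show ?thesis using x by (simp add: P_def mpartial_def)
qed

text \<open>A relation would hold between the entries of each column of derivatives at \<open>0\<close>, so that all columns would lie in one
hyperplane and could not span.\<close>

lemma finitely_nondegenerate_independent:
  fixes Q :: "(complex ^ 'n::finite) \<times> (complex ^ 'n) \<times> complex \<Rightarrow> complex"
  assumes fin: "finitely_nondegenerate Q" and Q: "holomorphic_near Q 0"
    and rel: "\<forall>\<^sub>F z in nhds 0. (\<Sum>k\<in>UNIV. c k * cpartial k (\<lambda>\<xi>. Q (z, \<xi>, 0)) 0) = 0"
  shows "c = (\<lambda>_. 0)"
proof (rule ccontr)
  assume "c \<noteq> (\<lambda>_. 0)"
  then obtain k0 where k0: "c k0 \<noteq> 0" by auto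
  obtain S where S: "open S" "0 \<in> S" "\<And>x. x \<in> S \<Longrightarrow> cdiff Q x"
    using Q unfolding holomorphic_near_iff eventually_nhds by blast
  obtain N where N: "open N" "0 \<in> N"
      "\<And>z. z \<in> N \<Longrightarrow> (\<Sum>k\<in>UNIV. c k * cpartial k (\<lambda>\<xi>. Q (z, \<xi>, 0)) 0) = 0"
    using rel unfolding eventually_nhds by blast
  let ?G = "\<lambda>k z. cpartial k (\<lambda>\<xi>. Q (z, \<xi>, 0)) 0"
  define V where "V = N \<inter> (\<lambda>z. (z, 0, 0)) -` S"
  have V: "open V" "0 \<in> V"
    unfolding V_def using S N
    by (auto intro!: open_Int open_vimage continuous_intros simp: zero_prod_def)
  have lh: "lhol (?G k) V" for k
  proof -
    have "lhol (\<lambda>z. dird (0, axis k 1, 0) Q (z, 0, 0)) V"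
      by (rule lhol_dird_compose[OF S(1) S(3) V(1)])
        (auto simp: V_def intro!: cdiff_Pair cdiff_ident cdiff_const)
    then show ?thesis
      by (simp add: dird_def cpartial_def cscale_axis)
  qed
  have rel0: "(\<Sum>k\<in>UNIV. c k * mpartial \<alpha> (?G k) 0) = 0" for \<alpha>
    by (rule lhol_relation_mpartial[OF lh _ V(2)]) (auto simp: V_def intro: N)
  obtain K where K: "vec.dim {(\<chi> j. mpartial \<alpha> (?G j) 0) :: complex ^ 'n | \<alpha>. mabs \<alpha> \<le> K} = CARD('n)"
    (is "vec.dim ?S = _")
    using fin unfolding finitely_nondegenerate_def by blast
  define H where "H = {x :: complex ^ 'n. (\<Sum>k\<in>UNIV. c k * x $ k) = 0}"
  (* The hyperplane cut out by the relation contains all columns, so it contains their span. *)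
  have "vec.subspace H"
    unfolding vec.subspace_def H_def
    by (auto simp: distrib_left sum.distrib mult.left_commute sum_distrib_left[symmetric])
  moreover have "?S \<subseteq> H" using rel0 by (auto simp: H_def)
  ultimately have "vec.span ?S \<subseteq> H" by (simp add: vec.span_minimal)
  moreover have "vec.span ?S = UNIV"
  proof (rule vec.subspace_dim_equal)
    show "vec.dim (UNIV :: (complex ^ 'n) set) \<le> vec.dim (vec.span ?S)"
      by (simp only: vec.dim_span vec_dim_card K order.refl)
  qed (auto simp: vec.subspace_UNIV)
  ultimately have "axis k0 1 \<in> H" by blast
  then show False using k0 by (simp add: H_def axis_def if_distrib cong: if_cong)
qed

text \<open>Differentiate \<open>Q (z, y, bar Q (y, z, 0)) = 0\<close> in \<open>z\<close> at \<open>z = 0\<close>, using \<open>Q (0, y, \<tau>) = \<tau>\<close>. This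
converts the \<open>z\<close>-derivatives that occur in the covector identity into the
\<open>\<xi>\<close>-derivatives in terms of which finite nondegeneracy is formulated.\<close>

lemma normal_coordinates_first_order:
  assumes Q: "normal_coordinates M Q"
  shows "\<forall>\<^sub>F y in nhds 0. dird (axis k 1, 0) Q (0, y, 0) = - cnj (cpartial k (\<lambda>\<xi>. Q (conj y, \<xi>, 0)) 0)"
proof -
  note n = normal_coordinatesD[OF Q]
  have a: "\<forall>\<^sub>F y in nhds 0. cdiff Q (0, y, 0)"
    by (rule eventually_nhds_compose[where h = "\<lambda>y. (0, y, 0)"])
      (use n(1) in \<open>auto simp: zero_prod_def[symmetric] intro!: continuous_intros\<close>)
  have b: "\<forall>\<^sub>F y in nhds 0. cdiff Q (conj y, 0, 0)"
    by (rule eventually_nhds_compose[where h = "\<lambda>y. (conj y, 0, 0)"])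
      (use n(1) in \<open>auto simp: zero_prod_def[symmetric] intro!: continuous_intros\<close>)
  have c: "\<forall>\<^sub>F y in nhds 0. \<forall>\<^sub>F p in nhds (y, 0). Q (0, fst p, snd p) = snd p"
    by (rule eventually_nhds_compose[where h = "\<lambda>y. (y, 0)"])
      (use n(2) in \<open>auto simp: zero_prod_def[symmetric] eventually_eventually intro!: continuous_intros\<close>)
  have d: "\<forall>\<^sub>F y in nhds 0. Q (conj y, 0, 0) = 0"
    by (rule eventually_nhds_compose[where h = "\<lambda>y. (conj y, 0)" and
          P = "\<lambda>p. Q (fst p, 0, snd p) = snd p", simplified])
      (use n(3) in \<open>auto simp: zero_prod_def[symmetric] intro!: continuous_intros\<close>)
  have e: "\<forall>\<^sub>F y in nhds 0. \<forall>\<^sub>F p in nhds (0, y, 0).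
      Q (fst p, fst (snd p), bar Q (fst (snd p), fst p, snd (snd p))) = snd (snd p)"
    by (rule eventually_nhds_compose[where h = "\<lambda>y. (0, y, 0)"])
      (use n(4) in \<open>auto simp: zero_prod_def[symmetric] eventually_eventually intro!: continuous_intros\<close>)
  from a b c d e show ?thesis
  proof eventually_elim
    case (elim y)
    obtain D where D: "(Q has_derivative D) (at (0, y, 0))" "\<forall>c v. D (cscale c v) = cscale c (D v)"
      using elim(1) unfolding cdiff_def by blast
    obtain E where E: "(Q has_derivative E) (at (conj y, 0, 0))" "\<forall>c v. E (cscale c v) = cscale c (E v)"
      using elim(2) unfolding cdiff_def by blast
    have bE: "(bar Q has_derivative bar E) (at (y, 0, 0))"
      by (rule has_derivative_bar) (simp add: E(1))
    have bQ: "bar Q (y, 0, 0) = 0" using elim(4) by (simp add: bar_def)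
    have 1: "((\<lambda>z. bar Q (y, z, 0)) has_derivative (\<lambda>v. bar E (0, v, 0))) (at 0)"
      by (rule has_derivative_compose[where g = "bar Q" and f = "\<lambda>z. (y, z, 0)", OF _ bE])
        (intro has_derivative_Pair has_derivative_ident has_derivative_const)
    have 2: "((\<lambda>z. Q (z, y, bar Q (y, z, 0))) has_derivative (\<lambda>v. D (v, 0, bar E (0, v, 0)))) (at 0)"
      by (rule has_derivative_compose[where g = Q,
          OF has_derivative_Pair[OF has_derivative_ident has_derivative_Pair[OF has_derivative_const 1]]])
        (simp add: bQ D(1))
    have ev: "\<forall>\<^sub>F z in nhds 0. Q (z, y, bar Q (y, z, 0)) = 0"
      by (rule eventually_nhds_compose[where h = "\<lambda>z. (z, y, 0)", OF elim(5), simplified])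
    have "((\<lambda>z. 0) has_derivative (\<lambda>v. D (v, 0, bar E (0, v, 0)))) (at 0)"
      by (rule has_derivative_transform_eventually[OF 2])
        (use ev eventually_nhds_x_imp_x[OF ev] in \<open>auto simp: eventually_nhds_conv_at\<close>)
    then have "(\<lambda>v. D (v, 0, bar E (0, v, 0))) = (\<lambda>v. 0)"
      by (rule has_derivative_unique) (rule has_derivative_const)
    then have 3: "D (axis k 1, 0, bar E (0, axis k 1, 0)) = 0" by (rule fun_cong)
    have 4: "((\<lambda>t. Q (0, y, t)) has_derivative (\<lambda>v. D (0, 0, v))) (at 0)"
      by (rule has_derivative_compose[where g = Q and f = "\<lambda>t. (0, y, t)", OF _ D(1)])
        (intro has_derivative_Pair has_derivative_ident has_derivative_const)
    have ev': "\<forall>\<^sub>F t in nhds 0. Q (0, y, t) = t"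
      by (rule eventually_nhds_compose[where h = "\<lambda>t. (y, t)", OF elim(3), simplified])
    have "((\<lambda>t. t) has_derivative (\<lambda>v. D (0, 0, v))) (at 0)"
      by (rule has_derivative_transform_eventually[OF 4])
        (use ev' eventually_nhds_x_imp_x[OF ev'] in \<open>auto simp: eventually_nhds_conv_at\<close>)
    then have "(\<lambda>v. D (0, 0, v)) = (\<lambda>v. v)"
      by (rule has_derivative_unique) (rule has_derivative_ident)
    then have 5: "D (0, 0, t) = t" for t by (rule fun_cong)
    have "D (axis k 1, 0, bar E (0, axis k 1, 0)) = D ((axis k 1, 0) + (0, 0, bar E (0, axis k 1, 0)))"
      by (simp add: zero_prod_def)
    also have "\<dots> = D (axis k 1, 0) + bar E (0, axis k 1, 0)"
      by (simp only: linear_add[OF has_derivative_linear[OF D(1)]] 5)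
    finally have "D (axis k 1, 0) = - bar E (0, axis k 1, 0)" using 3 by (simp add: eq_neg_iff_add_eq_0)
    also have "bar E (0, axis k 1, 0) = cnj (E (0, axis k 1, 0))"
      by (simp add: bar_def conj_axis)
    also have "E (0, axis k 1, 0) = cpartial k (\<lambda>\<xi>. Q (conj y, \<xi>, 0)) 0"
      using dird_eq[OF E, of "(0, axis k 1, 0)"] by (simp add: dird_def cpartial_def cscale_axis)
    finally show ?case by (simp add: dird_eq[OF D])
  qed
qed

text \<open>The matrix of complex partial derivatives represents the real derivative, which therefore has a right
inverse, and the open mapping theorem for one invertible derivative applies.\<close>

lemma jac_det_nonzero_interior:
  fixes f :: "(complex ^ 'n::finite) \<times> complex \<Rightarrow> complex ^ 'n"
  assumes N: "open N" "x \<in> N" "\<And>z. z \<in> N \<Longrightarrow> cdiff f (z, 0)" and nz: "jac_det f x \<noteq> 0"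
  shows "f (x, 0) \<in> interior ((\<lambda>z. f (z, 0)) ` N)"
proof -
  have cd: "cdiff (\<lambda>z. f (z, 0)) z" if "z \<in> N" for z
    by (rule cdiff_compose[OF cdiff_Pair[OF cdiff_ident cdiff_const] N(3)[OF that]])
  then obtain D where D: "((\<lambda>z. f (z, 0)) has_derivative D) (at x)" "\<forall>c v. D (cscale c v) = cscale c (D v)"
    using N(2) unfolding cdiff_def by blast
  define J :: "complex ^ 'n ^ 'n" where "J = (\<chi> i j. cpartial j (\<lambda>z. f (z, 0) $ i) x)"
  have J: "J $ i $ j = D (axis j 1) $ i" for i j
    by (simp add: J_def cpartial_eq_dird dird_nth[OF D])
  have DJ: "D v = J *v v" for v
  proof -
    have "D v = (\<Sum>j\<in>UNIV. cscale (v $ j) (D (axis j 1)))"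
      by (subst vec_expansion[of v]) (simp only: linear_sum[OF has_derivative_linear[OF D(1)]] D(2))
    then show ?thesis
      by (simp add: vec_eq_iff matrix_vector_mult_def J mult.commute)
  qed
  have "det J \<noteq> 0" using nz by (simp add: jac_det_def J_def)
  then obtain B where B: "J ** B = mat 1"
    using invertible_det_nz invertible_def by blast
  have "linear ((*v) B)"
    by (rule linearI, rule matrix_vector_right_distrib)
      (simp add: vec_eq_iff matrix_vector_mult_def scaleR_sum_right)
  then have bl: "bounded_linear ((*v) B)" by (rule linear_conv_bounded_linear[THEN iffD1])
  have id: "D \<circ> (*v) B = id"
    by (simp add: fun_eq_iff DJ matrix_vector_mul_assoc B)
  have cont: "continuous_on N (\<lambda>z. f (z, 0))"
    using cd by (auto intro!: continuous_at_imp_continuous_on cdiff_isCont)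
  show ?thesis
    by (rule sussmann_open_mapping[OF N(1) cont N(2) D(1) bl id order.refl])
      (use N in \<open>simp add: interior_open\<close>)
qed

text \<open>The relation holds at the points \<open>ft (\<xi>, 0)\<close>, which fill an open set, hence near \<open>0\<close> by the identity theorem.
There \<open>normal_coordinates_first_order\<close> translates it into a relation excluded by finite nondegeneracy.\<close>

lemma covector_independent:
  fixes ft :: "(complex ^ 'n::finite) \<times> complex \<Rightarrow> complex ^ 'n"
  assumes Q: "normal_coordinates M Q" and fin: "finitely_nondegenerate Q"
    and ft: "holomorphic_near ft 0" "ft 0 = 0" and nz: "\<not> (\<forall>\<^sub>F \<xi> in nhds 0. jac_det ft \<xi> = 0)"
    and rel: "\<forall>\<^sub>F \<xi> in nhds 0. (\<Sum>k\<in>UNIV. c k * dird (axis k 1, 0) Q (0, ft (\<xi>, 0), 0)) = 0"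
  shows "c = (\<lambda>_. 0)"
proof -
  note n = normal_coordinatesD[OF Q]
  let ?L = "\<lambda>y. \<Sum>k\<in>UNIV. c k * dird (axis k 1, 0) Q (0, y, 0)"
  obtain S where S: "open S" "0 \<in> S" "\<And>x. x \<in> S \<Longrightarrow> cdiff Q x"
    using n(1) unfolding eventually_nhds by blast
  have "open ((\<lambda>y. (0, y, 0)) -` S)" "0 \<in> (\<lambda>y. (0, y, 0)) -` S"
    using S by (auto intro!: open_vimage continuous_intros simp: zero_prod_def)
  then obtain r where r: "r > 0" "ball 0 r \<subseteq> (\<lambda>y. (0, y, 0)) -` S"
    by (meson open_contains_ball)
  have lh: "lhol ?L (ball 0 r)"
    by (intro lhol_sum lhol_mult lhol_const lhol_dird_compose[OF S(1) S(3)] cdiff_Pair cdiff_ident cdiff_const)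
      (use r in auto)
  have cft: "isCont (\<lambda>\<xi>. ft (\<xi>, 0)) 0"
    by (rule isCont_o2[where f = "\<lambda>\<xi>. (\<xi>, 0)"])
      (use holomorphic_near_isCont[OF ft(1)] in \<open>auto simp: zero_prod_def intro!: continuous_intros\<close>)
  have "\<forall>\<^sub>F \<xi> in nhds 0. ft (\<xi>, 0) \<in> ball 0 r"
    by (rule eventually_nhds_compose[OF eventually_nhds_in_open cft])
      (use r ft(2) in \<open>auto simp: zero_prod_def\<close>)
  moreover have "\<forall>\<^sub>F \<xi> in nhds 0. cdiff ft (\<xi>, 0)"
    by (rule eventually_nhds_compose[where h = "\<lambda>\<xi>. (\<xi>, 0)"])
      (use ft(1) in \<open>auto simp: zero_prod_def[symmetric] holomorphic_near_iff intro!: continuous_intros\<close>)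
  ultimately have "\<forall>\<^sub>F \<xi> in nhds 0. ft (\<xi>, 0) \<in> ball 0 r \<and> cdiff ft (\<xi>, 0) \<and> ?L (ft (\<xi>, 0)) = 0"
    using rel by eventually_elim auto
  then obtain N where N: "open N" "0 \<in> N"
      "\<And>\<xi>. \<xi> \<in> N \<Longrightarrow> ft (\<xi>, 0) \<in> ball 0 r \<and> cdiff ft (\<xi>, 0) \<and> ?L (ft (\<xi>, 0)) = 0"
    unfolding eventually_nhds by blast
  obtain x where x: "x \<in> N" "jac_det ft x \<noteq> 0"
    using nz N(1,2) unfolding eventually_nhds by blast
  have int: "ft (x, 0) \<in> interior ((\<lambda>z. ft (z, 0)) ` N)"
    by (rule jac_det_nonzero_interior[OF N(1) x(1) _ x(2)]) (use N(3) in blast)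
  have "\<forall>\<^sub>F y in nhds (ft (x, 0)). y \<in> interior ((\<lambda>z. ft (z, 0)) ` N)"
    by (rule eventually_nhds_in_open[OF open_interior int])
  then have "\<forall>\<^sub>F y in nhds (ft (x, 0)). ?L y = 0"
    by eventually_elim (use interior_subset N(3) in blast)
  from lhol_identity[OF lh convex_ball _ this] have L0: "?L y = 0" if "y \<in> ball 0 r" for y
    using that N(3)[OF x(1)] by blast
  have "\<forall>\<^sub>F y in nhds 0. y \<in> ball 0 r" using r by (intro eventually_nhds_in_open) auto
  then have "\<forall>\<^sub>F y in nhds 0. ?L y = 0" by eventually_elim (rule L0)
  moreover have "\<forall>\<^sub>F y in nhds 0. \<forall>k. dird (axis k 1, 0) Q (0, y, 0) =
      - cnj (cpartial k (\<lambda>\<xi>. Q (conj y, \<xi>, 0)) 0)"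
    using normal_coordinates_first_order[OF Q] by (simp add: eventually_all_finite)
  ultimately have "\<forall>\<^sub>F y in nhds 0. (\<Sum>k\<in>UNIV. cnj (c k) * cpartial k (\<lambda>\<xi>. Q (conj y, \<xi>, 0)) 0) = 0"
  proof eventually_elim
    case (elim y)
    have "cnj (\<Sum>k\<in>UNIV. cnj (c k) * cpartial k (\<lambda>\<xi>. Q (conj y, \<xi>, 0)) 0) = - ?L y"
      using elim(2) by (simp add: sum_negf)
    then show ?case unfolding elim(1) minus_zero complex_cnj_zero_iff .
  qed
  then have "\<forall>\<^sub>F y in nhds (conj 0). (\<Sum>k\<in>UNIV. cnj (c k) * cpartial k (\<lambda>\<xi>. Q (conj y, \<xi>, 0)) 0) = 0"
    by simp
  then have "\<forall>\<^sub>F y in nhds 0. (\<Sum>k\<in>UNIV. cnj (c k) * cpartial k (\<lambda>\<xi>. Q (conj (conj y), \<xi>, 0)) 0) = 0"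
    by (rule eventually_nhds_compose[where h = conj])
      (intro continuous_intros)
  then have "\<forall>\<^sub>F y in nhds 0. (\<Sum>k\<in>UNIV. cnj (c k) * cpartial k (\<lambda>\<xi>. Q (y, \<xi>, 0)) 0) = 0"
    by (simp add: conj_conj)
  from finitely_nondegenerate_independent[OF fin _ this]
  have "(\<lambda>k. cnj (c k)) = (\<lambda>_. 0)" using n(1) by (simp add: holomorphic_near_iff)
  then show ?thesis by (simp add: fun_eq_iff)
qed

section \<open>The covector identity on a slice of the hypersurface\<close>

text \<open>The point of the complexified hypersurface with coordinates \<open>z\<close>, \<open>\<xi>\<close> and \<open>w = 0\<close> has this
\<open>\<tau>\<close>-coordinate, by the reality condition.\<close>

definition slice_tau ::
    "((complex ^ 'n::finite) \<times> (complex ^ 'n) \<times> complex \<Rightarrow> complex) \<Rightarrow>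
     (complex ^ 'n) \<times> (complex ^ 'n) \<Rightarrow> complex" where
  "slice_tau Q p = bar Q (snd p, fst p, 0)"

text \<open>The covector \<open>Q_z\<close> on the slice \<open>w = 0\<close>. No component of a map enters, and all comparisons
between two maps with the same source rest on this.\<close>

definition source_covector ::
    "((complex ^ 'n::finite) \<times> (complex ^ 'n) \<times> complex \<Rightarrow> complex) \<Rightarrow>
     (complex ^ 'n) \<times> (complex ^ 'n) \<Rightarrow> complex ^ 'n" where
  "source_covector Q p = (\<chi> j. dird (axis j 1, 0) Q (fst p, snd p, slice_tau Q p))"

text \<open>The covector \<open>Q'_{z'}\<close> at the image of the point of the slice with parameters \<open>p = (z, \<xi>)\<close>.\<close>

definition target_covector ::
    "((complex ^ 'n::finite) \<times> (complex ^ 'n) \<times> complex \<Rightarrow> complex) \<Rightarrow>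
     ((complex ^ 'n) \<times> (complex ^ 'n) \<times> complex \<Rightarrow> complex) \<Rightarrow>
     ((complex ^ 'n) \<times> complex \<Rightarrow> complex ^ 'n) \<Rightarrow>
     ((complex ^ 'n) \<times> complex \<Rightarrow> complex ^ 'n) \<Rightarrow> ((complex ^ 'n) \<times> complex \<Rightarrow> complex) \<Rightarrow>
     (complex ^ 'n) \<times> (complex ^ 'n) \<Rightarrow> complex ^ 'n" where
  "target_covector Q Q' f ft gt p =
     (\<chi> k. dird (axis k 1, 0) Q'
       (f (fst p, 0), ft (snd p, slice_tau Q p), gt (snd p, slice_tau Q p)))"

definition tangential_jacobian ::
    "((complex ^ 'n::finite) \<times> complex \<Rightarrow> complex ^ 'n) \<Rightarrow> complex ^ 'n \<Rightarrow> complex ^ 'n ^ 'n" where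
  "tangential_jacobian f z = (\<chi> i j. cpartial j (\<lambda>x. f (x, 0) $ i) z)"

definition normal_deriv :: "((complex ^ 'n::finite) \<times> complex \<Rightarrow> complex) \<Rightarrow> complex ^ 'n \<Rightarrow> complex" where
  "normal_deriv g z = dird (0, 1) g (z, 0)"

definition normal_deriv_vec ::
    "((complex ^ 'n::finite) \<times> complex \<Rightarrow> complex ^ 'n) \<Rightarrow> complex ^ 'n \<Rightarrow> complex ^ 'n" where
  "normal_deriv_vec f z = (\<chi> k. dird (0, 1) (\<lambda>x. f x $ k) (z, 0))"

text \<open>The factor by which the pullback of the contact form of the target differs from the contact form of the source.
The map is transversal at the points at which it does not vanish.\<close>

definition transversal_factor ::
    "((complex ^ 'n::finite) \<times> (complex ^ 'n) \<Rightarrow> complex ^ 'n) \<Rightarrow> (complex ^ 'n \<Rightarrow> complex) \<Rightarrow>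
     (complex ^ 'n \<Rightarrow> complex ^ 'n) \<Rightarrow> (complex ^ 'n) \<times> (complex ^ 'n) \<Rightarrow> complex" where
  "transversal_factor A gw fw p = gw (fst p) - (\<Sum>k\<in>UNIV. A p $ k * fw (fst p) $ k)"

text \<open>The properties of a Segre preserving map from which transversality and the comparison of Jacobians follow. The radius is a
parameter so that a map and its dual can be treated on the same ball.\<close>

locale covector_system =
  fixes \<rho> :: real
    and A R :: "(complex ^ 'n::finite) \<times> (complex ^ 'n) \<Rightarrow> complex ^ 'n"
    and J :: "complex ^ 'n \<Rightarrow> complex ^ 'n ^ 'n"
    and gw :: "complex ^ 'n \<Rightarrow> complex" and fw :: "complex ^ 'n \<Rightarrow> complex ^ 'n"
  assumes radius: "\<rho> > 0"
    and A_lhol: "\<And>k. lhol (\<lambda>p. A p $ k) (ball 0 \<rho> \<times> ball 0 \<rho>)"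
    and R_lhol: "\<And>k. lhol (\<lambda>p. R p $ k) (ball 0 \<rho> \<times> ball 0 \<rho>)"
    and J_lhol: "\<And>i j. lhol (\<lambda>z. J z $ i $ j) (ball 0 \<rho>)"
    and gw_lhol: "lhol gw (ball 0 \<rho>)"
    and fw_lhol: "\<And>k. lhol (\<lambda>z. fw z $ k) (ball 0 \<rho>)"
    and identity: "\<And>z \<xi> j. z \<in> ball 0 \<rho> \<Longrightarrow> \<xi> \<in> ball 0 \<rho> \<Longrightarrow>
      (\<Sum>k\<in>UNIV. A (z, \<xi>) $ k * J z $ k $ j) = transversal_factor A gw fw (z, \<xi>) * R (z, \<xi>) $ j"
    and A_zero: "\<And>z. z \<in> ball 0 \<rho> \<Longrightarrow> A (z, 0) = 0"
    and R_zero: "\<And>z. z \<in> ball 0 \<rho> \<Longrightarrow> R (z, 0) = 0"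
    and J_nonzero: "\<not> (\<forall>\<^sub>F z in nhds 0. det (J z) = 0)"
    and A_independent: "\<And>c. \<forall>\<^sub>F \<xi> in nhds 0. (\<Sum>k\<in>UNIV. c k * A (0, \<xi>) $ k) = 0 \<Longrightarrow> c = (\<lambda>_. 0)"

text \<open>The pointwise requirements hold at all points near \<open>0\<close>, either by the two derivative identities or because the normal form of
one of the hypersurfaces makes a function vanish on a coordinate subspace. The statement holds for all
smaller radii, since two different maps have to share one.\<close>

lemma covector_system_exists:
  fixes f ft :: "(complex ^ 'n::finite) \<times> complex \<Rightarrow> complex ^ 'n"
  assumes S: "segre_preserving Q Q' f g ft gt"
    and Q: "normal_coordinates M Q" and Q': "normal_coordinates M' Q'"
    and fin: "finitely_nondegenerate Q'" and nd: "totally_segre_nondegenerate f ft"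
  shows "\<exists>r>0. \<forall>\<rho>. 0 < \<rho> \<and> \<rho> \<le> r \<longrightarrow>
    covector_system \<rho> (target_covector Q Q' f ft gt) (source_covector Q) (tangential_jacobian f)
      (normal_deriv g) (normal_deriv_vec f) \<and>
    (\<forall>\<xi>\<in>ball 0 \<rho>. transversal_factor (target_covector Q Q' f ft gt) (normal_deriv g)
      (normal_deriv_vec f) (0, \<xi>) = normal_deriv gt \<xi>)"
proof -
  have hol: "holomorphic_near f 0" "holomorphic_near g 0" "holomorphic_near ft 0" "holomorphic_near gt 0"
    and zero: "f 0 = 0" "g 0 = 0" "ft 0 = 0" "gt 0 = 0"
    and E: "\<forall>\<^sub>F p in nhds 0. case p of (z, \<xi>, \<tau>) \<Rightarrow>
        g (z, Q (z, \<xi>, \<tau>)) = Q' (f (z, Q (z, \<xi>, \<tau>)), ft (\<xi>, \<tau>), gt (\<xi>, \<tau>))"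
    using S unfolding segre_preserving_def by blast+
  note z0 = zero_prod_def[symmetric]
  have E0: "\<forall>\<^sub>F p in nhds (0, 0, 0). case p of (z, \<xi>, \<tau>) \<Rightarrow>
        g (z, Q (z, \<xi>, \<tau>)) = Q' (f (z, Q (z, \<xi>, \<tau>)), ft (\<xi>, \<tau>), gt (\<xi>, \<tau>))"
    unfolding z0 by (rule E)
  note n = normal_coordinatesD[OF Q] and n' = normal_coordinatesD[OF Q']
  have cd: "\<forall>\<^sub>F x in nhds 0. cdiff f x" "\<forall>\<^sub>F x in nhds 0. cdiff g x"
      "\<forall>\<^sub>F x in nhds 0. cdiff ft x" "\<forall>\<^sub>F x in nhds 0. cdiff gt x"
    using hol by (simp_all only: holomorphic_near_iff)
  let ?t = "slice_tau Q"
  let ?X = "\<lambda>p. (fst p, snd p, ?t p)"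
  let ?Y = "\<lambda>p. (f (fst p, 0), ft (snd p, ?t p), gt (snd p, ?t p))"
  obtain SQ where SQ: "open SQ" "0 \<in> SQ" "\<And>x. x \<in> SQ \<Longrightarrow> cdiff Q x"
    using n(1) unfolding eventually_nhds by blast
  obtain SQ' where SQ': "open SQ'" "0 \<in> SQ'" "\<And>x. x \<in> SQ' \<Longrightarrow> cdiff Q' x"
    using n'(1) unfolding eventually_nhds by blast
  obtain Sf where Sf: "open Sf" "0 \<in> Sf" "\<And>x. x \<in> Sf \<Longrightarrow> cdiff f x"
    using cd(1) unfolding eventually_nhds by blast
  obtain Sg where Sg: "open Sg" "0 \<in> Sg" "\<And>x. x \<in> Sg \<Longrightarrow> cdiff g x"
    using cd(2) unfolding eventually_nhds by blast
  have t0: "?t 0 = 0" using n(5) by (simp add: slice_tau_def bar_zero z0)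
  have cdt: "\<forall>\<^sub>F p in nhds 0. cdiff ?t p"
  proof -
    have "\<forall>\<^sub>F p in nhds 0. cdiff (bar Q) (snd p, fst p, 0)"
      by (rule eventually_nhds_compose[where h = "\<lambda>p. (snd p, fst p, 0)"])
        (use holomorphic_near_bar[of Q] n(1) in \<open>auto simp: z0 holomorphic_near_iff intro!: continuous_intros\<close>)
    then show ?thesis
    proof eventually_elim
      case (elim p)
      have "cdiff (\<lambda>p. bar Q (snd p, fst p, 0)) p"
        by (rule cdiff_compose[OF cdiff_Pair[OF cdiff_snd cdiff_Pair[OF cdiff_fst cdiff_const]] elim])
      then show ?case by (simp add: slice_tau_def[abs_def])
    qed
  qed
  have ct: "isCont ?t 0" by (rule cdiff_isCont[OF eventually_nhds_x_imp_x[OF cdt]])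
  have cX: "isCont ?X 0" by (intro continuous_intros ct)
  have cs: "isCont (\<lambda>p. (snd p, ?t p)) 0" by (intro continuous_intros ct)
  have e_f: "\<forall>\<^sub>F p in nhds (0 :: (complex ^ 'n) \<times> (complex ^ 'n)). (fst p, 0) \<in> Sf \<inter> Sg"
    by (rule eventually_nhds_compose[where h = "\<lambda>p. (fst p, 0)"])
      (use Sf Sg in \<open>auto simp: z0 intro!: continuous_intros eventually_conj eventually_nhds_in_open\<close>)
  have e_ft: "\<forall>\<^sub>F p in nhds 0. cdiff ft (snd p, ?t p)"
    by (rule eventually_nhds_compose[where h = "\<lambda>p. (snd p, ?t p)"])
      (use cd t0 cs in \<open>auto simp: z0\<close>)
  have e_gt: "\<forall>\<^sub>F p in nhds 0. cdiff gt (snd p, ?t p)"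
    by (rule eventually_nhds_compose[where h = "\<lambda>p. (snd p, ?t p)"])
      (use cd t0 cs in \<open>auto simp: z0\<close>)
  have e_Y: "\<forall>\<^sub>F p in nhds 0. cdiff ?Y p"
    using e_f e_ft e_gt cdt
  proof eventually_elim
    case (elim p)
    have 1: "cdiff (\<lambda>p. (snd p, ?t p)) p" by (intro cdiff_Pair cdiff_snd elim(4))
    have 2: "cdiff (\<lambda>p. f (fst p, 0)) p"
      by (rule cdiff_compose[OF cdiff_Pair[OF cdiff_fst cdiff_const] Sf(3)]) (use elim(1) in blast)
    show ?case
      by (intro cdiff_Pair 2 cdiff_compose[OF 1 elim(2)] cdiff_compose[OF 1 elim(3)])
  qed
  have cY: "isCont ?Y 0" by (rule cdiff_isCont[OF eventually_nhds_x_imp_x[OF e_Y]])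
  have Y0: "?Y 0 = 0" using zero t0 by (simp add: z0)
  have e_SQ: "\<forall>\<^sub>F p in nhds 0. ?X p \<in> SQ"
    by (rule eventually_nhds_compose[where h = ?X])
      (use SQ t0 cX in \<open>auto simp: z0 intro!: eventually_nhds_in_open\<close>)
  have e_SQ': "\<forall>\<^sub>F p in nhds 0. ?Y p \<in> SQ'"
    by (rule eventually_nhds_compose[where h = ?Y, OF _ cY], unfold Y0, rule eventually_nhds_in_open[OF SQ'(1,2)])
  (* By the reality condition, the point with this \<tau>-coordinate does lie on w = 0. *)
  have e_Q0: "\<forall>\<^sub>F p in nhds 0. Q (?X p) = 0"
  proof -
    have "\<forall>\<^sub>F p in nhds 0. let p = (fst p, snd p, 0) in
        Q (fst p, fst (snd p), bar Q (fst (snd p), fst p, snd (snd p))) = snd (snd p)"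
      unfolding Let_def
      by (rule eventually_nhds_compose[where h = "\<lambda>p. (fst p, snd p, 0)"])
        (use n(4) in \<open>auto simp: z0 intro!: continuous_intros\<close>)
    then show ?thesis by (simp add: slice_tau_def)
  qed
  have Qz: "\<forall>\<^sub>F z in nhds 0. Q (z, 0, 0) = 0"
    by (rule eventually_nhds_compose[where h = "\<lambda>z. (z, 0)" and P = "\<lambda>p. Q (fst p, 0, snd p) = snd p", simplified])
      (use n(3) in \<open>auto simp: z0 intro!: continuous_intros\<close>)
  have Q'z: "\<forall>\<^sub>F z in nhds 0. Q' (z, 0, 0) = 0"
    by (rule eventually_nhds_compose[where h = "\<lambda>z. (z, 0)" and P = "\<lambda>p. Q' (fst p, 0, snd p) = snd p", simplified])
      (use n'(3) in \<open>auto simp: z0 intro!: continuous_intros\<close>)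
  have Qx: "\<forall>\<^sub>F x in nhds 0. Q (0, x, 0) = 0"
    by (rule eventually_nhds_compose[where h = "\<lambda>x. (x, 0)" and P = "\<lambda>p. Q (0, fst p, snd p) = snd p", simplified])
      (use n(2) in \<open>auto simp: z0 intro!: continuous_intros\<close>)
  have cf: "isCont (\<lambda>z. f (z, 0)) 0"
    by (rule isCont_o2[where f = "\<lambda>z. (z, 0)"])
      (use holomorphic_near_isCont[OF hol(1)] in \<open>auto simp: z0 intro!: continuous_intros\<close>)
  have cft: "isCont (\<lambda>z. ft (z, 0)) 0"
    by (rule isCont_o2[where f = "\<lambda>z. (z, 0)"])
      (use holomorphic_near_isCont[OF hol(3)] in \<open>auto simp: z0 intro!: continuous_intros\<close>)
  have cgt: "isCont (\<lambda>z. gt (z, 0)) 0"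
    by (rule isCont_o2[where f = "\<lambda>z. (z, 0)"])
      (use holomorphic_near_isCont[OF hol(4)] in \<open>auto simp: z0 intro!: continuous_intros\<close>)
  have Q'fz: "\<forall>\<^sub>F z in nhds 0. \<forall>\<^sub>F y in nhds (f (z, 0)). Q' (y, 0, 0) = 0"
    by (rule eventually_nhds_compose[where h = "\<lambda>z. f (z, 0)", OF _ cf])
      (use Q'z zero in \<open>simp add: z0 eventually_eventually\<close>)
  (* At \<xi> = 0, \<tau> = 0 the normal forms reduce the mapping equation to g (z, 0) = 0. *)
  have gz: "\<forall>\<^sub>F z in nhds 0. g (z, 0) = 0"
  proof -
    have "\<forall>\<^sub>F z in nhds 0. case (z, 0, 0) of (z, \<xi>, \<tau>) \<Rightarrow>
        g (z, Q (z, \<xi>, \<tau>)) = Q' (f (z, Q (z, \<xi>, \<tau>)), ft (\<xi>, \<tau>), gt (\<xi>, \<tau>))"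
      by (rule eventually_nhds_compose[where h = "\<lambda>z. (z, 0, 0)", OF E0])
        (intro continuous_intros)
    with Qz Q'fz show ?thesis
    proof eventually_elim
      case (elim z)
      then show ?case using eventually_nhds_x_imp_x[OF elim(2)] zero by (simp add: z0)
    qed
  qed
  have e_g0: "\<forall>\<^sub>F p in nhds (0 :: (complex ^ 'n) \<times> (complex ^ 'n)). \<forall>\<^sub>F x in nhds (fst p). g (x, 0) = 0"
    by (rule eventually_nhds_compose[where h = fst])
      (use gz in \<open>auto simp: eventually_eventually intro!: continuous_intros\<close>)
  have e_E: "\<forall>\<^sub>F p in nhds 0. \<forall>\<^sub>F x in nhds (fst p).
      g (x, Q (x, snd p, ?t p)) = Q' (f (x, Q (x, snd p, ?t p)), ft (snd p, ?t p), gt (snd p, ?t p))"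
  proof -
    have "\<forall>\<^sub>F p in nhds 0. \<forall>\<^sub>F q in nhds (?X p). case q of (z, \<xi>, \<tau>) \<Rightarrow>
        g (z, Q (z, \<xi>, \<tau>)) = Q' (f (z, Q (z, \<xi>, \<tau>)), ft (\<xi>, \<tau>), gt (\<xi>, \<tau>))"
      by (rule eventually_nhds_compose[where h = ?X, OF _ cX])
        (use E t0 in \<open>simp add: z0 eventually_eventually\<close>)
    then show ?thesis
    proof eventually_elim
      case (elim p)
      show ?case
        by (rule eventually_nhds_compose[where h = "\<lambda>x. (x, snd p, ?t p)", OF elim, simplified])
    qed
  qed
  have good: "\<forall>\<^sub>F p in nhds 0. cdiff ?t p \<and> (fst p, 0) \<in> Sf \<inter> Sg \<and> cdiff ?Y p \<and> ?X p \<in> SQ \<and> ?Y p \<in> SQ' \<and>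
      (\<forall>j. (\<Sum>k\<in>UNIV. target_covector Q Q' f ft gt p $ k * tangential_jacobian f (fst p) $ k $ j) =
        transversal_factor (target_covector Q Q' f ft gt) (normal_deriv g) (normal_deriv_vec f) p *
        source_covector Q p $ j)"
    using cdt e_f e_Y e_SQ e_SQ' e_Q0 e_g0 e_E
  proof eventually_elim
    case (elim p)
    have "(\<Sum>k\<in>UNIV. target_covector Q Q' f ft gt p $ k * tangential_jacobian f (fst p) $ k $ j) =
        transversal_factor (target_covector Q Q' f ft gt) (normal_deriv g) (normal_deriv_vec f) p *
        source_covector Q p $ j" for j
      using covector_identity[of Q "fst p" "snd p" "?t p" f g Q' "ft (snd p, ?t p)" "gt (snd p, ?t p)" j]
        SQ(3)[OF elim(4)] elim(6) Sf(3) Sg(3) elim(2) SQ'(3)[OF elim(5)] elim(7,8)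
      by (simp add: target_covector_def tangential_jacobian_def transversal_factor_def
          normal_deriv_def normal_deriv_vec_def source_covector_def)
    then show ?case using elim by blast
  qed
  have good_z: "\<forall>\<^sub>F z in nhds 0. target_covector Q Q' f ft gt (z, 0) = 0 \<and> source_covector Q (z, 0) = 0"
  proof -
    have tz: "\<forall>\<^sub>F z in nhds 0. ?t (z, 0) = 0"
    proof -
      have "\<forall>\<^sub>F z in nhds 0. Q (0, conj z, 0) = 0"
        by (rule eventually_nhds_compose[where h = conj])
          (use Qx in \<open>auto intro!: continuous_intros\<close>)
      then show ?thesis by eventually_elim (simp add: slice_tau_def bar_def)
    qed
    have Qzz: "\<forall>\<^sub>F z in nhds 0. \<forall>\<^sub>F y in nhds z. Q (y, 0, 0) = 0"
      using Qz by (simp add: eventually_eventually)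
    from tz Q'fz Qzz show ?thesis
    proof eventually_elim
      case (elim z)
      have "dird (axis k 1, 0) Q' (f (z, 0), 0) = 0" for k
        by (rule dird_eventually_zero) (use elim(2) in \<open>simp add: zero_prod_def\<close>)
      moreover have "dird (axis k 1, 0) Q (z, 0) = 0" for k
        by (rule dird_eventually_zero) (use elim(3) in \<open>simp add: zero_prod_def\<close>)
      ultimately show ?case
        using elim(1) zero by (simp add: target_covector_def source_covector_def z0 zero_vec_def[symmetric])
    qed
  qed
  have tx: "\<forall>\<^sub>F x in nhds 0. ?t (0, x) = 0"
  proof -
    have "\<forall>\<^sub>F z in nhds 0. Q (conj z, 0, 0) = 0"
      by (rule eventually_nhds_compose[where h = conj])
        (use Qz in \<open>auto intro!: continuous_intros\<close>)
    then show ?thesis by eventually_elim (simp add: slice_tau_def bar_def)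
  qed
  (* At z = 0, \<tau> = 0 the left-hand side is g 0, and the normal form of the target turns the right-hand side into gt. *)
  have gtx: "\<forall>\<^sub>F x in nhds 0. gt (x, 0) = 0"
  proof -
    have "\<forall>\<^sub>F x in nhds 0. case (0, x, 0) of (z, \<xi>, \<tau>) \<Rightarrow>
        g (z, Q (z, \<xi>, \<tau>)) = Q' (f (z, Q (z, \<xi>, \<tau>)), ft (\<xi>, \<tau>), gt (\<xi>, \<tau>))"
      by (rule eventually_nhds_compose[where h = "\<lambda>x. (0, x, 0)", OF E0])
        (intro continuous_intros)
    moreover have "\<forall>\<^sub>F x in nhds 0. Q' (0, ft (x, 0), gt (x, 0)) = gt (x, 0)"
      by (rule eventually_nhds_compose[where h = "\<lambda>x. (ft (x, 0), gt (x, 0))" and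
            P = "\<lambda>p. Q' (0, fst p, snd p) = snd p", simplified fst_conv snd_conv])
        (use n'(2) zero cft cgt in \<open>auto simp: z0 intro!: continuous_intros\<close>)
    ultimately show ?thesis using Qx
    proof eventually_elim
      case (elim x)
      then show ?case using zero by (simp add: z0)
    qed
  qed
  have covx: "\<forall>\<^sub>F x in nhds 0. target_covector Q Q' f ft gt (0, x) = (\<chi> k. dird (axis k 1, 0) Q' (0, ft (x, 0), 0))"
    using tx gtx by eventually_elim (use zero in \<open>simp add: target_covector_def z0\<close>)
  have good_x: "\<forall>\<^sub>F x in nhds 0. transversal_factor (target_covector Q Q' f ft gt) (normal_deriv g)
      (normal_deriv_vec f) (0, x) = normal_deriv gt x"
  proof -
    have 1: "\<forall>\<^sub>F x in nhds 0. cdiff ft (x, 0)" "\<forall>\<^sub>F x in nhds 0. cdiff gt (x, 0)"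
      by (rule eventually_nhds_compose[where h = "\<lambda>x. (x, 0)"],
          use cd in \<open>auto simp: z0 intro!: continuous_intros\<close>)+
    have 2: "\<forall>\<^sub>F x in nhds 0. cdiff Q' (0, ft (x, 0), 0)"
      by (rule eventually_nhds_compose[where h = "\<lambda>x. (0, ft (x, 0), 0)"])
        (use n'(1) zero cft in \<open>auto simp: z0 intro!: continuous_intros\<close>)
    have 3: "\<forall>\<^sub>F x in nhds 0. \<forall>\<^sub>F p in nhds (ft (x, 0), 0). Q' (0, fst p, snd p) = snd p"
      by (rule eventually_nhds_compose[where h = "\<lambda>x. (ft (x, 0), 0)"])
        (use n'(2) zero cft in \<open>auto simp: z0 eventually_eventually intro!: continuous_intros\<close>)
    have 4: "\<forall>\<^sub>F x in nhds 0. \<forall>\<^sub>F t in nhds 0. g (0, t) = Q' (f (0, t), ft (x, t), gt (x, t))"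
    proof -
      have a: "\<forall>\<^sub>F x in nhds 0. \<forall>\<^sub>F q in nhds (0, x, 0). case q of (z, \<xi>, \<tau>) \<Rightarrow>
          g (z, Q (z, \<xi>, \<tau>)) = Q' (f (z, Q (z, \<xi>, \<tau>)), ft (\<xi>, \<tau>), gt (\<xi>, \<tau>))"
        by (rule eventually_nhds_compose[where h = "\<lambda>x. (0, x, 0)"])
          (use E in \<open>auto simp: z0 eventually_eventually intro!: continuous_intros\<close>)
      have b: "\<forall>\<^sub>F x in nhds 0. \<forall>\<^sub>F q in nhds (x, 0). Q (0, fst q, snd q) = snd q"
        by (rule eventually_nhds_compose[where h = "\<lambda>x. (x, 0)"])
          (use n(2) in \<open>auto simp: z0 eventually_eventually intro!: continuous_intros\<close>)
      from a b show ?thesis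
      proof eventually_elim
        case (elim x)
        have "\<forall>\<^sub>F t in nhds 0. g (0, Q (0, x, t)) = Q' (f (0, Q (0, x, t)), ft (x, t), gt (x, t))"
          by (rule eventually_nhds_compose[where h = "\<lambda>t. (0, x, t)", OF elim(1), simplified])
        moreover have "\<forall>\<^sub>F t in nhds 0. Q (0, x, t) = t"
          by (rule eventually_nhds_compose[where h = "\<lambda>t. (x, t)", OF elim(2), simplified])
        ultimately show ?case by eventually_elim simp
      qed
    qed
    from covx gtx 1 2 3 4 show ?thesis
    proof eventually_elim
      case (elim x)
      have "dird (0, 1) g (0, 0) -
          (\<Sum>k\<in>UNIV. dird (axis k 1, 0) Q' (0, ft (x, 0), 0) * dird (0, 1) (\<lambda>x. f x $ k) (0, 0)) =
          dird (0, 1) gt (x, 0)"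
        by (rule normal_derivative_identity)
          (use elim zero eventually_nhds_x_imp_x[OF cd(1)] eventually_nhds_x_imp_x[OF cd(2)] in \<open>simp_all add: z0\<close>)
      then show ?case using elim(1)
        by (simp add: transversal_factor_def normal_deriv_def normal_deriv_vec_def)
    qed
  qed
  obtain r1 where r1: "r1 > 0" and good: "\<And>p. p \<in> ball 0 r1 \<times> ball 0 r1 \<Longrightarrow>
      cdiff ?t p \<and> (fst p, 0) \<in> Sf \<inter> Sg \<and> cdiff ?Y p \<and> ?X p \<in> SQ \<and> ?Y p \<in> SQ' \<and>
      (\<forall>j. (\<Sum>k\<in>UNIV. target_covector Q Q' f ft gt p $ k * tangential_jacobian f (fst p) $ k $ j) =
        transversal_factor (target_covector Q Q' f ft gt) (normal_deriv g) (normal_deriv_vec f) p *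
        source_covector Q p $ j)"
    using eventually_nhds_0_ball_Times[OF good] by blast
  obtain r2 where r2: "r2 > 0" and good_z: "\<And>z. z \<in> ball 0 r2 \<Longrightarrow>
      target_covector Q Q' f ft gt (z, 0) = 0 \<and> source_covector Q (z, 0) = 0"
    using eventually_nhds_0_ball[OF good_z] by blast
  obtain r3 where r3: "r3 > 0" and good_x: "\<And>x. x \<in> ball 0 r3 \<Longrightarrow>
      transversal_factor (target_covector Q Q' f ft gt) (normal_deriv g) (normal_deriv_vec f) (0, x) =
      normal_deriv gt x"
    using eventually_nhds_0_ball[OF good_x] by blast
  show ?thesis
  proof (intro exI[of _ "min r1 (min r2 r3)"] conjI allI impI)
    show "0 < min r1 (min r2 r3)" using r1 r2 r3 by simp
    fix \<rho> assume \<rho>: "0 < \<rho> \<and> \<rho> \<le> min r1 (min r2 r3)"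
    let ?B = "ball (0 :: complex ^ 'n) \<rho>"
    have B1: "p \<in> ball 0 r1 \<times> ball 0 r1" if "p \<in> ?B \<times> ?B" for p using that \<rho> by auto
    have Bz: "(z, 0) \<in> ?B \<times> ?B" if "z \<in> ?B" for z using that \<rho> by auto
    have gY: "cdiff ?Y p" and gSQ: "?X p \<in> SQ" and gSQ': "?Y p \<in> SQ'" and gt: "cdiff ?t p"
      if "p \<in> ?B \<times> ?B" for p
      using good[OF B1[OF that]] by auto
    have gX: "cdiff ?X p" if "p \<in> ?B \<times> ?B" for p
      by (intro cdiff_Pair cdiff_fst cdiff_snd gt[OF that])
    have gf: "(z, 0) \<in> Sf" and gg: "(z, 0) \<in> Sg" if "z \<in> ?B" for z
      using good[OF B1[OF Bz[OF that]]] by auto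
    have emb: "cdiff (\<lambda>z. (z, 0)) z" for z :: "complex ^ 'n"
      by (intro cdiff_Pair cdiff_ident cdiff_const)
    have oB: "open (?B \<times> ?B)" by (intro open_Times open_ball)
    show "covector_system \<rho> (target_covector Q Q' f ft gt) (source_covector Q) (tangential_jacobian f)
      (normal_deriv g) (normal_deriv_vec f)"
    proof
      show "0 < \<rho>" using \<rho> by simp
      show "lhol (\<lambda>p. target_covector Q Q' f ft gt p $ k) (?B \<times> ?B)" for k
        unfolding target_covector_def vec_lambda_beta
        by (rule lhol_dird_compose[OF SQ'(1,3) oB gY gSQ'])
      show "lhol (\<lambda>p. source_covector Q p $ k) (?B \<times> ?B)" for k
        unfolding source_covector_def vec_lambda_beta
        by (rule lhol_dird_compose[OF SQ(1,3) oB gX gSQ])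
      show "lhol (normal_deriv g) ?B"
        unfolding normal_deriv_def[abs_def]
        by (rule lhol_dird_compose[OF Sg(1,3) open_ball emb gg])
      show "lhol (\<lambda>z. normal_deriv_vec f z $ k) ?B" for k
        unfolding normal_deriv_vec_def vec_lambda_beta
        by (rule lhol_dird_compose[OF Sf(1) cdiff_compose[OF Sf(3) cdiff_nth] open_ball emb gf])
      show "lhol (\<lambda>z. tangential_jacobian f z $ i $ j) ?B" for i j
        unfolding tangential_jacobian_def vec_lambda_beta cpartial_eq_dird
      proof (rule lhol_dird, rule lhol_cdiff[OF open_ball])
        fix z assume "z \<in> ?B"
        then have "cdiff (\<lambda>z. f (z, 0)) z"
          by (intro cdiff_compose[OF emb Sf(3)] gf)
        then show "cdiff (\<lambda>x. f (x, 0) $ i) z" by (rule cdiff_compose[OF _ cdiff_nth])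
      qed
      show "(\<Sum>k\<in>UNIV. target_covector Q Q' f ft gt (z, \<xi>) $ k * tangential_jacobian f z $ k $ j) =
          transversal_factor (target_covector Q Q' f ft gt) (normal_deriv g) (normal_deriv_vec f) (z, \<xi>) *
          source_covector Q (z, \<xi>) $ j" if "z \<in> ?B" "\<xi> \<in> ?B" for z \<xi> j
        using good[OF B1, of "(z, \<xi>)"] that by auto
      show "target_covector Q Q' f ft gt (z, 0) = 0" "source_covector Q (z, 0) = 0" if "z \<in> ?B" for z
        using good_z[of z] that \<rho> by auto
      show "\<not> (\<forall>\<^sub>F z in nhds 0. det (tangential_jacobian f z) = 0)"
        using nd unfolding totally_segre_nondegenerate_def jac_det_def tangential_jacobian_def by blast
      fix c assume "\<forall>\<^sub>F \<xi> in nhds 0. (\<Sum>k\<in>UNIV. c k * target_covector Q Q' f ft gt (0, \<xi>) $ k) = 0"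
      with covx have "\<forall>\<^sub>F \<xi> in nhds 0. (\<Sum>k\<in>UNIV. c k * dird (axis k 1, 0) Q' (0, ft (\<xi>, 0), 0)) = 0"
        by eventually_elim simp
      then show "c = (\<lambda>_. 0)"
        using covector_independent[OF Q' fin hol(3) zero(3)] nd
        unfolding totally_segre_nondegenerate_def by blast
    qed
    show "\<forall>\<xi>\<in>?B. transversal_factor (target_covector Q Q' f ft gt) (normal_deriv g)
      (normal_deriv_vec f) (0, \<xi>) = normal_deriv gt \<xi>"
      using good_x \<rho> by auto
  qed
qed

section \<open>Linear algebra of covectors\<close>

text \<open>Used to cancel the matrix in the identities of covectors.\<close>

lemma covector_kernel_trivial:
  fixes N :: "complex ^ 'n ^ 'n"
  assumes "det N \<noteq> 0" "\<And>j. (\<Sum>k\<in>UNIV. x $ k * N $ k $ j) = 0"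
  shows "x = 0"
proof -
  have "det (transpose N) \<noteq> 0" using assms(1) by (simp add: det_transpose)
  then have "\<exists>B. B ** transpose N = mat 1"
    using invertible_det_nz invertible_def by blast
  moreover have "transpose N *v x = 0"
    using assms(2) by (simp add: vec_eq_iff matrix_vector_mult_def transpose_def mult.commute)
  ultimately show ?thesis using matrix_left_invertible_ker by blast
qed

text \<open>Put a basis of the span of \<open>S\<close>, chosen inside \<open>S\<close>, into the rows of a matrix and fill the
remaining rows with \<open>0\<close>. The kernel of the matrix annihilates \<open>S\<close>, so it is trivial; hence there were no
remaining rows.\<close>

lemma exists_nonsingular_rows:
  fixes S :: "(complex ^ 'n::finite) set"
  assumes S: "\<And>c. (\<And>x. x \<in> S \<Longrightarrow> (\<Sum>k\<in>UNIV. c k * x $ k) = 0) \<Longrightarrow> c = (\<lambda>_. 0)"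
  shows "\<exists>w. (\<forall>i. w i \<in> S) \<and> det (\<chi> i :: 'n. w i) \<noteq> 0"
proof -
  obtain B where B: "B \<subseteq> S" "vec.independent B" "S \<subseteq> vec.span B" "card B = vec.dim S"
    by (rule vec.basis_exists)
  have "card B \<le> card (UNIV :: 'n set)"
    using vec.dim_subset[of S UNIV] by (simp only: B(4) vec_dim_card subset_UNIV)
  then obtain h :: "complex ^ 'n \<Rightarrow> 'n" where h: "inj_on h B"
    using card_le_inj[of B "UNIV :: 'n set"] vec.finiteI_independent[OF B(2)] by auto
  define w where "w i = (if i \<in> h ` B then inv_into B h i else 0)" for i
  define M :: "complex ^ 'n ^ 'n" where "M = (\<chi> i. w i)"
  have "x = 0" if "M *v x = 0" for x
  proof -
    have Bx: "(\<Sum>k\<in>UNIV. x $ k * b $ k) = 0" if "b \<in> B" for b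
    proof -
      have "w (h b) = b" using that h by (simp add: w_def)
      then have "(M *v x) $ h b = (\<Sum>k\<in>UNIV. x $ k * b $ k)"
        by (simp add: M_def matrix_vector_mult_def mult.commute)
      then show ?thesis using \<open>M *v x = 0\<close> by simp
    qed
    let ?H = "{y :: complex ^ 'n. (\<Sum>k\<in>UNIV. x $ k * y $ k) = 0}"
    have "vec.subspace ?H"
      unfolding vec.subspace_def
      by (auto simp: distrib_left sum.distrib mult.left_commute sum_distrib_left[symmetric])
    then have "vec.span B \<subseteq> ?H" using Bx by (intro vec.span_minimal) auto
    then have "(\<lambda>k. x $ k) = (\<lambda>_. 0)" using B(3) by (intro S) auto
    then show ?thesis by (simp add: vec_eq_iff fun_eq_iff)
  qed
  then have "\<exists>B. B ** M = mat 1" using matrix_left_invertible_ker by blast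
  then have "invertible M" by (simp add: invertible_left_inverse)
  then have det: "det M \<noteq> 0" by (simp add: invertible_det_nz)
  have "w i \<in> S" for i
  proof (cases "i \<in> h ` B")
    case True
    then show ?thesis using B(1) by (auto simp: w_def inv_into_into h)
  next
    case False
    then have "row i M = 0" by (simp add: M_def row_def w_def vec_eq_iff)
    then show ?thesis using det det_zero_row(2)[of i M] by simp
  qed
  then show ?thesis using det unfolding M_def by blast
qed

section \<open>Transversality\<close>

context covector_system
begin

abbreviation "B \<equiv> ball (0 :: complex ^ 'n) \<rho>"
abbreviation "b \<equiv> transversal_factor A gw fw"

lemma zero_in_B: "0 \<in> B"
  using radius by simp

lemma eventually_B: "\<forall>\<^sub>F z in nhds 0. z \<in> B"
  using radius by (intro eventually_nhds_in_open) auto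

lemma b_lhol: "lhol b (B \<times> B)"
proof -
  have "lhol (\<lambda>p. gw (fst p)) (B \<times> B)"
    by (rule lhol_compose_fst[OF gw_lhol open_ball])
  moreover have "lhol (\<lambda>p. fw (fst p) $ k) (B \<times> B)" for k
    by (rule lhol_compose_fst[OF fw_lhol open_ball])
  ultimately show ?thesis
    unfolding transversal_factor_def[abs_def]
    by (intro lhol_diff lhol_sum lhol_mult A_lhol open_Times open_ball)
qed

lemma b_zero_right: "z \<in> B \<Longrightarrow> b (z, 0) = gw z"
  by (simp add: transversal_factor_def A_zero)

lemma det_J_lhol: "lhol (\<lambda>z. det (J z)) B"
  by (intro lhol_det open_ball J_lhol)

text \<open>Where the identity degenerates over a point with invertible Jacobian, the covector of the target vanishes. The factor
\<open>b\<close> then reduces to \<open>gw\<close>, so that zeros of \<open>b\<close> are controlled by zeros of \<open>gw\<close>.\<close>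

lemma A_eq_zero:
  assumes "z \<in> B" "\<xi> \<in> B" "det (J z) \<noteq> 0" "b (z, \<xi>) = 0"
  shows "A (z, \<xi>) = 0"
  using identity[OF assms(1,2)] assms(4) by (intro covector_kernel_trivial[OF assms(3)]) simp

lemma det_J_nonzero_point: "\<exists>z\<in>B. det (J z) \<noteq> 0"
proof (rule ccontr)
  assume "\<not> (\<exists>z\<in>B. det (J z) \<noteq> 0)"
  then have "\<forall>\<^sub>F z in nhds 0. det (J z) = 0" using eventually_B by (auto elim: eventually_mono)
  with J_nonzero show False by blast
qed

text \<open>If \<open>gw\<close> vanishes, then \<open>b = - A \<cdot> fw\<close> and the identity becomes \<open>A \<cdot> (J + fw \<otimes> R) = 0\<close>. For fixed \<open>z\<close>
with \<open>J z\<close> invertible, the matrix in parentheses is invertible for small \<open>\<xi>\<close>, because \<open>R\<close> vanishes at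
\<open>\<xi> = 0\<close>. So \<open>A (z, \<xi>) = 0\<close> for small \<open>\<xi>\<close>, and by two applications of the identity theorem also at
\<open>z = 0\<close>, contrary to the independence of the components of \<open>A (0, \<xi>)\<close>.\<close>

lemma gw_not_zero: "\<not> (\<forall>z\<in>B. gw z = 0)"
proof
  assume gw: "\<forall>z\<in>B. gw z = 0"
  have slice: "A (z, \<xi>) $ k = 0" if z: "z \<in> B" "det (J z) \<noteq> 0" and \<xi>: "\<xi> \<in> B" for z \<xi> k
  proof -
    (* The matrix J + fw \<otimes> R, which the covector A annihilates when gw = 0. *)
    define N where "N x = (\<chi> k j. J z $ k $ j + fw z $ k * R (z, x) $ j)" for x
    have "lhol (\<lambda>x. N x $ k $ j) B" for k j
      unfolding N_def vec_lambda_beta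
      by (intro lhol_add lhol_mult lhol_const open_ball lhol_slice_right[OF R_lhol open_ball z(1)])
    then have "lhol (\<lambda>x. det (N x)) B" by (intro lhol_det open_ball)
    then have c: "isCont (\<lambda>x. det (N x)) 0"
      by (rule lhol_isCont[OF _ zero_in_B])
    have "N 0 = J z" using R_zero[OF z(1)] by (simp add: N_def vec_eq_iff)
    then have "det (N 0) \<noteq> 0" using z(2) by simp
    from eventually_nhds_compose[where h = "\<lambda>x. det (N x)", OF t1_space_nhds[OF this] c]
    have "\<forall>\<^sub>F x in nhds 0. det (N x) \<noteq> 0" .
    then have "\<forall>\<^sub>F x in nhds 0. A (z, x) $ k = 0"
      using eventually_B
    proof eventually_elim
      case (elim x)
      have "(\<Sum>k\<in>UNIV. A (z, x) $ k * N x $ k $ j) = 0" for j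
        using identity[OF z(1) elim(2), of j] gw z(1)
        by (simp add: N_def transversal_factor_def distrib_left sum.distrib sum_distrib_right mult.assoc)
      then have "A (z, x) = 0" by (rule covector_kernel_trivial[OF elim(1)])
      then show ?case by simp
    qed
    from lhol_identity[OF lhol_slice_right[OF A_lhol open_ball z(1)] convex_ball zero_in_B this \<xi>]
    show ?thesis .
  qed
  have "A (0, \<xi>) $ k = 0" if \<xi>: "\<xi> \<in> B" for \<xi> k
  proof (rule ccontr)
    assume nz: "A (0, \<xi>) $ k \<noteq> 0"
    obtain z0 where z0: "z0 \<in> B" "det (J z0) \<noteq> 0" using det_J_nonzero_point by blast
    have "\<exists>z\<in>B. det (J z) \<noteq> 0 \<and> A (z, \<xi>) $ k \<noteq> 0"
      by (rule lhol_nonzero_mult[OF det_J_lhol lhol_slice_left[OF A_lhol open_ball \<xi>] convex_ball z0 zero_in_B nz])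
    with slice \<xi> show False by blast
  qed
  then have "\<forall>\<^sub>F \<xi> in nhds 0. (\<Sum>k\<in>UNIV. 1 * A (0, \<xi>) $ k) = 0"
    using eventually_B by (auto elim: eventually_mono)
  then have "(\<lambda>_ :: 'n. 1 :: complex) = (\<lambda>_. 0)" by (rule A_independent)
  then show False by (simp add: fun_eq_iff)
qed

text \<open>On a disc \<open>z = s v\<close> the function \<open>b (s v, \<xi>)\<close> can vanish only at the centre, and on the boundary circle it is
bounded below uniformly in \<open>\<xi>\<close>. If it does not vanish at the centre either, the maximum principle for its
inverse carries the lower bound to the centre. This bound is violated as \<open>\<xi> \<rightarrow> 0\<close>, where
\<open>b (0, \<xi>) \<rightarrow> b (0, 0) = 0\<close>.\<close>

lemma degenerate_imp_b_zero:
  assumes b0: "b (0, 0) = 0"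
  shows "\<forall>\<^sub>F \<xi> in nhds 0. b (0, \<xi>) = 0"
proof -
  obtain z1 where z1: "z1 \<in> B" "gw z1 \<noteq> 0" using gw_not_zero by blast
  obtain z2 where z2: "z2 \<in> B" "det (J z2) \<noteq> 0" using det_J_nonzero_point by blast
  obtain v where v: "v \<in> B" "det (J v) \<noteq> 0" "gw v \<noteq> 0"
    using lhol_nonzero_mult[OF det_J_lhol gw_lhol convex_ball z2 z1] by blast
  have "\<forall>\<^sub>F s in at 0. det (J (cscale s v)) * gw (cscale s v) \<noteq> 0 \<and> cscale s v \<in> B"
    by (rule lhol_isolated_zero[OF lhol_mult[OF det_J_lhol gw_lhol] convex_ball zero_in_B v(1)]) (use v in simp)
  then obtain d where d: "d > 0" "\<And>s. s \<noteq> 0 \<Longrightarrow> dist s 0 < d \<Longrightarrow>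
      det (J (cscale s v)) \<noteq> 0 \<and> gw (cscale s v) \<noteq> 0 \<and> cscale s v \<in> B"
    unfolding eventually_at by auto
  (* The closed disc of radius r has to lie inside the open disc of radius d. *)
  define r where "r = d / 2"
  have r: "r > 0" using d by (simp add: r_def)
  have line: "cscale s v \<in> B" if "s \<in> cball 0 r" for s
    using d that zero_in_B by (cases "s = 0") (auto simp: r_def)
  have b_nz: "b (cscale s v, \<xi>) \<noteq> 0" if s: "s \<in> cball 0 r" "s \<noteq> 0" and \<xi>: "\<xi> \<in> B" for s \<xi>
  proof
    assume z: "b (cscale s v, \<xi>) = 0"
    have *: "det (J (cscale s v)) \<noteq> 0" "gw (cscale s v) \<noteq> 0" using d s by (auto simp: r_def)
    have "A (cscale s v, \<xi>) = 0" by (rule A_eq_zero[OF line[OF s(1)] \<xi> *(1) z])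
    then have "b (cscale s v, \<xi>) = gw (cscale s v)" by (simp add: transversal_factor_def)
    with z * show False by simp
  qed
  have gcont: "continuous_on (sphere 0 r) (\<lambda>s. norm (gw (cscale s v)))"
    using line by (intro continuous_on_norm continuous_on_compose2[OF lhol_continuous[OF gw_lhol]]
        bounded_linear.continuous_on[OF bounded_linear_cscale_left] continuous_on_id)
      auto
  (* At \<xi> = 0 the factor b equals gw, so its minimum on the circle is positive. *)
  obtain s0 where s0: "s0 \<in> sphere 0 r" "\<And>s. s \<in> sphere 0 r \<Longrightarrow> norm (gw (cscale s0 v)) \<le> norm (gw (cscale s v))"
    using continuous_attains_inf[OF compact_sphere _ gcont] r by auto
  define m where "m = norm (gw (cscale s0 v)) / 2"
  have m: "m > 0" using s0(1) d(2)[of s0] r by (auto simp: m_def r_def)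
  (* Half of the minimum remains a lower bound on the circle for all \<xi> close to 0, by the tube lemma. *)
  define q where "q = (\<lambda>(\<xi> :: complex ^ 'n, s). (cscale s v, \<xi>))"
  have qc: "continuous_on X q" for X
    unfolding q_def case_prod_beta
    by (intro continuous_intros bounded_linear.continuous_on[OF bounded_linear_cscale_left])
  define W where "W = q -` (B \<times> B \<inter> b -` {y. m < norm y})"
  have oW: "open W"
    unfolding W_def
    by (intro open_vimage[OF _ qc] continuous_open_preimage[OF lhol_continuous[OF b_lhol]] open_Times open_ball
        open_Collect_less continuous_intros)
  have sub: "{0} \<times> sphere 0 r \<subseteq> W"
  proof clarify
    fix s :: complex assume s: "s \<in> sphere 0 r"
    have "cscale s v \<in> B" using line[of s] s by simp
    moreover have "m < norm (gw (cscale s v))" using s0(2)[OF s] m unfolding m_def by linarith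
    ultimately show "(0, s) \<in> W" using zero_in_B by (simp add: W_def q_def b_zero_right)
  qed
  obtain X where X: "0 \<in> X" "open X" "X \<times> sphere 0 r \<subseteq> W"
    using Elementary_Topology.tube_lemma[OF compact_sphere oW sub] by (elim exE conjE)
  have lower: "m \<le> norm (b (0, \<xi>))" if \<xi>: "\<xi> \<in> X" "\<xi> \<in> B" and nz: "b (0, \<xi>) \<noteq> 0" for \<xi>
  proof -
    have bs: "b (cscale s v, \<xi>) \<noteq> 0" if "s \<in> cball 0 r" for s
      using b_nz[OF that _ \<xi>(2)] nz by (cases "s = 0") auto
    have "(\<lambda>s. b (0 + cscale s v, \<xi>)) holomorphic_on {s. 0 + cscale s v \<in> B}"
      by (rule lhol_line[OF lhol_slice_left[OF b_lhol open_ball \<xi>(2)]])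
    then have "(\<lambda>s. b (cscale s v, \<xi>)) holomorphic_on {s. cscale s v \<in> B}" by (simp only: add_0_left)
    then have hol: "(\<lambda>s. b (cscale s v, \<xi>)) holomorphic_on cball 0 r"
      by (rule holomorphic_on_subset) (use line in blast)
    have hol': "(\<lambda>s. inverse (b (cscale s v, \<xi>))) holomorphic_on cball 0 r"
      by (intro holomorphic_on_inverse hol bs)
    have "norm (inverse (b (cscale 0 v, \<xi>))) \<le> inverse m"
    proof (rule maximum_modulus_frontier[where S = "cball 0 r" and \<xi> = 0 and
          f = "\<lambda>s. inverse (b (cscale s v, \<xi>))"])
      show "(\<lambda>s. inverse (b (cscale s v, \<xi>))) holomorphic_on interior (cball 0 r)"
        by (rule holomorphic_on_subset[OF hol' interior_subset])
      show "continuous_on (closure (cball 0 r)) (\<lambda>s. inverse (b (cscale s v, \<xi>)))"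
        using holomorphic_on_imp_continuous_on[OF hol'] by simp
      fix s :: complex assume "s \<in> frontier (cball 0 r)"
      then have "(\<xi>, s) \<in> W" using X(3) \<xi>(1) by auto
      then have "m < norm (b (cscale s v, \<xi>))" by (simp add: W_def q_def)
      then show "norm (inverse (b (cscale s v, \<xi>))) \<le> inverse m"
        using m by (simp add: norm_inverse le_imp_inverse_le)
    qed (use r in auto)
    then show ?thesis using nz m by (simp add: norm_inverse)
  qed
  have c: "isCont (\<lambda>\<xi>. b (0, \<xi>)) 0"
    by (rule lhol_isCont[OF lhol_slice_right[OF b_lhol open_ball zero_in_B] zero_in_B])
  have "b (0, 0) \<in> ball 0 m" using b0 m by simp
  from eventually_nhds_compose[where h = "\<lambda>\<xi>. b (0, \<xi>)", OF eventually_nhds_in_open[OF open_ball this] c]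
  have "\<forall>\<^sub>F \<xi> in nhds 0. b (0, \<xi>) \<in> ball 0 m" .
  then show ?thesis
    using eventually_nhds_in_open[OF X(2,1)] eventually_B
  proof eventually_elim
    case (elim \<xi>)
    show ?case using lower[OF elim(2,3)] elim(1) by (cases "b (0, \<xi>) = 0") auto
  qed
qed

lemma b_slice_lhol: "\<xi> \<in> B \<Longrightarrow> lhol (\<lambda>z. b (z, \<xi>)) B"
  by (rule lhol_slice_left[OF b_lhol open_ball])

lemma nonsingular_points:
  assumes \<delta>: "\<delta> > 0"
  shows "\<exists>x. (\<forall>i. x i \<in> ball 0 \<delta>) \<and> det (\<chi> i :: 'n. A (0, x i)) \<noteq> 0"
proof -
  have "\<exists>w. (\<forall>i. w i \<in> (\<lambda>\<xi>. A (0, \<xi>)) ` ball 0 \<delta>) \<and> det (\<chi> i :: 'n. w i) \<noteq> 0"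
  proof (rule exists_nonsingular_rows)
    fix c :: "'n \<Rightarrow> complex"
    assume c: "\<And>x. x \<in> (\<lambda>\<xi>. A (0, \<xi>)) ` ball 0 \<delta> \<Longrightarrow> (\<Sum>k\<in>UNIV. c k * x $ k) = 0"
    have "\<forall>\<^sub>F \<xi> in nhds 0. \<xi> \<in> ball (0 :: complex ^ 'n) \<delta>"
      using \<delta> by (intro eventually_nhds_in_open) auto
    then have "\<forall>\<^sub>F \<xi> in nhds 0. (\<Sum>k\<in>UNIV. c k * A (0, \<xi>) $ k) = 0"
      by eventually_elim (use c in blast)
    then show "c = (\<lambda>_. 0)" by (rule A_independent)
  qed
  then obtain w where w: "\<forall>i. w i \<in> (\<lambda>\<xi>. A (0, \<xi>)) ` ball 0 \<delta>" "det (\<chi> i :: 'n. w i) \<noteq> 0" by blast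
  then have "\<forall>i. \<exists>x. x \<in> ball 0 \<delta> \<and> w i = A (0, x)" by blast
  then obtain x where x: "\<And>i. x i \<in> ball 0 \<delta> \<and> w i = A (0, x i)" by metis
  then have "w = (\<lambda>i. A (0, x i))" by auto
  then show ?thesis using w(2) x by blast
qed

lemma det_identity:
  assumes z: "z \<in> B" and x: "\<And>i :: 'n. x i \<in> B"
  shows "det (\<chi> i. A (z, x i)) * det (J z) = (\<Prod>i\<in>UNIV. b (z, x i)) * det (\<chi> i. R (z, x i))"
proof -
  have "(\<chi> i. A (z, x i)) ** J z = (\<chi> i. b (z, x i) *s R (z, x i))"
    using identity[OF z x] by (simp add: vec_eq_iff matrix_matrix_mult_def)
  then have "det ((\<chi> i. A (z, x i)) ** J z) = det (\<chi> i. b (z, x i) *s R (z, x i))"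
    by (simp only:)
  then show ?thesis by (simp only: det_mul det_rows_mul)
qed

end

text \<open>Both systems contain the same covector \<open>R\<close>. With points \<open>x i\<close> for which the rows \<open>A (0, x i)\<close> are
independent, \<open>det_identity\<close> expresses \<open>det (J z)\<close> by the determinant of the rows
\<open>R (z, x i)\<close>, and this determinant by \<open>det (J' z)\<close>. The divisions are by \<open>det (A (z, x i))\<close> and by values of the second
transversal factor, all nonzero near \<open>z = 0\<close>.\<close>

lemma det_ratio_continuous:
  assumes 1: "covector_system \<rho> A R J gw fw" and 2: "covector_system \<rho> A' R J' gw' fw'"
    and b1: "transversal_factor A gw fw (0, 0) \<noteq> 0" and b2: "transversal_factor A' gw' fw' (0, 0) \<noteq> 0"
  shows "\<exists>u. isCont u 0 \<and> (\<forall>\<^sub>F z in nhds 0. det (J z) = u z * det (J' z))"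
proof -
  interpret s1: covector_system \<rho> A R J gw fw by (rule 1)
  interpret s2: covector_system \<rho> A' R J' gw' fw' by (rule 2)
  have nz: "\<forall>\<^sub>F \<xi> in nhds 0. F (0, \<xi>) \<noteq> 0" if F: "lhol F (s1.B \<times> s1.B)" "F (0, 0) \<noteq> 0"
    for F :: "(complex ^ 'a) \<times> (complex ^ 'a) \<Rightarrow> complex"
  proof -
    have "isCont (\<lambda>\<xi>. F (0, \<xi>)) 0"
      by (rule lhol_isCont[OF lhol_slice_right[OF F(1) open_ball s1.zero_in_B] s1.zero_in_B])
    from eventually_nhds_compose[where h = "\<lambda>\<xi>. F (0, \<xi>)", OF t1_space_nhds[OF F(2)] this]
    show ?thesis .
  qed
  have "\<forall>\<^sub>F \<xi> in nhds 0. \<xi> \<in> s1.B \<and> s1.b (0, \<xi>) \<noteq> 0 \<and> s2.b (0, \<xi>) \<noteq> 0"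
    using s1.eventually_B nz[OF s1.b_lhol b1] nz[OF s2.b_lhol b2] by eventually_elim simp
  then obtain \<delta> where \<delta>: "\<delta> > 0"
      "\<And>\<xi>. \<xi> \<in> ball 0 \<delta> \<Longrightarrow> \<xi> \<in> s1.B \<and> s1.b (0, \<xi>) \<noteq> 0 \<and> s2.b (0, \<xi>) \<noteq> 0"
    using eventually_nhds_0_ball by blast
  obtain x where x: "\<And>i. x i \<in> ball 0 \<delta>" "det (\<chi> i. A (0, x i)) \<noteq> 0"
    using s1.nonsingular_points[OF \<delta>(1)] by blast
  have xB: "x i \<in> s1.B" for i using x(1) \<delta>(2) by blast
  (* The quotient of these two functions is the multiplier. *)
  define N where "N z = (\<Prod>i\<in>UNIV. s1.b (z, x i)) * det (\<chi> i. A' (z, x i))" for z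
  define D where "D z = (\<Prod>i\<in>UNIV. s2.b (z, x i)) * det (\<chi> i. A (z, x i))" for z
  have "lhol (\<lambda>z. det (\<chi> i. A (z, x i))) s1.B" "lhol (\<lambda>z. det (\<chi> i. A' (z, x i))) s1.B"
    by (rule lhol_det[OF open_ball]; unfold vec_lambda_beta;
        rule lhol_slice_left[OF s1.A_lhol open_ball xB] lhol_slice_left[OF s2.A_lhol open_ball xB])+
  note dA = this
  have "lhol N s1.B"
    unfolding N_def[abs_def] by (intro lhol_mult lhol_prod open_ball s1.b_slice_lhol xB dA(2))
  then have c1: "isCont N 0" by (rule lhol_isCont[OF _ s1.zero_in_B])
  have "lhol D s1.B"
    unfolding D_def[abs_def] by (intro lhol_mult lhol_prod open_ball s2.b_slice_lhol xB dA(1))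
  then have c2: "isCont D 0" by (rule lhol_isCont[OF _ s1.zero_in_B])
  have D0: "D 0 \<noteq> 0" using x \<delta>(2) by (auto simp: D_def)
  have "\<forall>\<^sub>F z in nhds 0. D z \<noteq> 0"
    by (rule eventually_nhds_compose[OF t1_space_nhds[OF D0] c2])
  then have "\<forall>\<^sub>F z in nhds 0. det (J z) = N z / D z * det (J' z)"
    using s1.eventually_B
  proof eventually_elim
    case (elim z)
    have "D z * det (J z) = (\<Prod>i\<in>UNIV. s2.b (z, x i)) * ((\<Prod>i\<in>UNIV. s1.b (z, x i)) * det (\<chi> i. R (z, x i)))"
      using s1.det_identity[OF elim(2) xB] by (simp add: D_def)
    also have "\<dots> = N z * det (J' z)"
      using s2.det_identity[OF elim(2) xB] by (simp add: N_def)
    finally show ?case using elim(1) by (simp add: field_simps)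
  qed
  moreover have "isCont (\<lambda>z. N z / D z) 0" by (intro continuous_intros c1 c2 D0)
  ultimately show ?thesis by blast
qed

section \<open>Comparison of a Segre preserving map with its dual\<close>

text \<open>If the factor vanished at the origin, it would vanish at all points \<open>(0, \<xi>)\<close> with small \<open>\<xi>\<close>, and by the assumed link the function
\<open>gw'\<close> of the second system would be zero near \<open>0\<close>, which \<open>gw_not_zero\<close> excludes.\<close>

lemma transversal_pair:
  assumes 1: "covector_system \<rho> A R J gw fw" and 2: "covector_system \<rho> A' R' J' gw' fw'"
    and link: "\<And>\<xi>. \<xi> \<in> ball 0 \<rho> \<Longrightarrow> transversal_factor A gw fw (0, \<xi>) = cnj (gw' (conj \<xi>))"
  shows "transversal_factor A gw fw (0, 0) \<noteq> 0"
proof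
  interpret s1: covector_system \<rho> A R J gw fw by (rule 1)
  interpret s2: covector_system \<rho> A' R' J' gw' fw' by (rule 2)
  assume "transversal_factor A gw fw (0, 0) = 0"
  then have "\<forall>\<^sub>F \<xi> in nhds 0. s1.b (0, \<xi>) = 0" by (rule s1.degenerate_imp_b_zero)
  then have "\<forall>\<^sub>F \<xi> in nhds 0. gw' (conj \<xi>) = 0"
    using s1.eventually_B by eventually_elim (simp add: link)
  then have ev: "\<forall>\<^sub>F \<xi> in nhds (conj 0). gw' (conj \<xi>) = 0" by simp
  have "isCont conj (0 :: complex ^ 'a)" by (intro continuous_intros)
  from eventually_nhds_compose[where h = conj, OF ev this]
  have "\<forall>\<^sub>F z in nhds 0. gw' z = 0" by (simp add: conj_conj)
  from lhol_identity[OF s2.gw_lhol convex_ball s2.zero_in_B this] s2.gw_not_zero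
  show False by blast
qed

lemma det_cnj: "det (\<chi> i j. cnj (N $ i $ j) :: complex ^ 'n ^ 'n) = cnj (det (N :: complex ^ 'n ^ 'n))"
  unfolding det_def by simp

lemma jac_det_bar:
  fixes f :: "(complex ^ 'n::finite) \<times> complex \<Rightarrow> complex ^ 'n"
  assumes "cdiff f (conj z, 0)"
  shows "jac_det (bar f) z = cnj (jac_det f (conj z))"
proof -
  have "cdiff (\<lambda>x. f (x, 0)) (conj z)"
    by (rule cdiff_compose[OF cdiff_Pair[OF cdiff_ident cdiff_const] assms])
  then have c: "cdiff (\<lambda>x. f (x, 0) $ i) (conj z)" for i by (rule cdiff_compose[OF _ cdiff_nth])
  have "(\<lambda>x. bar f (x, 0) $ i) = bar (\<lambda>x. f (x, 0) $ i)" for i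
    by (simp add: bar_def fun_eq_iff)
  then have "cpartial j (\<lambda>x. bar f (x, 0) $ i) z = cnj (cpartial j (\<lambda>x. f (x, 0) $ i) (conj z))" for i j
    using dird_bar[OF c, of "axis j 1" i] by (simp add: cpartial_eq_dird conj_axis)
  then show ?thesis
    unfolding jac_det_def using det_cnj[of "\<chi> i j. cpartial j (\<lambda>x. f (x, 0) $ i) (conj z)"] by simp
qed

lemma jac_det_bar_eventually:
  fixes f :: "(complex ^ 'n::finite) \<times> complex \<Rightarrow> complex ^ 'n"
  assumes "holomorphic_near f 0"
  shows "\<forall>\<^sub>F z in nhds 0. jac_det (bar f) z = cnj (jac_det f (conj z))"
proof -
  have "\<forall>\<^sub>F z in nhds 0. cdiff f (conj z, 0)"
    by (rule eventually_nhds_compose[where h = "\<lambda>z. (conj z, 0)"])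
      (use assms in \<open>auto simp: zero_prod_def[symmetric] holomorphic_near_iff intro!: continuous_intros\<close>)
  then show ?thesis by eventually_elim (rule jac_det_bar)
qed

lemma eventually_nhds_conj_iff:
  fixes P :: "'a::{complex_space,euclidean_space} \<Rightarrow> bool"
  shows "(\<forall>\<^sub>F z in nhds 0. P (conj z)) \<longleftrightarrow> (\<forall>\<^sub>F z in nhds 0. P z)"
proof -
  have c: "isCont conj (0 :: 'a)" by (intro continuous_intros)
  have imp: "\<forall>\<^sub>F z in nhds 0. P (conj z)" if "\<forall>\<^sub>F z in nhds 0. P z" for P :: "'a \<Rightarrow> bool"
    by (rule eventually_nhds_compose[where h = conj, OF _ c]) (use that in simp)
  show ?thesis using imp[of P] imp[of "\<lambda>z. P (conj z)"] by (auto simp: conj_conj)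
qed

lemma totally_segre_nondegenerate_dual:
  fixes f ft :: "(complex ^ 'n::finite) \<times> complex \<Rightarrow> complex ^ 'n"
  assumes "totally_segre_nondegenerate f ft" "holomorphic_near f 0" "holomorphic_near ft 0"
  shows "totally_segre_nondegenerate (bar ft) (bar f)"
proof -
  have "\<forall>\<^sub>F z in nhds 0. jac_det h z = 0"
    if h: "holomorphic_near h 0" and z: "\<forall>\<^sub>F z in nhds 0. jac_det (bar h) z = 0"
    for h :: "(complex ^ 'n::finite) \<times> complex \<Rightarrow> complex ^ 'n"
  proof -
    have "\<forall>\<^sub>F z in nhds 0. jac_det h (conj z) = 0"
      using jac_det_bar_eventually[OF h] z by eventually_elim simp
    then show ?thesis by (rule eventually_nhds_conj_iff[THEN iffD1])
  qed
  then show ?thesis using assms unfolding totally_segre_nondegenerate_def by blast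
qed

text \<open>Each of the two Jacobian determinants is a multiple of the other by a germ continuous at the origin: apply
\<open>det_ratio_continuous\<close> to the map and its dual in both orders. Each of the two is the partner that the transversality of
the other requires.\<close>

lemma jacobian_ratio:
  fixes f ft :: "(complex ^ 'n::finite) \<times> complex \<Rightarrow> complex ^ 'n"
  assumes S: "segre_preserving Q Q' f g ft gt"
    and Q: "normal_coordinates M Q" and Q': "normal_coordinates M' Q'"
    and fin: "finitely_nondegenerate Q'" and nd: "totally_segre_nondegenerate f ft"
  shows "(\<exists>u. isCont u 0 \<and> (\<forall>\<^sub>F z in nhds 0. jac_det f z = u z * jac_det (bar ft) z)) \<and>
    (\<exists>u. isCont u 0 \<and> (\<forall>\<^sub>F z in nhds 0. jac_det (bar ft) z = u z * jac_det f z))"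
proof -
  have hol: "holomorphic_near f 0" "holomorphic_near g 0" "holomorphic_near ft 0" "holomorphic_near gt 0"
    using S unfolding segre_preserving_def by blast+
  have S2: "segre_preserving Q Q' (bar ft) (bar gt) (bar f) (bar g)"
    by (rule segre_preserving_dual[OF S Q Q'])
  have nd2: "totally_segre_nondegenerate (bar ft) (bar f)"
    by (rule totally_segre_nondegenerate_dual[OF nd hol(1,3)])
  define A where "A = target_covector Q Q' f ft gt"
  define A' where "A' = target_covector Q Q' (bar ft) (bar f) (bar g)"
  define sys where "sys \<rho> \<longleftrightarrow> covector_system \<rho> A (source_covector Q) (tangential_jacobian f)
      (normal_deriv g) (normal_deriv_vec f) \<and>
    (\<forall>\<xi>\<in>ball 0 \<rho>. transversal_factor A (normal_deriv g) (normal_deriv_vec f) (0, \<xi>) = normal_deriv gt \<xi>)"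
    for \<rho>
  define sys' where "sys' \<rho> \<longleftrightarrow> covector_system \<rho> A' (source_covector Q) (tangential_jacobian (bar ft))
      (normal_deriv (bar gt)) (normal_deriv_vec (bar ft)) \<and>
    (\<forall>\<xi>\<in>ball 0 \<rho>. transversal_factor A' (normal_deriv (bar gt)) (normal_deriv_vec (bar ft)) (0, \<xi>) =
      normal_deriv (bar g) \<xi>)"
    for \<rho>
  obtain r1 where r1: "r1 > 0" "\<And>\<rho>. 0 < \<rho> \<and> \<rho> \<le> r1 \<Longrightarrow> sys \<rho>"
    using covector_system_exists[OF S Q Q' fin nd] unfolding sys_def A_def by blast
  obtain r2 where r2: "r2 > 0" "\<And>\<rho>. 0 < \<rho> \<and> \<rho> \<le> r2 \<Longrightarrow> sys' \<rho>"
    using covector_system_exists[OF S2 Q Q' fin nd2] unfolding sys'_def A'_def by blast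
  have nb: "\<forall>\<^sub>F z in nhds 0. normal_deriv (bar h) z = cnj (normal_deriv h (conj z))"
    if "holomorphic_near h 0" for h :: "(complex ^ 'n) \<times> complex \<Rightarrow> complex"
  proof -
    have "\<forall>\<^sub>F z in nhds 0. cdiff h (conj z, 0)"
      by (rule eventually_nhds_compose[where h = "\<lambda>z. (conj z, 0)"])
        (use that in \<open>auto simp: zero_prod_def[symmetric] holomorphic_near_iff intro!: continuous_intros\<close>)
    then show ?thesis by eventually_elim (simp add: normal_deriv_def dird_bar)
  qed
  obtain r3 where r3: "r3 > 0" "\<And>z. z \<in> ball 0 r3 \<Longrightarrow> normal_deriv (bar gt) z = cnj (normal_deriv gt (conj z)) \<and>
      normal_deriv (bar g) z = cnj (normal_deriv g (conj z)) \<and>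
      normal_deriv (bar gt) (conj z) = cnj (normal_deriv gt z)"
  proof -
    have "\<forall>\<^sub>F z in nhds 0. normal_deriv (bar gt) (conj z) = cnj (normal_deriv gt (conj (conj z)))"
      by (rule eventually_nhds_conj_iff[THEN iffD2, OF nb[OF hol(4)]])
    with nb[OF hol(4)] nb[OF hol(2)]
    have "\<forall>\<^sub>F z in nhds 0. normal_deriv (bar gt) z = cnj (normal_deriv gt (conj z)) \<and>
      normal_deriv (bar g) z = cnj (normal_deriv g (conj z)) \<and>
      normal_deriv (bar gt) (conj z) = cnj (normal_deriv gt z)"
      by eventually_elim (simp add: conj_conj)
    from eventually_nhds_0_ball[OF this] that show ?thesis by blast
  qed
  define \<rho> where "\<rho> = min r1 (min r2 r3)"
  have \<rho>: "0 < \<rho> \<and> \<rho> \<le> r1" "0 < \<rho> \<and> \<rho> \<le> r2" "\<rho> \<le> r3"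
    using r1(1) r2(1) r3(1) by (auto simp: \<rho>_def)
  have s1: "covector_system \<rho> A (source_covector Q) (tangential_jacobian f) (normal_deriv g) (normal_deriv_vec f)"
    and b1: "\<And>\<xi>. \<xi> \<in> ball 0 \<rho> \<Longrightarrow>
      transversal_factor A (normal_deriv g) (normal_deriv_vec f) (0, \<xi>) = normal_deriv gt \<xi>"
    using r1(2)[OF \<rho>(1)] unfolding sys_def by blast+
  have s2: "covector_system \<rho> A' (source_covector Q) (tangential_jacobian (bar ft))
      (normal_deriv (bar gt)) (normal_deriv_vec (bar ft))"
    and b2: "\<And>\<xi>. \<xi> \<in> ball 0 \<rho> \<Longrightarrow>
      transversal_factor A' (normal_deriv (bar gt)) (normal_deriv_vec (bar ft)) (0, \<xi>) = normal_deriv (bar g) \<xi>"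
    using r2(2)[OF \<rho>(2)] unfolding sys'_def by blast+
  have t1: "transversal_factor A (normal_deriv g) (normal_deriv_vec f) (0, 0) \<noteq> 0"
  proof (rule transversal_pair[OF s1 s2])
    fix \<xi> :: "complex ^ 'n" assume \<xi>: "\<xi> \<in> ball 0 \<rho>"
    then have "\<xi> \<in> ball 0 r3" using \<rho>(3) by auto
    then show "transversal_factor A (normal_deriv g) (normal_deriv_vec f) (0, \<xi>) =
        cnj (normal_deriv (bar gt) (conj \<xi>))"
      using b1[OF \<xi>] r3(2) by simp
  qed
  have t2: "transversal_factor A' (normal_deriv (bar gt)) (normal_deriv_vec (bar ft)) (0, 0) \<noteq> 0"
  proof (rule transversal_pair[OF s2 s1])
    fix \<xi> :: "complex ^ 'n" assume \<xi>: "\<xi> \<in> ball 0 \<rho>"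
    then have "\<xi> \<in> ball 0 r3" using \<rho>(3) by auto
    then show "transversal_factor A' (normal_deriv (bar gt)) (normal_deriv_vec (bar ft)) (0, \<xi>) =
        cnj (normal_deriv g (conj \<xi>))"
      using b2[OF \<xi>] r3(2) by simp
  qed
  have "jac_det h z = det (tangential_jacobian h z)" for h :: "(complex ^ 'n) \<times> complex \<Rightarrow> complex ^ 'n" and z
    by (simp add: jac_det_def tangential_jacobian_def)
  then show ?thesis
    using det_ratio_continuous[OF s1 s2 t1 t2] det_ratio_continuous[OF s2 s1 t2 t1] by simp
qed

section \<open>Lowest homogeneous terms\<close>

lemma homogeneous_polynomial_scale:
  assumes "homogeneous_polynomial l P"
  shows "P (cscale t z) = t ^ l * P z"
proof -
  obtain a where a: "\<And>z. P z = (\<Sum>\<alpha> | mabs \<alpha> = l. a \<alpha> * (\<Prod>i\<in>UNIV. (z $ i) ^ \<alpha> i))"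
    using assms unfolding homogeneous_polynomial_def by blast
  have "P (cscale t z) = (\<Sum>\<alpha> | mabs \<alpha> = l. t ^ l * (a \<alpha> * (\<Prod>i\<in>UNIV. (z $ i) ^ \<alpha> i)))"
    unfolding a
  proof (rule sum.cong[OF refl])
    fix \<alpha> :: "'a \<Rightarrow> nat" assume "\<alpha> \<in> {\<alpha>. mabs \<alpha> = l}"
    then have "(\<Prod>i\<in>UNIV. t ^ \<alpha> i) = t ^ l" by (simp add: mabs_def power_sum[symmetric])
    then show "a \<alpha> * (\<Prod>i\<in>UNIV. (cscale t z $ i) ^ \<alpha> i) = t ^ l * (a \<alpha> * (\<Prod>i\<in>UNIV. (z $ i) ^ \<alpha> i))"
      by (simp add: power_mult_distrib prod.distrib)
  qed
  then show ?thesis by (simp add: a sum_distrib_left)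
qed

text \<open>Along a complex line the expansion into homogeneous terms is a power series in the parameter of the line.\<close>

lemma leading_term_limit:
  fixes p :: "nat \<Rightarrow> 'a::complex_space \<Rightarrow> complex"
  assumes hom: "\<And>l t z. p l (cscale t z) = t ^ l * p l z"
    and F: "\<forall>\<^sub>F z in nhds 0. (\<lambda>l. p l z) sums F z" and low: "\<And>l. l < j \<Longrightarrow> p l = (\<lambda>_. 0)"
  shows "((\<lambda>t. F (cscale t z) / t ^ j) \<longlongrightarrow> p j z) (at 0)"
proof -
  have "isCont (\<lambda>t. cscale t z) 0"
    by (intro bounded_linear.isCont[OF bounded_linear_cscale_left] continuous_ident)
  then have "\<forall>\<^sub>F t in nhds 0. (\<lambda>l. p l (cscale t z)) sums F (cscale t z)"
    using F by (intro eventually_nhds_compose[where h = "\<lambda>t. cscale t z"]) auto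
  from eventually_nhds_0_ball[OF this] obtain r where r: "r > 0"
      "\<And>t. t \<in> ball 0 r \<Longrightarrow> (\<lambda>l. p l (cscale t z)) sums F (cscale t z)" by blast
  have "((\<lambda>t. F (cscale t z) / t ^ j) \<longlongrightarrow> p (0 + j) z) (at 0)"
  proof (rule powser_limit_0_strong[OF r(1)])
    fix t :: complex assume t: "t \<noteq> 0" "norm t < r"
    have "(\<lambda>l. p l (cscale t z)) sums (F (cscale t z) + (\<Sum>l<j. p l (cscale t z)))"
      using r(2)[of t] t low by simp
    then have "(\<lambda>l. p (l + j) (cscale t z)) sums F (cscale t z)" by (rule sums_iff_shift[THEN iffD2])
    then have "(\<lambda>l. p (l + j) (cscale t z) / t ^ j) sums (F (cscale t z) / t ^ j)"
      by (rule sums_divide)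
    moreover have "p (l + j) (cscale t z) / t ^ j = p (l + j) z * t ^ l" for l
      using t(1) by (simp add: hom power_add)
    ultimately show "(\<lambda>l. p (l + j) z * t ^ l) sums (F (cscale t z) / t ^ j)" by simp
  qed
  then show ?thesis by simp
qed

text \<open>The factor \<open>0 ^ d\<close> treats two cases at once: it is \<open>1\<close> if the two orders agree and \<open>0\<close> if
the order of \<open>G\<close> exceeds that of \<open>F\<close>.\<close>

lemma leading_terms_of_multiple:
  fixes F G u :: "'a::complex_space \<Rightarrow> complex"
  assumes u: "isCont u 0" and FG: "\<forall>\<^sub>F z in nhds 0. F z = u z * G z"
    and F: "((\<lambda>t. F (cscale t z) / t ^ j) \<longlongrightarrow> a) (at 0)"
    and G: "((\<lambda>t. G (cscale t z) / t ^ (j + d)) \<longlongrightarrow> c) (at 0)"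
  shows "a = u 0 * (0 ^ d * c)"
proof -
  have cs: "isCont (\<lambda>t. cscale t z) 0"
    by (intro bounded_linear.isCont[OF bounded_linear_cscale_left] continuous_ident)
  have "isCont (\<lambda>t. u (cscale t z)) 0" by (rule isCont_o2[OF cs]) (simp add: u)
  then have "((\<lambda>t. u (cscale t z)) \<longlongrightarrow> u 0) (at 0)" by (auto simp: isCont_def)
  moreover have "((\<lambda>t :: complex. t ^ d) \<longlongrightarrow> 0 ^ d) (at 0)" by (intro tendsto_intros)
  ultimately have "((\<lambda>t. u (cscale t z) * (t ^ d * (G (cscale t z) / t ^ (j + d)))) \<longlongrightarrow> u 0 * (0 ^ d * c)) (at 0)"
    using G by (intro tendsto_mult)
  moreover have "\<forall>\<^sub>F t in at 0. u (cscale t z) * (t ^ d * (G (cscale t z) / t ^ (j + d))) = F (cscale t z) / t ^ j"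
  proof -
    have "\<forall>\<^sub>F t in nhds 0. F (cscale t z) = u (cscale t z) * G (cscale t z)"
      by (rule eventually_nhds_compose[where h = "\<lambda>t. cscale t z", OF _ cs]) (simp add: FG)
    then have "\<forall>\<^sub>F t in at 0. F (cscale t z) = u (cscale t z) * G (cscale t z)"
      by (simp add: eventually_nhds_conv_at)
    moreover have "\<forall>\<^sub>F t in at (0 :: complex). t \<noteq> 0" by (simp add: eventually_at_filter)
    ultimately show ?thesis by eventually_elim (simp add: power_add)
  qed
  ultimately have "((\<lambda>t. F (cscale t z) / t ^ j) \<longlongrightarrow> u 0 * (0 ^ d * c)) (at 0)"
    by (rule Lim_transform_eventually)
  with F show ?thesis by (rule tendsto_unique[OF trivial_limit_at])
qed

theorem theorem1p5:
  fixes M M' :: "((complex ^ 'n::finite) \<times> complex) set"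
    and Q Q' :: "(complex ^ 'n) \<times> (complex ^ 'n) \<times> complex \<Rightarrow> complex"
    and f ft :: "(complex ^ 'n) \<times> complex \<Rightarrow> complex ^ 'n"
    and g gt :: "(complex ^ 'n) \<times> complex \<Rightarrow> complex"
    and p q :: "nat \<Rightarrow> complex ^ 'n \<Rightarrow> complex"
    and j0 k0 :: nat
  assumes "real_analytic_hypersurface M" and "0 \<in> M" and "normal_coordinates M Q"
    and "real_analytic_hypersurface M'" and "0 \<in> M'" and "normal_coordinates M' Q'"
    and "finitely_nondegenerate Q'"
    and "HSPM Q Q' f g ft gt"
    and "totally_segre_nondegenerate f ft"
    and "\<And>l. homogeneous_polynomial l (p l)"
    and "\<And>l. homogeneous_polynomial l (q l)"
    and "\<forall>\<^sub>F z in nhds 0. (\<lambda>j. p j z) sums jac_det f z"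
    and "\<forall>\<^sub>F \<xi> in nhds 0. (\<lambda>k. q k \<xi>) sums jac_det ft \<xi>"
    and "p j0 \<noteq> (\<lambda>_. 0)" and "\<And>j. j < j0 \<Longrightarrow> p j = (\<lambda>_. 0)"
    and "q k0 \<noteq> (\<lambda>_. 0)" and "\<And>k. k < k0 \<Longrightarrow> q k = (\<lambda>_. 0)"
  shows "j0 = k0 \<and> (\<exists>c. c \<noteq> 0 \<and> (\<forall>z. p j0 z = c * bar (q k0) z))"
proof -
  have S: "segre_preserving Q Q' f g ft gt"
    by (rule HSPM_imp_segre_preserving[OF assms(8,3)])
  then have hol: "holomorphic_near ft 0" unfolding segre_preserving_def by blast
  obtain u where u: "isCont u 0" "\<forall>\<^sub>F z in nhds 0. jac_det f z = u z * jac_det (bar ft) z"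
    using jacobian_ratio[OF S assms(3,6,7,9)] by blast
  obtain v where v: "isCont v 0" "\<forall>\<^sub>F z in nhds 0. jac_det (bar ft) z = v z * jac_det f z"
    using jacobian_ratio[OF S assms(3,6,7,9)] by blast
  have P: "((\<lambda>t. jac_det f (cscale t z) / t ^ j0) \<longlongrightarrow> p j0 z) (at 0)" for z
    by (rule leading_term_limit[OF homogeneous_polynomial_scale[OF assms(10)] assms(12,15)])
  have R: "((\<lambda>t. jac_det (bar ft) (cscale t z) / t ^ k0) \<longlongrightarrow> bar (q k0) z) (at 0)" for z
  proof (rule leading_term_limit[where p = "\<lambda>k. bar (q k)"])
    show "bar (q l) (cscale t z) = t ^ l * bar (q l) z" for l t z
      by (simp add: bar_def conj_cscale homogeneous_polynomial_scale[OF assms(11)])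
    have "\<forall>\<^sub>F z in nhds 0. (\<lambda>k. q k (conj z)) sums jac_det ft (conj z)"
      by (rule eventually_nhds_conj_iff[THEN iffD2, OF assms(13)])
    with jac_det_bar_eventually[OF hol]
    show "\<forall>\<^sub>F z in nhds 0. (\<lambda>k. bar (q k) z) sums jac_det (bar ft) z"
      by eventually_elim (simp add: bar_def sums_cnj)
    show "bar (q l) = (\<lambda>_. 0)" if "l < k0" for l
      by (simp add: bar_def fun_eq_iff assms(17)[OF that])
  qed
  obtain z1 where z1: "p j0 z1 \<noteq> 0" using assms(14) by (auto simp: fun_eq_iff)
  obtain z2 where "q k0 z2 \<noteq> 0" using assms(16) by (auto simp: fun_eq_iff)
  then have z2: "bar (q k0) (conj z2) \<noteq> 0" by (simp add: bar_def conj_conj)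
  have "k0 \<le> j0"
  proof (rule ccontr)
    assume "\<not> k0 \<le> j0"
    then have k: "k0 = j0 + (k0 - j0)" "0 < k0 - j0" by auto
    have "p j0 z1 = u 0 * (0 ^ (k0 - j0) * bar (q k0) z1)"
      by (rule leading_terms_of_multiple[OF u P]) (use R[of z1] k(1) in simp)
    with z1 k(2) show False by simp
  qed
  moreover have "j0 \<le> k0"
  proof (rule ccontr)
    assume "\<not> j0 \<le> k0"
    then have k: "j0 = k0 + (j0 - k0)" "0 < j0 - k0" by auto
    have "bar (q k0) (conj z2) = v 0 * (0 ^ (j0 - k0) * p j0 (conj z2))"
      by (rule leading_terms_of_multiple[OF v R]) (use P[of "conj z2"] k(1) in simp)
    with z2 k(2) show False by simp
  qed
  ultimately have jk: "j0 = k0" by simp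
  have eq: "p j0 z = u 0 * bar (q k0) z" for z
    using leading_terms_of_multiple[OF u P, where d = 0 and z = z and c = "bar (q k0) z"] R[of z]
    by (simp add: jk)
  moreover have "u 0 \<noteq> 0" using eq[of z1] z1 by auto
  ultimately show ?thesis using jk by blast
qed

end
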